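(* Let $\Omega\subset\mathbb{R}^d$ be a bounded Lipschitz domain and let $R>0$ be such that $\delta_\Omega(x)<R$ for all $x\in\Omega$. (i) There exists a constant $C=C(d,\Omega)>0$ (depending only on $d$ and $\Omega$) such that for every integer $m\ge 2$ and all $u\in BV(\Omega)$, $$\int_{\Omega}\frac{|u(x)-(u)_\Omega|}{\delta_\Omega(x)}\,\mathcal{L}_1\!\left(\frac{\delta_\Omega(x)}{R}\right)\cdots\mathcal{L}_{m-1}\!\left(\frac{\delta_\Omega(x)}{R}\right)\mathcal{L}_m^2\!\left(\frac{\delta_\Omega(x)}{R}\right)dx\le C\,2^m\,[u]_{BV(\Omega)}.$$ (ii) For any $0<\alpha<\frac12$, there exists a constant $C=C(d,\Omega)>0$ (depending only on $d$ and $\Omega$) such that for all $u\in BV(\Omega)$, $$\sum_{m=2}^\infty\alpha^m\int_{\Omega}\frac{|u(x)-(u)_\Omega|}{\delta_\Omega(x)}\,\mathcal{L}_1\!\left(\frac{\delta_\Omega(x)}{R}\right)\cdots\mathcal{L}_{m-1}\!\left(\frac{\delta_\Omega(x)}{R}\right)\mathcal{L}_m^2\!\left(\frac{\delta_\Omega(x)}{R}\right)dx\le C\left(\frac{4\alpha^2}{1-2\alpha}\right)[u]_{BV(\Omega)}.$$ (iii) The series inequality in (ii) fails when $\alpha\ge1$: for $\alpha\geq 1$ there is no finite constant $C'$ such that the left-hand side of the inequality in (ii) is at most $C'[u]_{BV(\Omega)}$ for all $u\in BV(\Omega)$.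
   Context: For a bounded domain $\Omega\subset\mathbb{R}^d$, $d\ge1$, $\delta_\Omega(x)=\min_{y\in\partial\Omega}|x-y|$ is the distance to the boundary. The functions $\mathcal{L}_m$ are defined on $(0,1)$ by $\mathcal{L}_1(t)=\frac{1}{1-\ln t}$ and recursively $\mathcal{L}_m(t)=\mathcal{L}_1(\mathcal{L}_{m-1}(t))$ for $m\ge2$; $\mathcal{L}_m^2(t)$ means $(\mathcal{L}_m(t))^2$. A function $u\in L^1(\Omega)$ belongs to $BV(\Omega)$ if $[u]_{BV(\Omega)}:=\sup\{\int_\Omega u\,\mathrm{div}(\phi)\,dx:\phi\in C_c^1(\Omega;\mathbb{R}^d),\ |\phi(x)|\le1\text{ on }\Omega\}<\infty$. The average of $u$ is $(u)_\Omega=\frac1{|\Omega|}\int_\Omega u(y)\,dy$. *)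

theory Defs
  imports "HOL-Analysis.Analysis"
begin

text \<open>The graph function \<open>g\<close> only matters on the hyperplane orthogonal to \<open>e\<close>, which plays the
  role of \<open>\<real>\<close> to the power \<open>d - 1\<close> after a rotation; for \<open>d = 1\<close> it is \<open>{0}\<close>.
  A domain is a nonempty connected open set.\<close>

definition lipschitz_domain :: "(real ^ 'n) set \<Rightarrow> bool" where
  "lipschitz_domain \<Omega> \<longleftrightarrow>
     open \<Omega> \<and> connected \<Omega> \<and> \<Omega> \<noteq> {} \<and>
     (\<forall>p\<in>frontier \<Omega>. \<exists>e r L. \<exists>g :: real ^ 'n \<Rightarrow> real.
        norm e = 1 \<and> r > 0 \<and> L-lipschitz_on {y. y \<bullet> e = 0} g \<and>
        \<Omega> \<inter> ball p r = {x \<in> ball p r. g (x - (x \<bullet> e) *\<^sub>R e) < x \<bullet> e})"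

definition bdist :: "(real ^ 'n) set \<Rightarrow> real ^ 'n \<Rightarrow> real" where
  "bdist \<Omega> x = infdist x (frontier \<Omega>)"

text \<open>Index \<open>0\<close> is the identity, so that index \<open>m\<close> is the \<open>m\<close>-fold iterate of
  \<open>t \<mapsto> 1 / (1 - ln t)\<close>. Only arguments in \<open>{0<..<1}\<close> are meaningful.\<close>

primrec iter_log :: "nat \<Rightarrow> real \<Rightarrow> real" where
  "iter_log 0 t = t"
| "iter_log (Suc m) t = 1 / (1 - ln (iter_log m t))"

lemma iter_log_1: "iter_log 1 t = 1 / (1 - ln t)"
  by simp

lemma iter_log_rec: "m \<ge> 2 \<Longrightarrow> iter_log m t = iter_log 1 (iter_log (m - 1) t)"
  by (cases m) auto

definition divergence :: "(real ^ 'n \<Rightarrow> real ^ 'n) \<Rightarrow> real ^ 'n \<Rightarrow> real" where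
  "divergence \<phi> x = (\<Sum>i\<in>UNIV. frechet_derivative \<phi> (at x) (axis i 1) $ i)"

text \<open>Compactly supported \<open>C\<^sup>1\<close> fields on the open set \<open>\<Omega>\<close>, extended by zero to the whole space,
  and bounded by \<open>1\<close>.\<close>

definition test_fields :: "(real ^ 'n) set \<Rightarrow> (real ^ 'n \<Rightarrow> real ^ 'n) set" where
  "test_fields \<Omega> = {\<phi>.
     (\<exists>\<phi>' :: real ^ 'n \<Rightarrow> (real ^ 'n) \<Rightarrow>\<^sub>L (real ^ 'n).
        (\<forall>x. (\<phi> has_derivative blinfun_apply (\<phi>' x)) (at x)) \<and> continuous_on UNIV \<phi>') \<and>
     compact (closure {x. \<phi> x \<noteq> 0}) \<and> closure {x. \<phi> x \<noteq> 0} \<subseteq> \<Omega> \<and>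
     (\<forall>x\<in>\<Omega>. norm (\<phi> x) \<le> 1)}"

lemma zero_in_test_fields: "(\<lambda>x. 0) \<in> test_fields \<Omega>"
  by (auto simp: test_fields_def zero_blinfun.rep_eq intro!: exI[of _ "\<lambda>x. 0"])

text \<open>Clipping negative integrals to \<open>0\<close> does not change the supremum, since the zero field is
  admissible.\<close>

definition bv_seminorm :: "(real ^ 'n) set \<Rightarrow> (real ^ 'n \<Rightarrow> real) \<Rightarrow> ennreal" where
  "bv_seminorm \<Omega> u =
     (SUP \<phi>\<in>test_fields \<Omega>. ennreal (LINT x:\<Omega>|lebesgue. u x * divergence \<phi> x))"

definition BV :: "(real ^ 'n) set \<Rightarrow> (real ^ 'n \<Rightarrow> real) set" where
  "BV \<Omega> = {u. u absolutely_integrable_on \<Omega> \<and> bv_seminorm \<Omega> u < \<infinity>}"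

definition average :: "(real ^ 'n) set \<Rightarrow> (real ^ 'n \<Rightarrow> real) \<Rightarrow> real" where
  "average \<Omega> u = (LINT y:\<Omega>|lebesgue. u y) / measure lebesgue \<Omega>"

text \<open>The integrand is nonnegative on \<open>\<Omega>\<close> whenever \<open>bdist \<Omega> x < R\<close> there, so the integral is taken
  in the extended nonnegative reals; it may be infinite.\<close>

definition hardy_integral ::
    "(real ^ 'n) set \<Rightarrow> real \<Rightarrow> nat \<Rightarrow> (real ^ 'n \<Rightarrow> real) \<Rightarrow> ennreal" where
  "hardy_integral \<Omega> R m u =
     (\<integral>\<^sup>+x\<in>\<Omega>. ennreal (\<bar>u x - average \<Omega> u\<bar> / bdist \<Omega> x *
        (\<Prod>k=1..m - 1. iter_log k (bdist \<Omega> x / R)) * (iter_log m (bdist \<Omega> x / R))\<^sup>2) \<partial>lebesgue)"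

definition hardy_series ::
    "(real ^ 'n) set \<Rightarrow> real \<Rightarrow> real \<Rightarrow> (real ^ 'n \<Rightarrow> real) \<Rightarrow> ennreal" where
  "hardy_series \<Omega> R \<alpha> u = (\<Sum>m. ennreal (\<alpha> ^ (m + 2)) * hardy_integral \<Omega> R (m + 2) u)"

end

theory Submission
  imports Defs
begin

text \<open>The weight with index \<open>m\<close> is the derivative of \<open>t \<mapsto> L\<^sub>m(t / R)\<close> at \<open>t = \<delta>\<^sub>\<Omega>(x)\<close>, so
  along lines transversal to the boundary it has mass at most \<open>1\<close>, uniformly in \<open>m\<close> and \<open>R\<close>. Near a
  boundary point, the part of \<open>\<Omega>\<close> with \<open>\<delta>\<^sub>\<Omega> < a\<close> meets every line in the direction of the chart in a
  set of length \<open>O(a)\<close>; by duality and translation along these lines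
  the integral of \<open>|u - c|\<close> over it is \<open>O(a) [u]\<close>. Summing over dyadic \<open>a\<close> and gluing finitely many charts and
  interior balls (connectedness of \<open>\<Omega>\<close>) bounds all the integrals by one constant times \<open>[u]\<close>, which
  gives (i) and (ii). Conversely, for \<open>u = \<delta>\<^sub>\<Omega>\<close> the difference \<open>|u - (u)\<^sub>\<Omega>|\<close> is bounded below near the
  boundary, where the weights keep a fixed amount of mass; the terms of the series then stay away from
  zero if \<open>\<alpha> \<ge> 1\<close>.\<close>

section \<open>Iterated logarithms\<close>

text \<open>The obstacle is the factor 1/\<delta>: the layer estimate O(a) [u] bounds each dyadic
  shell only by a constant, and infinitely many constants diverge. The sum is saved by the remaining
  factor of the weight: its values at the points 2^-k are dominated by the increments of
  \<open>iter_log m\<close> between consecutive dyadic points, and these telescope to at most 1,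
  whatever m is. To obtain a constant that depends on \<Omega> alone, each local estimate is proved
  for all admissible R and m at once. The seminorm enters through its dual definition: u is not
  approximated by smooth functions; explicit test fields are built whose divergence is a difference
  of two translates. Since the resulting bound does not grow with m, (i) follows from 1 \<le> 2^m,
  and (ii) from \<alpha>^2 / (1 - \<alpha>) \<le> 4 \<alpha>^2 / (1 - 2 \<alpha>).\<close>

lemma iter_log_pos_le_1:
  assumes "0 < t" "t \<le> 1"
  shows "0 < iter_log m t \<and> iter_log m t \<le> 1"
proof (induction m)
  case (Suc m)
  then have "ln (iter_log m t) \<le> 0" by simp
  then show ?case by (simp add: divide_simps)
qed (use assms in simp)

lemmas iter_log_pos = iter_log_pos_le_1[THEN conjunct1]
  and iter_log_le_1 = iter_log_pos_le_1[THEN conjunct2]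

text \<open>One step of the iteration does not decrease its argument: s \<le> 1 / (1 - ln s) on
  (0,1], because ln (1/s) \<le> 1/s - 1. The bound holds for every m at once, which later keeps the
  lower bound for (iii) uniform in m.\<close>

lemma le_iter_log:
  assumes "0 < t" "t \<le> 1"
  shows "t \<le> iter_log m t"
proof (induction m)
  case (Suc m)
  let ?s = "iter_log m t"
  have s: "0 < ?s" "?s \<le> 1" using iter_log_pos_le_1[OF assms] by auto
  have "- ln ?s \<le> 1 / ?s - 1"
    using ln_le_minus_one[of "1 / ?s"] s by (simp add: ln_div)
  then have "1 - ln ?s \<le> 1 / ?s" by simp
  moreover have "0 < 1 - ln ?s" using s by (smt (verit) ln_le_zero_iff)
  ultimately have "?s \<le> 1 / (1 - ln ?s)" using s by (simp add: field_simps)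
  with Suc show ?case by simp
qed simp

lemma iter_log_mono:
  assumes "0 < s" "s \<le> t" "t \<le> 1"
  shows "iter_log m s \<le> iter_log m t"
proof (induction m)
  case (Suc m)
  have "0 < iter_log m s" "iter_log m t \<le> 1" using iter_log_pos_le_1 assms by auto
  with Suc have "ln (iter_log m s) \<le> ln (iter_log m t)" "ln (iter_log m t) \<le> 0" by auto
  then show ?case by (auto intro!: divide_left_mono)
qed (use assms in simp)

text \<open>The induction carries the one-sided filter \<open>at_right 0\<close>, because the
  divergence of \<open>ln\<close> is available only there; convergence to 0 alone does not pass
  positivity on to the next step.\<close>

lemma iter_log_tendsto_0:
  assumes "\<And>n. 0 < a n" "a \<longlonglongrightarrow> 0"
  shows "(\<lambda>n. iter_log m (a n)) \<longlonglongrightarrow> 0"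
proof -
  have "filterlim (\<lambda>n. iter_log m (a n)) (at_right 0) sequentially"
  proof (induction m)
    case 0
    have "a n \<noteq> 0" for n using assms(1)[of n] by simp
    then show ?case using assms by (simp add: filterlim_at)
  next
    case (Suc m)
    have "filterlim (\<lambda>n. ln (iter_log m (a n))) at_bot sequentially"
      by (rule filterlim_compose[OF ln_at_0 Suc])
    then have "filterlim (\<lambda>n. 1 - ln (iter_log m (a n))) at_top sequentially"
      using filterlim_tendsto_add_at_top[OF tendsto_const[of "1::real"],
          of "\<lambda>n. - ln (iter_log m (a n))" sequentially]
      by (simp add: filterlim_uminus_at_top)
    then have "filterlim (\<lambda>n. inverse (1 - ln (iter_log m (a n)))) (at_right 0) sequentially"
      by (rule filterlim_compose[OF filterlim_inverse_at_right_top])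
    then show ?case by (simp add: inverse_eq_divide)
  qed
  then show ?thesis by (simp add: filterlim_at)
qed

section \<open>Weights without the factor 1/\<delta>, and their dyadic sums\<close>

text \<open>With the factor 1/t split off, what remains is increasing and at most 1 on (0,1]. This
  monotonicity allows values to be compared across a dyadic shell, where 1/t varies by a factor of
  2.\<close>

definition log_weight :: "nat \<Rightarrow> real \<Rightarrow> real" where
  "log_weight m t = (\<Prod>k=1..m - 1. iter_log k t) * (iter_log m t)\<^sup>2"

lemma log_weight_nonneg: "0 < t \<Longrightarrow> t \<le> 1 \<Longrightarrow> 0 \<le> log_weight m t"
  by (auto simp: log_weight_def intro!: mult_nonneg_nonneg prod_nonneg dest: iter_log_pos less_imp_le)

lemma log_weight_mono:
  assumes "0 < s" "s \<le> t" "t \<le> 1"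
  shows "log_weight m s \<le> log_weight m t"
  unfolding log_weight_def
  using assms iter_log_mono[OF assms] iter_log_pos[of s] iter_log_pos[of t]
  by (intro mult_mono prod_mono power_mono prod_nonneg) (auto intro: less_imp_le)

lemma log_weight_le_1:
  assumes "0 < t" "t \<le> 1"
  shows "log_weight m t \<le> 1"
proof -
  have "log_weight m t \<le> log_weight m 1" using assms by (intro log_weight_mono) auto
  also have "iter_log k 1 = 1" for k by (induction k) auto
  then have "log_weight m 1 = 1" by (simp add: log_weight_def)
  finally show ?thesis .
qed

text \<open>Induction by the chain rule: with s the m-th iterate, the derivative of 1 / (1 - ln s)
  is s'/s times the square of the new iterate. Dividing by s turns the squared last factor of the
  old weight into a simple one, so the square always sits on the last factor.\<close>

lemma DERIV_iter_log:
  assumes "0 < t" "t \<le> 1" "1 \<le> m"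
  shows "(iter_log m has_real_derivative log_weight m t / t) (at t)"
  using assms(3)
proof (induction m rule: nat_induct_at_least)
  case base
  have "1 - ln t \<noteq> 0" using assms by (smt (verit) ln_le_zero_iff)
  then show ?case using assms
    by (auto intro!: derivative_eq_intros simp: log_weight_def power2_eq_square divide_simps)
next
  case (Suc m)
  have pos: "0 < iter_log m t" "iter_log m t \<le> 1" using iter_log_pos_le_1 assms by auto
  then have nz: "1 - ln (iter_log m t) \<noteq> 0" by (smt (verit) ln_le_zero_iff)
  have "(\<Prod>k=1..m. iter_log k t) = (\<Prod>k=1..m - 1. iter_log k t) * iter_log m t"
    using Suc(1) by (cases m) (auto simp del: iter_log.simps)
  then have eq: "log_weight (Suc m) t / t = (log_weight m t / t) / iter_log m t / (1 - ln (iter_log m t))\<^sup>2"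
    using pos by (simp add: log_weight_def power2_eq_square)
  have "(iter_log (Suc m) has_real_derivative
      (log_weight m t / t) / iter_log m t / (1 - ln (iter_log m t))\<^sup>2) (at t)"
    unfolding iter_log.simps using pos nz
    by (auto intro!: derivative_eq_intros Suc.IH simp: power2_eq_square divide_simps)
  then show ?case by (simp only: eq)
qed

lemma iter_log_double_mvt:
  assumes "0 < a" "2 * a \<le> 1" "1 \<le> m"
  obtains z where "a < z" "z < 2 * a" "iter_log m (2 * a) - iter_log m a = a * (log_weight m z / z)"
  using MVT2[of a "2 * a" "iter_log m" "\<lambda>t. log_weight m t / t"] DERIV_iter_log assms by force

text \<open>Mean value theorem on [a, 2a]: by monotonicity the weight at a is at most that at the
  intermediate point z, and a/z > 1/2 costs the factor 2.\<close>

lemma log_weight_le_double: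
  assumes "0 < a" "2 * a \<le> 1" "1 \<le> m"
  shows "log_weight m a \<le> 2 * (iter_log m (2 * a) - iter_log m a)"
proof -
  obtain z where z: "a < z" "z < 2 * a" "iter_log m (2 * a) - iter_log m a = a * (log_weight m z / z)"
    using iter_log_double_mvt[OF assms] .
  have "log_weight m a \<le> log_weight m z" "0 \<le> log_weight m z"
    using z assms by (auto intro!: log_weight_mono log_weight_nonneg)
  moreover have "log_weight m z * 1 \<le> log_weight m z * (2 * (a / z))"
    using calculation z assms by (intro mult_left_mono) auto
  moreover have "2 * (iter_log m (2 * a) - iter_log m a) = log_weight m z * (2 * (a / z))"
    using z(3) by simp
  ultimately show ?thesis by linarith
qed

text \<open>The same intermediate point, now with a/z < 1 and the weight estimated by its value at
  the right end.\<close>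

lemma double_le_log_weight:
  assumes "0 < a" "2 * a \<le> 1" "1 \<le> m"
  shows "iter_log m (2 * a) - iter_log m a \<le> log_weight m (2 * a)"
proof -
  obtain z where z: "a < z" "z < 2 * a" "iter_log m (2 * a) - iter_log m a = a * (log_weight m z / z)"
    using iter_log_double_mvt[OF assms] .
  have "log_weight m z \<le> log_weight m (2 * a)" "0 \<le> log_weight m z"
    using z assms by (auto intro!: log_weight_mono log_weight_nonneg)
  moreover have "log_weight m z * (a / z) \<le> log_weight m z * 1"
    using calculation z assms by (intro mult_left_mono) auto
  moreover have "iter_log m (2 * a) - iter_log m a = log_weight m z * (a / z)"
    using z(3) by simp
  ultimately show ?thesis by linarith
qed

text \<open>Every scale below 1 contributes at most twice an increment of \<open>iter_log m\<close>,
  and the increments telescope to at most 1. The scale 1 has no dyadic point above it in (0,1] and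
  is bounded by 1 directly. Hence 3 = 1 + 2.\<close>

lemma sum_log_weight_le:
  assumes "1 \<le> m"
  shows "(\<Sum>k<n. log_weight m (1 / 2 ^ k)) \<le> 3"
proof -
  \<comment> \<open>The negative term is the part of the telescoping sum not yet used up; it makes
    the induction close.\<close>
  have "(\<Sum>k<Suc n. log_weight m (1 / 2 ^ k)) \<le> 3 - 2 * iter_log m (1 / 2 ^ n)" for n
  proof (induction n)
    case 0
    have "log_weight m 1 \<le> 1" "iter_log m 1 \<le> 1"
      by (auto intro: log_weight_le_1 iter_log_le_1)
    then show ?case by simp
  next
    case (Suc n)
    have "(1::real) \<le> 2 * 2 ^ n" by (metis one_le_numeral one_le_power power_Suc)
    then have "log_weight m (1 / 2 ^ Suc n) \<le> 2 * (iter_log m (2 * (1 / 2 ^ Suc n)) - iter_log m (1 / 2 ^ Suc n))"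
      using assms by (intro log_weight_le_double) (auto simp: field_simps)
    with Suc show ?case by simp
  qed
  from this[of n] have "(\<Sum>k<Suc n. log_weight m (1 / 2 ^ k)) \<le> 3"
    using iter_log_pos[of "1 / 2 ^ n" m] by (smt (verit) divide_le_eq_1_pos divide_pos_pos one_le_power zero_less_power)
  moreover have "0 \<le> log_weight m (1 / 2 ^ n)" by (intro log_weight_nonneg) auto
  ultimately show ?thesis by simp
qed

text \<open>The sum is bounded below by a telescoping one, equal to \<open>iter_log m a\<close>
  minus a term that tends to 0; what remains is at least a, whatever m is.\<close>

lemma suminf_log_weight_ge:
  assumes "1 \<le> m" "0 < a" "a \<le> 1"
  shows "ennreal a \<le> (\<Sum>k. ennreal (log_weight m (a / 2 ^ k)))"
proof -
  have a: "0 < a / 2 ^ k" "a / 2 ^ k \<le> 1" for k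
    using assms by (auto simp: divide_simps intro: order_trans[of a 1])
  have "iter_log m a - iter_log m (a / 2 ^ n) \<le> (\<Sum>k<n. log_weight m (a / 2 ^ k))" for n
  proof (induction n)
    case (Suc n)
    have "iter_log m (2 * (a / 2 ^ Suc n)) - iter_log m (a / 2 ^ Suc n)
        \<le> log_weight m (2 * (a / 2 ^ Suc n))"
      using a[of n] a[of "Suc n"] assms by (intro double_le_log_weight) auto
    with Suc show ?case by simp
  qed simp
  then have *: "ennreal (iter_log m a - iter_log m (a / 2 ^ n)) \<le> (\<Sum>k. ennreal (log_weight m (a / 2 ^ k)))" for n
    using sum_le_suminf[of "\<lambda>k. ennreal (log_weight m (a / 2 ^ k))" "{..<n}"]
    by (smt (verit) a ennreal_leI log_weight_nonneg order_trans sum.cong sum_ennreal finite_lessThan summableI zero_le)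
  have "(\<lambda>n. a / 2 ^ n) \<longlonglongrightarrow> 0" by (rule LIMSEQ_divide_realpow_zero) simp
  then have "(\<lambda>n. ennreal (iter_log m a - iter_log m (a / 2 ^ n))) \<longlonglongrightarrow> ennreal (iter_log m a - 0)"
    using a by (intro tendsto_intros iter_log_tendsto_0) auto
  then have "ennreal (iter_log m a) \<le> (\<Sum>k. ennreal (log_weight m (a / 2 ^ k)))"
    using * by (auto intro: LIMSEQ_le_const2)
  then show ?thesis using le_iter_log[of a m] assms by (meson ennreal_leI order_trans)
qed

section \<open>Duality for \<open>L\<^sup>1\<close> functions\<close>

text \<open>The derivative is stored as a gradient vector, so that the divergence of a field of
  fixed direction w becomes the inner product of the gradient with w.\<close>

definition C1_fun :: "('a::euclidean_space \<Rightarrow> real) \<Rightarrow> bool" where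
  "C1_fun f \<longleftrightarrow> (\<exists>f'. (\<forall>x. (f has_derivative (\<lambda>v. f' x \<bullet> v)) (at x)) \<and> continuous_on UNIV f')"

lemma C1_funI:
  assumes "\<And>x. (f has_derivative (\<lambda>v. f' x \<bullet> v)) (at x)" "continuous_on UNIV f'"
  shows "C1_fun f"
  using assms by (auto simp: C1_fun_def)

lemma C1_fun_continuous: "C1_fun f \<Longrightarrow> continuous_on UNIV f"
  by (auto simp: C1_fun_def continuous_on_eq_continuous_at intro: has_derivative_continuous)

lemma C1_fun_const: "C1_fun (\<lambda>x. c)"
proof (rule C1_funI)
  show "((\<lambda>x. c) has_derivative (\<lambda>v. 0 \<bullet> v)) (at x)" for x :: 'a
    by (rule has_derivative_eq_rhs[OF has_derivative_const]) simp
qed simp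

lemma C1_fun_linear:
  assumes "bounded_linear f"
  shows "C1_fun f"
proof -
  have "f v = (\<Sum>b\<in>Basis. f b *\<^sub>R b) \<bullet> v" for v
  proof -
    interpret bounded_linear f by fact
    have "f v = f (\<Sum>b\<in>Basis. (v \<bullet> b) *\<^sub>R b)" by (simp add: euclidean_representation)
    also have "\<dots> = (\<Sum>b\<in>Basis. (v \<bullet> b) * f b)" by (simp add: sum scale)
    also have "\<dots> = (\<Sum>b\<in>Basis. f b *\<^sub>R b) \<bullet> v"
      unfolding inner_sum_left by (intro sum.cong) (simp_all add: inner_commute)
    finally show ?thesis .
  qed
  then have eq: "f = (\<lambda>v. (\<Sum>b\<in>Basis. f b *\<^sub>R b) \<bullet> v)" by (rule ext)
  have "(f has_derivative (\<lambda>v. (\<Sum>b\<in>Basis. f b *\<^sub>R b) \<bullet> v)) (at x)" for x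
    by (rule has_derivative_eq_rhs[OF bounded_linear_imp_has_derivative[OF assms] eq])
  then show ?thesis by (rule C1_funI) simp
qed

lemma C1_fun_add:
  assumes "C1_fun f" "C1_fun g"
  shows "C1_fun (\<lambda>x. f x + g x)"
proof -
  obtain f' where f: "\<And>x. (f has_derivative (\<lambda>v. f' x \<bullet> v)) (at x)" "continuous_on UNIV f'"
    using assms(1) unfolding C1_fun_def by blast
  obtain g' where g: "\<And>x. (g has_derivative (\<lambda>v. g' x \<bullet> v)) (at x)" "continuous_on UNIV g'"
    using assms(2) unfolding C1_fun_def by blast
  have "((\<lambda>x. f x + g x) has_derivative (\<lambda>v. (f' x + g' x) \<bullet> v)) (at x)" for x
    using has_derivative_add[OF f(1) g(1)] by (simp add: inner_add_left)
  moreover have "continuous_on UNIV (\<lambda>x. f' x + g' x)" using f g by (intro continuous_intros)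
  ultimately show ?thesis by (rule C1_funI)
qed

lemma C1_fun_mult:
  assumes "C1_fun f" "C1_fun g"
  shows "C1_fun (\<lambda>x. f x * g x)"
proof -
  obtain f' where f: "\<And>x. (f has_derivative (\<lambda>v. f' x \<bullet> v)) (at x)" "continuous_on UNIV f'"
    using assms(1) unfolding C1_fun_def by blast
  obtain g' where g: "\<And>x. (g has_derivative (\<lambda>v. g' x \<bullet> v)) (at x)" "continuous_on UNIV g'"
    using assms(2) unfolding C1_fun_def by blast
  have "((\<lambda>x. f x * g x) has_derivative (\<lambda>v. (f x *\<^sub>R g' x + g x *\<^sub>R f' x) \<bullet> v)) (at x)" for x
    using has_derivative_mult[OF f(1) g(1)] by (simp add: inner_add_left mult.commute)
  moreover have "continuous_on UNIV (\<lambda>x. f x *\<^sub>R g' x + g x *\<^sub>R f' x)"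
    using f g assms by (intro continuous_intros C1_fun_continuous)
  ultimately show ?thesis by (rule C1_funI)
qed

lemma C1_fun_sum:
  assumes "\<And>i. i \<in> I \<Longrightarrow> C1_fun (f i)"
  shows "C1_fun (\<lambda>x. \<Sum>i\<in>I. f i x)"
  using assms
proof (induction I rule: infinite_finite_induct)
  case (insert i I)
  then show ?case by (simp add: C1_fun_add)
qed (simp_all add: C1_fun_const)

lemma C1_fun_compose:
  assumes "C1_fun f" "\<And>x. (g has_real_derivative g' (f x)) (at (f x))" "continuous_on (range f) g'"
  shows "C1_fun (\<lambda>x. g (f x))"
proof -
  obtain f' where f: "\<And>x. (f has_derivative (\<lambda>v. f' x \<bullet> v)) (at x)" "continuous_on UNIV f'"
    using assms(1) unfolding C1_fun_def by blast
  have "((\<lambda>x. g (f x)) has_derivative (\<lambda>v. (g' (f x) *\<^sub>R f' x) \<bullet> v)) (at x)" for x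
    using has_derivative_compose[OF f(1) assms(2)[unfolded has_field_derivative_def]]
    by simp
  moreover have "continuous_on UNIV (\<lambda>x. g' (f x) *\<^sub>R f' x)"
    using f(2) continuous_on_compose2[OF assms(3) C1_fun_continuous[OF assms(1)]]
    by (intro continuous_on_scaleR) auto
  ultimately show ?thesis by (rule C1_funI)
qed

lemma C1_fun_polynomial: "real_polynomial_function f \<Longrightarrow> C1_fun f"
  by (induction rule: real_polynomial_function.induct)
     (simp_all add: C1_fun_linear C1_fun_const C1_fun_add C1_fun_mult)

text \<open>Squaring removes the kink of the positive part at 0: there the difference quotient is at
  most |h|.\<close>

lemma has_real_derivative_max_0_power2:
  "((\<lambda>t::real. (max 0 t)\<^sup>2) has_real_derivative 2 * max 0 t) (at t)"
proof -
  consider "t < 0" | "t = 0" | "0 < t" by linarith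
  then show ?thesis
  proof cases
    case 1
    have "((\<lambda>t::real. 0) has_real_derivative 2 * max 0 t) (at t)" using 1 by simp
    then show ?thesis
      by (rule has_field_derivative_transform_within_open[of _ _ _ "{..<0}"]) (use 1 in auto)
  next
    case 2
    have "((\<lambda>h::real. (max 0 h)\<^sup>2 / h) \<longlongrightarrow> 0) (at 0)"
    proof (rule Lim_null_comparison)
      show "\<forall>\<^sub>F h::real in at 0. norm ((max 0 h)\<^sup>2 / h) \<le> \<bar>h\<bar>"
        by (rule always_eventually) (auto simp: max_def power2_eq_square)
      show "((\<lambda>h::real. \<bar>h\<bar>) \<longlongrightarrow> 0) (at 0)" by (auto intro!: tendsto_eq_intros)
    qed
    then show ?thesis using 2 by (simp add: DERIV_def)
  next
    case 3
    have "((\<lambda>t::real. t\<^sup>2) has_real_derivative 2 * max 0 t) (at t)"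
      using 3 by (auto intro!: derivative_eq_intros)
    then show ?thesis
      by (rule has_field_derivative_transform_within_open[of _ _ _ "{0<..}"]) (use 3 in auto)
  qed
qed

text \<open>The squared positive part of the quadratic r^2 - |x - a|^2 is nonzero exactly on the
  open ball of radius |r| about a.\<close>

lemma C1_fun_ball_bump:
  fixes a :: "'a::euclidean_space"
  shows "C1_fun (\<lambda>x. (max 0 (r\<^sup>2 - (x - a) \<bullet> (x - a)))\<^sup>2)"
proof (rule C1_fun_compose[where f = "\<lambda>x. r\<^sup>2 - (x - a) \<bullet> (x - a)" and g = "\<lambda>t. (max 0 t)\<^sup>2" and g' = "\<lambda>t. 2 * max 0 t"])
  have "((\<lambda>x. r\<^sup>2 - (x - a) \<bullet> (x - a)) has_derivative (\<lambda>v. (- 2 *\<^sub>R (x - a)) \<bullet> v)) (at x)" for x :: 'a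
    by (auto intro!: derivative_eq_intros simp: inner_commute algebra_simps)
  moreover have "continuous_on UNIV (\<lambda>x. - 2 *\<^sub>R (x - a))" by (intro continuous_intros)
  ultimately show "C1_fun (\<lambda>x. r\<^sup>2 - (x - a) \<bullet> (x - a))" by (rule C1_funI)
qed (auto intro!: has_real_derivative_max_0_power2 continuous_intros)

text \<open>As c grows, this tends to the indicator of the set where q is positive, while it
  vanishes wherever q does and its values stay in [0,1).\<close>

lemma C1_fun_saturate:
  assumes "C1_fun q" "\<And>x. 0 \<le> q x" "0 \<le> c"
  shows "C1_fun (\<lambda>x. c * q x / (1 + c * q x))"
proof (rule C1_fun_compose[where f = q and g' = "\<lambda>t. c / (1 + c * t)\<^sup>2"])
  have pos: "1 + c * q x > 0" for x using assms by (simp add: add_pos_nonneg)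
  show "((\<lambda>t. c * t / (1 + c * t)) has_real_derivative c / (1 + c * q x)\<^sup>2) (at (q x))" for x
    using pos[of x] by (auto intro!: derivative_eq_intros simp: power2_eq_square divide_simps) (simp add: algebra_simps)
  show "continuous_on (range q) (\<lambda>t. c / (1 + c * t)\<^sup>2)"
    using pos by (intro continuous_intros) (auto simp: less_imp_neq[THEN not_sym])
qed fact

text \<open>Compactness: finitely many balls with closure in D cover K, and the sum of their bumps
  is nonzero exactly on the union of these balls.\<close>

lemma C1_fun_positive_on_compact:
  fixes D :: "'a::euclidean_space set"
  assumes "compact K" "open D" "K \<subseteq> D"
  shows "\<exists>q. C1_fun q \<and> (\<forall>x. 0 \<le> q x) \<and> (\<forall>x\<in>K. 0 < q x) \<and>
    compact (closure {x. q x \<noteq> 0}) \<and> closure {x. q x \<noteq> 0} \<subseteq> D"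
proof -
  have "\<exists>r. 0 < r \<and> cball x r \<subseteq> D" if "x \<in> K" for x
    using that assms open_contains_cball[of D] by blast
  then obtain r where r: "\<And>x. x \<in> K \<Longrightarrow> 0 < r x \<and> cball x (r x) \<subseteq> D" by metis
  then have "K \<subseteq> (\<Union>x\<in>K. ball x (r x))" by force
  then obtain F where F: "F \<subseteq> K" "finite F" "K \<subseteq> (\<Union>x\<in>F. ball x (r x))"
    using compactE_image[OF assms(1), of K "\<lambda>x. ball x (r x)"] by (metis open_ball)
  define q where "q x = (\<Sum>a\<in>F. (max 0 ((r a)\<^sup>2 - (x - a) \<bullet> (x - a)))\<^sup>2)" for x
  have pos: "0 < (r a)\<^sup>2 - (x - a) \<bullet> (x - a) \<longleftrightarrow> x \<in> ball a (r a)" if "a \<in> F" for a x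
  proof -
    have "0 \<le> r a" using r[of a] that F(1) by auto
    then have "(norm (x - a))\<^sup>2 < (r a)\<^sup>2 \<longleftrightarrow> norm (x - a) < r a"
      by (auto intro: power2_less_imp_less power_strict_mono)
    moreover have "x \<in> ball a (r a) \<longleftrightarrow> norm (x - a) < r a" by (simp add: dist_norm norm_minus_commute)
    ultimately show ?thesis by (simp add: power2_norm_eq_inner)
  qed
  have "q x = 0 \<longleftrightarrow> (\<forall>a\<in>F. (max 0 ((r a)\<^sup>2 - (x - a) \<bullet> (x - a)))\<^sup>2 = 0)" for x
    unfolding q_def using F(2) by (intro sum_nonneg_eq_0_iff) auto
  moreover have "(max 0 t)\<^sup>2 = 0 \<longleftrightarrow> \<not> 0 < t" for t :: real by (simp add: max_def not_less)
  ultimately have q0: "q x \<noteq> 0 \<longleftrightarrow> x \<in> (\<Union>a\<in>F. ball a (r a))" for x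
    by (simp only: pos cong: ball_cong) blast
  have sub: "{x. q x \<noteq> 0} \<subseteq> (\<Union>a\<in>F. cball a (r a))" using q0 by force
  have comp: "compact (\<Union>a\<in>F. cball a (r a))" using F(2) by (intro compact_UN) auto
  then have cl: "closure {x. q x \<noteq> 0} \<subseteq> (\<Union>a\<in>F. cball a (r a))"
    using sub by (intro closure_minimal compact_imp_closed)
  have q_nonneg: "0 \<le> q x" for x unfolding q_def by (intro sum_nonneg) auto
  show ?thesis
  proof (intro exI[of _ q] conjI allI ballI q_nonneg)
    show "C1_fun q" unfolding q_def by (intro C1_fun_sum C1_fun_ball_bump)
    show "0 < q x" if "x \<in> K" for x
      using that F(3) q0[of x] q_nonneg[of x] by (metis order_le_less subsetD)
    show "compact (closure {x. q x \<noteq> 0})"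
      using cl comp by (metis compact_Int_closed closed_closure inf.absorb_iff2)
    show "closure {x. q x \<noteq> 0} \<subseteq> D" using cl r F by blast
  qed
qed

section \<open>Signs as limits of admissible test functions\<close>

text \<open>Here g stands for continuous approximations of a sign s, and p for polynomials close to
  the clipped g. Clipping to [-1,1] does not move the limit, and the denominator 1 + 1/(n+1) brings
  p back into [-1,1] without changing the limit.\<close>

lemma sgn_clipped_tendsto:
  fixes p g :: "nat \<Rightarrow> real"
  assumes "g \<longlonglongrightarrow> s" "\<bar>s\<bar> \<le> 1" "\<And>n. \<bar>max (-1) (min 1 (g n)) - p n\<bar> < 1 / Suc n"
  shows "(\<lambda>n. p n / (1 + 1 / Suc n)) \<longlonglongrightarrow> s"
proof -
  have "(\<lambda>n. max (-1) (min 1 (g n))) \<longlonglongrightarrow> max (-1) (min 1 s)"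
    by (intro tendsto_intros assms)
  moreover have "max (-1) (min 1 s) = s" using assms(2) by (auto simp: max_def min_def)
  moreover have "(\<lambda>n. max (-1) (min 1 (g n)) - p n) \<longlonglongrightarrow> 0"
    by (rule tendsto_rabs_zero_cancel, rule tendsto_sandwich[OF _ _ tendsto_const LIMSEQ_inverse_real_of_nat])
       (use assms(3) in \<open>auto simp: inverse_eq_divide less_imp_le simp del: of_nat_Suc\<close>)
  ultimately have "p \<longlonglongrightarrow> s" using tendsto_diff by fastforce
  then have "(\<lambda>n. p n / (1 + inverse (real (Suc n)))) \<longlonglongrightarrow> s / (1 + 0)"
    by (intro tendsto_intros LIMSEQ_inverse_real_of_nat) auto
  then show ?thesis by (simp add: inverse_eq_divide)
qed

lemma saturate_tendsto_1:
  fixes t :: real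
  assumes "0 < t"
  shows "(\<lambda>n. real n * t / (1 + real n * t)) \<longlonglongrightarrow> 1"
proof -
  have "filterlim (\<lambda>n. 1 + real n * t) at_top sequentially"
    by (intro filterlim_tendsto_add_at_top[OF tendsto_const]
        filterlim_at_top_mult_tendsto_pos[OF tendsto_const assms filterlim_real_sequentially])
  then have "(\<lambda>n. 1 - inverse (1 + real n * t)) \<longlonglongrightarrow> 1 - 0"
    by (intro tendsto_diff tendsto_const tendsto_inverse_0_at_top)
  moreover have "1 - inverse (1 + real n * t) = n * t / (1 + n * t)" for n
  proof -
    have "1 + real n * t > 0" using assms by (simp add: add_pos_nonneg)
    then show ?thesis by (simp add: field_simps)
  qed
  ultimately show ?thesis by simp
qed

text \<open>The sign of \<open>f\<close> is an almost everywhere limit of continuous functions, hence by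
  Stone--Weierstrass of polynomials; a fixed \<open>C\<^sup>1\<close> cutoff makes the latter admissible.\<close>

lemma L1_duality_cutoff:
  fixes f :: "'a::euclidean_space \<Rightarrow> real"
  assumes f: "integrable lborel f" and D: "open D"
    and bound: "\<And>\<psi>. C1_fun \<psi> \<Longrightarrow> compact (closure {x. \<psi> x \<noteq> 0}) \<Longrightarrow> closure {x. \<psi> x \<noteq> 0} \<subseteq> D
      \<Longrightarrow> (\<And>x. \<bar>\<psi> x\<bar> \<le> 1) \<Longrightarrow> (\<integral>x. f x * \<psi> x \<partial>lborel) \<le> B"
    and q: "C1_fun q" "\<And>x. 0 \<le> q x" "compact (closure {x. q x \<noteq> 0})" "closure {x. q x \<noteq> 0} \<subseteq> D"
  shows "(\<integral>x. \<bar>f x\<bar> * indicator {x. 0 < q x} x \<partial>lborel) \<le> B"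
proof -
  let ?K = "closure {x. q x \<noteq> 0}"
  have fm [measurable]: "f \<in> borel_measurable borel" using f by auto
  have qm [measurable]: "q \<in> borel_measurable borel"
    using C1_fun_continuous[OF q(1)] by (rule borel_measurable_continuous_onI)
  have "(\<lambda>x. sgn (f x)) measurable_on UNIV"
    by (rule lebesgue_measurable_imp_measurable_on_real)
       (auto intro!: measurable_completion simp: sgn_if)
  then obtain N g where N: "negligible N" and g: "\<And>n. continuous_on UNIV (g n)"
    "\<And>x. x \<notin> N \<Longrightarrow> (\<lambda>n. g n x) \<longlonglongrightarrow> sgn (f x)"
    unfolding measurable_on_def by (simp only: UNIV_I if_True) blast
  have "\<exists>p. real_polynomial_function p \<and> (\<forall>x\<in>?K. \<bar>max (-1) (min 1 (g n x)) - p x\<bar> < 1 / Suc n)" for n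
  proof -
    have "continuous_on ?K (\<lambda>x. max (-1) (min 1 (g n x)))"
      by (intro continuous_intros continuous_on_subset[OF g(1)]) auto
    then show ?thesis
      by (rule Stone_Weierstrass_real_polynomial_function[OF q(3), where e = "1 / Suc n"]) auto
  qed
  then obtain p where p: "\<And>n. real_polynomial_function (p n)"
    "\<And>n x. x \<in> ?K \<Longrightarrow> \<bar>max (-1) (min 1 (g n x)) - p n x\<bar> < 1 / Suc n"
    by metis
  \<comment> \<open>Outside \<open>?K\<close> the polynomial is uncontrolled, but q vanishes there.
    On \<open>?K\<close> the first factor is below 1 and tends to the indicator of {q > 0}; the last
    one compensates the approximation error, so that |\<psi>| \<le> 1 everywhere.\<close>
  define \<psi> where "\<psi> n x = (n * q x / (1 + n * q x)) * (p n x * (1 / (1 + 1 / Suc n)))" for n :: nat and x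
  have C1: "C1_fun (\<psi> n)" for n
    unfolding \<psi>_def
    by (rule C1_fun_mult[OF C1_fun_saturate[OF q(1,2)] C1_fun_mult[OF C1_fun_polynomial[OF p(1)] C1_fun_const]]) simp
  have sub: "{x. \<psi> n x \<noteq> 0} \<subseteq> {x. q x \<noteq> 0}" for n
  proof (clarify)
    fix x assume "q x = 0" "\<psi> n x \<noteq> 0"
    then show False by (simp add: \<psi>_def)
  qed
  have le1: "\<bar>\<psi> n x\<bar> \<le> 1" for n x
  proof (cases "x \<in> ?K")
    case True
    have "\<bar>max (-1) (min 1 t)\<bar> \<le> 1" for t :: real by (auto simp: max_def min_def abs_le_iff)
    then have "\<bar>p n x\<bar> \<le> 1 + 1 / Suc n" using p(2)[OF True, of n] by (smt (verit))
    moreover have "\<bar>s * (1 / d)\<bar> \<le> 1" if "\<bar>s\<bar> \<le> d" "0 < d" for s d :: real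
      using that by (simp add: abs_mult)
    moreover have "(0::real) < 1 + 1 / Suc n" by (simp add: add_pos_pos)
    ultimately have A: "\<bar>p n x * (1 / (1 + 1 / Suc n))\<bar> \<le> 1" by blast
    have "0 \<le> n * q x" using q(2) by simp
    moreover have "\<bar>t / (1 + t)\<bar> \<le> 1" if "0 \<le> t" for t :: real using that by (simp add: divide_simps)
    ultimately have B: "\<bar>n * q x / (1 + n * q x)\<bar> \<le> 1" by blast
    have "\<bar>n * q x / (1 + n * q x)\<bar> * \<bar>p n x * (1 / (1 + 1 / Suc n))\<bar> \<le> 1"
      by (intro mult_le_one abs_ge_zero A B)
    then show ?thesis unfolding \<psi>_def by (subst abs_mult)
  next
    case False
    then have "q x = 0" using closure_subset[of "{x. q x \<noteq> 0}"] by blast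
    then show ?thesis by (simp add: \<psi>_def)
  qed
  have "(\<lambda>n. \<integral>x. f x * \<psi> n x \<partial>lborel) \<longlonglongrightarrow> (\<integral>x. \<bar>f x\<bar> * indicator {x. 0 < q x} x \<partial>lborel)"
  proof (rule integral_dominated_convergence[where w = "\<lambda>x. \<bar>f x\<bar>"])
    have [measurable]: "\<psi> n \<in> borel_measurable borel" for n
      using C1_fun_continuous[OF C1[of n]] by (rule borel_measurable_continuous_onI)
    show "(\<lambda>x. f x * \<psi> n x) \<in> borel_measurable lborel" for n by measurable
    have "AE x in lborel. x \<notin> N"
      using AE_not_in[OF N[unfolded negligible_iff_null_sets]] by (simp add: AE_completion_iff)
    then show "AE x in lborel. (\<lambda>n. f x * \<psi> n x) \<longlonglongrightarrow> \<bar>f x\<bar> * indicator {x. 0 < q x} x"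
    proof eventually_elim
      case (elim x)
      show ?case
      proof (cases "0 < q x")
        case True
        then have "x \<in> ?K" using closure_subset[of "{x. q x \<noteq> 0}"] by force
        then have "(\<lambda>n. p n x / (1 + 1 / Suc n)) \<longlonglongrightarrow> sgn (f x)"
          by (intro sgn_clipped_tendsto[OF g(2)[OF elim]] p(2)) (auto simp: sgn_if)
        moreover have "(\<lambda>n. n * q x / (1 + n * q x)) \<longlonglongrightarrow> 1" using True by (rule saturate_tendsto_1)
        ultimately have "(\<lambda>n. f x * (n * q x / (1 + n * q x) * (p n x / (1 + 1 / Suc n)))) \<longlonglongrightarrow> f x * (1 * sgn (f x))"
          by (intro tendsto_mult tendsto_const)
        then have "(\<lambda>n. f x * \<psi> n x) \<longlonglongrightarrow> f x * (1 * sgn (f x))"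
          unfolding \<psi>_def times_divide_eq_right mult_1_right .
        then show ?thesis using True by (simp add: abs_sgn)
      next
        case False
        then have "q x = 0" using q(2)[of x] by simp
        then show ?thesis by (simp add: \<psi>_def)
      qed
    qed
    show "AE x in lborel. norm (f x * \<psi> n x) \<le> \<bar>f x\<bar>" for n
      using le1 by (auto simp: abs_mult mult_left_le)
  qed (use f in auto)
  moreover have "(\<integral>x. f x * \<psi> n x \<partial>lborel) \<le> B" for n
  proof (rule bound[OF C1 _ _ le1])
    have "closure {x. \<psi> n x \<noteq> 0} \<subseteq> ?K" using sub by (rule closure_mono)
    then show "closure {x. \<psi> n x \<noteq> 0} \<subseteq> D" "compact (closure {x. \<psi> n x \<noteq> 0})"
      using q(3,4) by (auto simp: compact_eq_bounded_closed intro: bounded_subset)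
  qed
  ultimately show ?thesis by (intro LIMSEQ_le_const2) auto
qed

text \<open>The cutoff version sees only {q > 0}. With D exhausted by compact sets and a q positive
  on each of them, continuity from below of the measure |f| dx yields the whole of D.\<close>

lemma L1_duality:
  fixes f :: "'a::euclidean_space \<Rightarrow> real"
  assumes f: "integrable lborel f" and D: "open D"
    and bound: "\<And>\<psi>. C1_fun \<psi> \<Longrightarrow> compact (closure {x. \<psi> x \<noteq> 0}) \<Longrightarrow> closure {x. \<psi> x \<noteq> 0} \<subseteq> D
      \<Longrightarrow> (\<And>x. \<bar>\<psi> x\<bar> \<le> 1) \<Longrightarrow> (\<integral>x. f x * \<psi> x \<partial>lborel) \<le> B"
  shows "(\<integral>\<^sup>+x. ennreal \<bar>f x\<bar> * indicator D x \<partial>lborel) \<le> ennreal B"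
proof -
  have fm [measurable]: "f \<in> borel_measurable borel" using f by auto
  obtain C where C: "\<And>n::nat. compact (C n)" "\<And>n. C n \<subseteq> D" "\<And>n. C n \<subseteq> interior (C (Suc n))" "\<Union>(range C) = D"
    using open_Union_compact_subsets[OF D] by metis
  have Cb [measurable]: "C n \<in> sets borel" for n using C(1) by (auto intro: borel_compact)
  let ?M = "density lborel (\<lambda>x. ennreal \<bar>f x\<bar>)"
  have "emeasure ?M (C n) \<le> ennreal B" for n
  proof -
    obtain q where q: "C1_fun q" "\<And>x. 0 \<le> q x" "\<And>x. x \<in> C n \<Longrightarrow> 0 < q x"
      "compact (closure {x. q x \<noteq> 0})" "closure {x. q x \<noteq> 0} \<subseteq> D"
      using C1_fun_positive_on_compact[OF C(1) D C(2), of n] by blast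
    have [measurable]: "q \<in> borel_measurable borel"
      using C1_fun_continuous[OF q(1)] by (rule borel_measurable_continuous_onI)
    have "emeasure ?M (C n) \<le> (\<integral>\<^sup>+x. ennreal (\<bar>f x\<bar> * indicator {x. 0 < q x} x) \<partial>lborel)"
      using q(3) by (subst emeasure_density) (auto intro!: nn_integral_mono simp: indicator_def)
    also have "\<dots> = ennreal (\<integral>x. \<bar>f x\<bar> * indicator {x. 0 < q x} x \<partial>lborel)"
      using f by (intro nn_integral_eq_integral integrable_real_mult_indicator) auto
    also have "\<dots> \<le> ennreal B"
      by (intro ennreal_leI L1_duality_cutoff[OF f D bound q(1,2,4,5)]) auto
    finally show ?thesis .
  qed
  moreover have "incseq C" using C(3) interior_subset by (intro incseq_SucI) blast
  then have "(SUP n. emeasure ?M (C n)) = emeasure ?M D"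
    using C(4) by (subst SUP_emeasure_incseq) auto
  ultimately have "emeasure ?M D \<le> ennreal B" by (metis SUP_least)
  then show ?thesis using D by (subst (asm) emeasure_density) auto
qed

section \<open>Translations of functions of bounded variation\<close>

lemma C1_fun_line_integral:
  fixes f :: "'a::euclidean_space \<Rightarrow> real"
  assumes f': "\<And>x. (f has_derivative (\<lambda>v. f' x \<bullet> v)) (at x)" "continuous_on UNIV f'"
  shows "((\<lambda>y. integral {0..l} (\<lambda>s. f (y - s *\<^sub>R e))) has_derivative
           (\<lambda>v. integral {0..l} (\<lambda>s. f' (y - s *\<^sub>R e)) \<bullet> v)) (at y)" (is ?D)
    and "continuous_on UNIV (\<lambda>y. integral {0..l} (\<lambda>s. f' (y - s *\<^sub>R e)))" (is ?C)
proof -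
  have f: "continuous_on UNIV f"
    using f'(1) by (auto simp: continuous_on_eq_continuous_at intro: has_derivative_continuous)
  have shift: "continuous_on A (\<lambda>z. g (fst z - snd z *\<^sub>R e))" if "continuous_on UNIV g"
    for A and g :: "'a \<Rightarrow> 'b::topological_space"
    by (rule continuous_on_compose2[OF that]) (auto intro!: continuous_intros)
  have shift1: "continuous_on A (\<lambda>s. g (y - s *\<^sub>R e))" if "continuous_on UNIV g"
    for A y and g :: "'a \<Rightarrow> 'b::topological_space"
    by (rule continuous_on_compose2[OF that]) (auto intro!: continuous_intros)
  have int: "(\<lambda>s. f' (y - s *\<^sub>R e)) integrable_on cbox 0 l"
    by (intro integrable_continuous shift1 f')
  have "((\<lambda>y. integral (cbox 0 l) (\<lambda>s. f (y - s *\<^sub>R e))) has_derivative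
      blinfun_apply (integral (cbox 0 l) (\<lambda>s. blinfun_inner_right (f' (y - s *\<^sub>R e))))) (at y within UNIV)"
  proof (rule leibniz_rule)
    fix x s
    have "((\<lambda>x. f (x - s *\<^sub>R e)) has_derivative (\<lambda>v. f' (x - s *\<^sub>R e) \<bullet> v)) (at x within UNIV)"
      by (rule has_derivative_compose[OF _ f'(1)]) (auto intro!: derivative_eq_intros)
    then show "((\<lambda>x. f (x - s *\<^sub>R e)) has_derivative blinfun_inner_right (f' (x - s *\<^sub>R e))) (at x within UNIV)"
      by (simp add: blinfun_inner_right.rep_eq)
  next
    show "(\<lambda>s. f (x - s *\<^sub>R e)) integrable_on cbox 0 l" for x
      by (intro integrable_continuous shift1 f)
    show "continuous_on (UNIV \<times> cbox 0 l) (\<lambda>(x, s). blinfun_inner_right (f' (x - s *\<^sub>R e)))"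
      unfolding case_prod_beta
      by (intro bounded_linear.continuous_on[OF bounded_linear_blinfun_inner_right] shift f')
  qed auto
  moreover have "blinfun_apply (integral (cbox 0 l) (\<lambda>s. blinfun_inner_right (f' (y - s *\<^sub>R e))))
      = (\<lambda>v. integral (cbox 0 l) (\<lambda>s. f' (y - s *\<^sub>R e)) \<bullet> v)"
    using integral_linear[OF int bounded_linear_blinfun_inner_right]
    by (simp add: o_def blinfun_inner_right.rep_eq)
  ultimately show ?D by simp
  have "continuous_on UNIV (\<lambda>y. integral (cbox 0 l) (\<lambda>s. f' (y - s *\<^sub>R e)))"
    by (rule integral_continuous_on_param) (use shift[OF f'(2)] in \<open>auto simp: case_prod_beta\<close>)
  then show ?C by simp
qed

text \<open>Fundamental theorem of calculus along the line. It is the reason why the field in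
  direction e built from the line integral has a difference of two translates of f as its
  divergence.\<close>

lemma line_integral_derivative:
  fixes f :: "'a::euclidean_space \<Rightarrow> real"
  assumes f': "\<And>x. (f has_derivative (\<lambda>v. f' x \<bullet> v)) (at x)" "continuous_on UNIV f'" and "0 \<le> l"
  shows "integral {0..l} (\<lambda>s. f' (y - s *\<^sub>R e)) \<bullet> e = f y - f (y - l *\<^sub>R e)"
proof -
  have "continuous_on {0..l} (\<lambda>s. f' (y - s *\<^sub>R e))"
    by (rule continuous_on_compose2[OF f'(2)]) (auto intro!: continuous_intros)
  then have int: "(\<lambda>s. f' (y - s *\<^sub>R e)) integrable_on {0..l}" by (rule integrable_continuous_interval)
  have "((\<lambda>s. - f (y - s *\<^sub>R e)) has_vector_derivative f' (y - s *\<^sub>R e) \<bullet> e) (at s within {0..l})" for s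
  proof -
    have "((\<lambda>s. f (y - s *\<^sub>R e)) has_derivative (\<lambda>t. f' (y - s *\<^sub>R e) \<bullet> (- (t *\<^sub>R e)))) (at s within {0..l})"
      by (rule has_derivative_compose[OF _ f'(1)]) (auto intro!: derivative_eq_intros)
    from has_derivative_minus[OF this] show ?thesis by (simp add: has_vector_derivative_def)
  qed
  then have "((\<lambda>s. f' (y - s *\<^sub>R e) \<bullet> e) has_integral (- f (y - l *\<^sub>R e) - - f (y - 0 *\<^sub>R e))) {0..l}"
    using \<open>0 \<le> l\<close> by (intro fundamental_theorem_of_calculus) auto
  moreover have "integral {0..l} (\<lambda>s. f' (y - s *\<^sub>R e) \<bullet> e) = integral {0..l} (\<lambda>s. f' (y - s *\<^sub>R e)) \<bullet> e"
    using integral_linear[OF int bounded_linear_inner_left[of e]] by (simp add: o_def)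
  ultimately show ?thesis by (simp add: integral_unique)
qed

lemma divergence_scaleR_const:
  fixes w :: "real ^ 'n"
  assumes "(f has_derivative (\<lambda>v. g \<bullet> v)) (at x)"
  shows "divergence (\<lambda>x. f x *\<^sub>R w) x = g \<bullet> w"
proof -
  have "((\<lambda>x. f x *\<^sub>R w) has_derivative (\<lambda>v. (g \<bullet> v) *\<^sub>R w)) (at x)"
    using assms by (auto intro!: derivative_eq_intros)
  then have "frechet_derivative (\<lambda>x. f x *\<^sub>R w) (at x) = (\<lambda>v. (g \<bullet> v) *\<^sub>R w)"
    by (rule frechet_derivative_at[symmetric])
  then show ?thesis by (simp add: divergence_def inner_axis) (simp add: inner_vec_def)
qed

lemma scaleR_const_in_test_fields:
  fixes w :: "real ^ 'n"
  assumes f': "\<And>x. (f has_derivative (\<lambda>v. f' x \<bullet> v)) (at x)" "continuous_on UNIV f'"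
    and K: "compact K" "K \<subseteq> \<Omega>" "\<And>x. f x \<noteq> 0 \<Longrightarrow> x \<in> K"
    and le: "\<And>x. \<bar>f x\<bar> * norm w \<le> 1"
  shows "(\<lambda>x. f x *\<^sub>R w) \<in> test_fields \<Omega>"
proof -
  have cl: "closure {x. f x *\<^sub>R w \<noteq> 0} \<subseteq> K"
    using K by (intro closure_minimal compact_imp_closed) auto
  have "((\<lambda>x. f x *\<^sub>R w) has_derivative blinfun_apply (blinfun_scaleR_left w o\<^sub>L blinfun_inner_right (f' x))) (at x)" for x
  proof -
    have "((\<lambda>x. f x *\<^sub>R w) has_derivative (\<lambda>v. (f' x \<bullet> v) *\<^sub>R w)) (at x)"
      using f'(1) by (auto intro!: derivative_eq_intros)
    then show ?thesis
      by (rule has_derivative_eq_rhs)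
         (simp add: fun_eq_iff blinfun_inner_right.rep_eq)
  qed
  moreover have "continuous_on UNIV (\<lambda>x. blinfun_scaleR_left w o\<^sub>L blinfun_inner_right (f' x))"
    by (intro continuous_intros bounded_linear.continuous_on[OF bounded_linear_blinfun_inner_right] f')
  moreover have "compact (closure {x. f x *\<^sub>R w \<noteq> 0})"
    using cl K(1) by (metis compact_Int_closed closed_closure inf.absorb_iff2)
  ultimately show ?thesis
    unfolding test_fields_def using cl K(2) le
    by (intro CollectI conjI exI[of _ "\<lambda>x. blinfun_scaleR_left w o\<^sub>L blinfun_inner_right (f' x)"]) auto
qed

text \<open>Only the parameters s with y - s e in D contribute, with integrand at most 1; so a set D
  that is thin in direction e gives a small bound even if l is large.\<close>

lemma abs_line_integral_le:
  fixes f :: "'a::euclidean_space \<Rightarrow> real"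
  assumes f: "continuous_on UNIV f" "\<And>x. \<bar>f x\<bar> \<le> indicator D x" and D: "open D"
  shows "\<bar>integral {0..l} (\<lambda>s. f (y - s *\<^sub>R e))\<bar> \<le> measure lborel {s \<in> {0..l}. y - s *\<^sub>R e \<in> D}"
proof -
  let ?S = "{s \<in> {0..l}. y - s *\<^sub>R e \<in> D}"
  have "open ((\<lambda>s. y - s *\<^sub>R e) -` D)" by (intro open_vimage D continuous_intros)
  moreover have eq: "?S = {0..l} \<inter> (\<lambda>s. y - s *\<^sub>R e) -` D" by auto
  ultimately have S [measurable]: "?S \<in> sets borel"
    unfolding eq by (intro sets.Int borel_open[of "_ -` _"]) auto
  have "{0..l} \<in> fmeasurable lborel" by (simp add: fmeasurable_def emeasure_lborel_Icc_eq)
  then have "?S \<in> fmeasurable lborel"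
  proof (rule fmeasurableI2)
    show "?S \<in> sets lborel" using S by (simp only: sets_lborel)
  qed blast
  then have intS: "integrable lborel (indicator ?S :: real \<Rightarrow> real)"
    by (intro integrable_real_indicator) (simp_all only: fmeasurable_def mem_Collect_eq infinity_ennreal_def)
  have cont: "continuous_on {0..l} (\<lambda>s. f (y - s *\<^sub>R e))"
    by (rule continuous_on_compose2[OF f(1)]) (auto intro!: continuous_intros)
  then have int: "set_integrable lborel {0..l} (\<lambda>s. f (y - s *\<^sub>R e))"
    by (rule borel_integrable_atLeastAtMost')
  have "\<bar>integral {0..l} (\<lambda>s. f (y - s *\<^sub>R e))\<bar> = \<bar>LINT s:{0..l}|lborel. f (y - s *\<^sub>R e)\<bar>"
    using set_borel_integral_eq_integral(2)[OF int] by simp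
  also have "\<dots> \<le> (LINT s|lborel. \<bar>indicator {0..l} s *\<^sub>R f (y - s *\<^sub>R e)\<bar>)"
    unfolding set_lebesgue_integral_def by (rule integral_abs_bound)
  also have "\<dots> \<le> (LINT s|lborel. indicator ?S s)"
  proof (rule integral_mono)
    show "integrable lborel (\<lambda>s. \<bar>indicator {0..l} s *\<^sub>R f (y - s *\<^sub>R e)\<bar>)"
      using int unfolding set_integrable_def by (rule integrable_abs)
    show "\<bar>indicator {0..l} s *\<^sub>R f (y - s *\<^sub>R e)\<bar> \<le> indicator ?S s" for s
      using f(2)[of "y - s *\<^sub>R e"]
      by (cases "s \<in> {0..l}"; cases "y - s *\<^sub>R e \<in> D") (simp_all add: indicator_def)
  qed (rule intS)
  also have "\<dots> = measure lborel ?S" by (subst Bochner_Integration.integral_indicator) simp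
  finally show ?thesis .
qed

text \<open>A Borel representative extended by zero, so that translation and Fubini on
  \<open>lborel\<close> apply directly. V is any real upper bound for the variation on \<Omega>;
  carrying it as a number avoids computing with the extended supremum.\<close>

definition bv_rep :: "(real ^ 'n) set \<Rightarrow> real \<Rightarrow> (real ^ 'n \<Rightarrow> real) \<Rightarrow> bool" where
  "bv_rep \<Omega> V v \<longleftrightarrow> integrable lborel v \<and> (\<forall>x. x \<notin> \<Omega> \<longrightarrow> v x = 0) \<and>
     (\<forall>\<phi>\<in>test_fields \<Omega>. (\<integral>x. v x * divergence \<phi> x \<partial>lborel) \<le> V)"

lemma bv_rep_measurable [measurable_dest]: "bv_rep \<Omega> V v \<Longrightarrow> v \<in> borel_measurable borel"
  by (auto simp: bv_rep_def)

lemma bv_rep_nonneg: "bv_rep \<Omega> V v \<Longrightarrow> 0 \<le> V"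
  using zero_in_test_fields[of \<Omega>] by (force simp: bv_rep_def divergence_def)

lemma integrable_translate:
  fixes f :: "'a::euclidean_space \<Rightarrow> real"
  assumes "integrable lborel f"
  shows "integrable lborel (\<lambda>x. f (x + h))" "(\<integral>x. f (x + h) \<partial>lborel) = (\<integral>x. f x \<partial>lborel)"
proof -
  have *: "lborel = distr lborel borel (\<lambda>x. x + h)"
    by (subst lborel_distr_plus[of h, symmetric]) (simp add: add.commute[of _ h])
  have f: "f \<in> borel_measurable borel" using assms by auto
  show "integrable lborel (\<lambda>x. f (x + h))"
    using assms f by (subst (asm) *, subst (asm) integrable_distr_eq) auto
  show "(\<integral>x. f (x + h) \<partial>lborel) = (\<integral>x. f x \<partial>lborel)"
    using f by (subst (2) *, subst integral_distr) auto
qed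

lemma nn_integral_translate:
  fixes f :: "'a::euclidean_space \<Rightarrow> ennreal"
  assumes "f \<in> borel_measurable borel"
  shows "(\<integral>\<^sup>+x. f (x + h) \<partial>lborel) = (\<integral>\<^sup>+x. f x \<partial>lborel)"
proof -
  have *: "lborel = distr lborel borel (\<lambda>x. x + h)"
    by (subst lborel_distr_plus[of h, symmetric]) (simp add: add.commute[of _ h])
  show ?thesis using assms by (subst (2) *, subst nn_integral_distr) auto
qed

text \<open>Difference quotients of \<open>v\<close> are tested against \<open>\<psi>\<close> by pairing \<open>v\<close> with the divergence of the
  field \<open>y \<mapsto> (\<integral>\<^sub>0\<^sup>l \<psi>(y - se) ds) e\<close>, whose size is controlled by the length of the
  lines in direction \<open>e\<close> inside \<open>D\<close> and not by \<open>l\<close>.\<close>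

lemma bv_translate_le:
  fixes \<Omega> :: "(real ^ 'n) set"
  assumes v: "bv_rep \<Omega> V v" and D: "open D" and sub: "\<And>x s. x \<in> D \<Longrightarrow> 0 \<le> s \<Longrightarrow> s \<le> l \<Longrightarrow> x + s *\<^sub>R e \<in> \<Omega>"
    and line: "\<And>y. measure lborel {s \<in> {0..l}. y - s *\<^sub>R e \<in> D} \<le> \<tau>"
    and "0 < \<tau>" "e \<noteq> 0" "0 \<le> l"
  shows "(\<integral>\<^sup>+x. ennreal \<bar>v (x + l *\<^sub>R e) - v x\<bar> * indicator D x \<partial>lborel) \<le> ennreal (\<tau> * norm e * V)"
proof (rule L1_duality[OF _ D])
  have vi: "integrable lborel v" using v by (simp add: bv_rep_def)
  note [measurable] = bv_rep_measurable[OF v]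
  show "integrable lborel (\<lambda>x. v (x + l *\<^sub>R e) - v x)"
    by (intro Bochner_Integration.integrable_diff integrable_translate vi)
  fix \<psi> :: "real ^ 'n \<Rightarrow> real"
  assume \<psi>: "C1_fun \<psi>" "compact (closure {x. \<psi> x \<noteq> 0})" "closure {x. \<psi> x \<noteq> 0} \<subseteq> D" "\<And>x. \<bar>\<psi> x\<bar> \<le> 1"
  let ?K = "closure {x. \<psi> x \<noteq> 0}"
  obtain \<psi>' where \<psi>': "\<And>x. (\<psi> has_derivative (\<lambda>v. \<psi>' x \<bullet> v)) (at x)" "continuous_on UNIV \<psi>'"
    using \<psi>(1) unfolding C1_fun_def by blast
  have cont: "continuous_on UNIV \<psi>" by (rule C1_fun_continuous) fact
  then have [measurable]: "\<psi> \<in> borel_measurable borel" by (rule borel_measurable_continuous_onI)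
  define J where "J y = integral {0..l} (\<lambda>s. \<psi> (y - s *\<^sub>R e))" for y
  \<comment> \<open>Since |J| \<le> \<tau>, this scaling makes the field J w bounded by 1. The sign
    is chosen so that its divergence is a positive multiple of \<psi>(y - l e) - \<psi>(y).\<close>
  define w where "w = - (1 / (\<tau> * norm e)) *\<^sub>R e"
  have K: "x \<in> ?K" if "\<psi> x \<noteq> 0" for x using that closure_subset[of "{x. \<psi> x \<noteq> 0}"] by blast
  have J': "(J has_derivative (\<lambda>v. integral {0..l} (\<lambda>s. \<psi>' (y - s *\<^sub>R e)) \<bullet> v)) (at y)" for y
    unfolding J_def by (rule C1_fun_line_integral[OF \<psi>'])
  have "(\<lambda>y. J y *\<^sub>R w) \<in> test_fields \<Omega>"
  proof (rule scaleR_const_in_test_fields[OF J' C1_fun_line_integral(2)[OF \<psi>']])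
    \<comment> \<open>The support of \<psi> swept along the segments x + s e with s in [0, l]: still
      compact, and inside \<Omega> by the hypothesis on segments starting in D.\<close>
    let ?L = "(\<lambda>z. fst z + snd z *\<^sub>R e) ` (?K \<times> {0..l})"
    show "compact ?L"
      by (intro compact_continuous_image continuous_intros compact_Times \<psi>(2)) auto
    show "?L \<subseteq> \<Omega>" using sub \<psi>(3) by auto
    show "y \<in> ?L" if "J y \<noteq> 0" for y
    proof (rule ccontr)
      assume "y \<notin> ?L"
      then have "\<psi> (y - s *\<^sub>R e) = 0" if "s \<in> {0..l}" for s
        using K[of "y - s *\<^sub>R e"] that by (force simp: image_iff)
      then have "J y = integral {0..l} (\<lambda>s. 0)"
        unfolding J_def by (rule integral_cong)
      with \<open>J y \<noteq> 0\<close> show False by simp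
    qed
    have "\<bar>J y\<bar> \<le> \<tau>" for y
      unfolding J_def
    proof (rule order_trans[OF abs_line_integral_le[OF cont _ D] line])
      show "\<bar>\<psi> x\<bar> \<le> indicator D x" for x
        using \<psi>(3,4) K[of x] by (cases "\<psi> x = 0") (auto simp: indicator_def)
    qed
    moreover have "norm w = 1 / \<tau>" using assms by (simp add: w_def)
    ultimately show "\<bar>J y\<bar> * norm w \<le> 1" for y using \<open>0 < \<tau>\<close> by simp
  qed
  then have "(\<integral>y. v y * divergence (\<lambda>y. J y *\<^sub>R w) y \<partial>lborel) \<le> V" using v by (simp add: bv_rep_def)
  moreover have "(\<integral>y. v y * divergence (\<lambda>y. J y *\<^sub>R w) y \<partial>lborel)
      = (\<integral>x. (v (x + l *\<^sub>R e) - v x) * \<psi> x \<partial>lborel) / (\<tau> * norm e)"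
  proof -
    have bdd: "integrable lborel (\<lambda>y. f y * \<psi> (y - c))" if "integrable lborel f" for f c
      using that \<psi>(4) by (intro Bochner_Integration.integrable_bound[OF that]) (auto simp: abs_mult mult_left_le)
    have i1: "integrable lborel (\<lambda>y. v y * \<psi> (y - l *\<^sub>R e))" by (rule bdd[OF vi])
    have i2: "integrable lborel (\<lambda>y. v y * \<psi> y)" using bdd[OF vi, of 0] by simp
    have i3: "integrable lborel (\<lambda>x. v (x + l *\<^sub>R e) * \<psi> x)"
      using bdd[OF integrable_translate(1)[OF vi], of "l *\<^sub>R e" 0] by simp
    have "divergence (\<lambda>y. J y *\<^sub>R w) y = (\<psi> (y - l *\<^sub>R e) - \<psi> y) / (\<tau> * norm e)" for y
    proof -
      have "divergence (\<lambda>y. J y *\<^sub>R w) y = integral {0..l} (\<lambda>s. \<psi>' (y - s *\<^sub>R e)) \<bullet> w"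
        by (rule divergence_scaleR_const[OF J'])
      also have "\<dots> = - (1 / (\<tau> * norm e)) * (integral {0..l} (\<lambda>s. \<psi>' (y - s *\<^sub>R e)) \<bullet> e)"
        unfolding w_def by (rule inner_scaleR_right)
      also have "\<dots> = - (1 / (\<tau> * norm e)) * (\<psi> y - \<psi> (y - l *\<^sub>R e))"
        by (subst line_integral_derivative[OF \<psi>' \<open>0 \<le> l\<close>]) (rule refl)
      also have "\<dots> = (\<psi> (y - l *\<^sub>R e) - \<psi> y) / (\<tau> * norm e)"
        by (simp add: diff_divide_distrib)
      finally show ?thesis .
    qed
    then have "(\<integral>y. v y * divergence (\<lambda>y. J y *\<^sub>R w) y \<partial>lborel)
        = (\<integral>y. (v y * \<psi> (y - l *\<^sub>R e) - v y * \<psi> y) / (\<tau> * norm e) \<partial>lborel)"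
      by (intro Bochner_Integration.integral_cong refl) (simp only: times_divide_eq_right right_diff_distrib)
    also have "\<dots> = ((\<integral>y. v y * \<psi> (y - l *\<^sub>R e) \<partial>lborel) - (\<integral>y. v y * \<psi> y \<partial>lborel)) / (\<tau> * norm e)"
      by (subst integral_divide_zero, subst Bochner_Integration.integral_diff[OF i1 i2]) (rule refl)
    \<comment> \<open>Translation by l e moves the difference from the test function to v.\<close>
    also have "(\<integral>y. v y * \<psi> (y - l *\<^sub>R e) \<partial>lborel) = (\<integral>x. v (x + l *\<^sub>R e) * \<psi> x \<partial>lborel)"
      using integrable_translate(2)[OF i1, of "l *\<^sub>R e"] by simp
    also have "\<dots> - (\<integral>y. v y * \<psi> y \<partial>lborel) = (\<integral>x. (v (x + l *\<^sub>R e) - v x) * \<psi> x \<partial>lborel)"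
      by (subst Bochner_Integration.integral_diff[OF i3 i2, symmetric]) (simp only: left_diff_distrib)
    finally show ?thesis .
  qed
  moreover have "0 < \<tau> * norm e" using assms by simp
  ultimately show "(\<integral>x. (v (x + l *\<^sub>R e) - v x) * \<psi> x \<partial>lborel) \<le> \<tau> * norm e * V"
    by (simp add: pos_divide_le_eq mult.commute)
qed

section \<open>Poincare inequality and thin layers\<close>

text \<open>Selects a good base point y; the constant in the Poincare inequality will be a value
  v(y) rather than the mean.\<close>

lemma exists_le_average:
  fixes f :: "'a \<Rightarrow> ennreal"
  assumes [measurable]: "f \<in> borel_measurable M" "B \<in> sets M"
    and B: "emeasure M B \<noteq> 0" "emeasure M B < \<infinity>" and k: "k < \<infinity>"
    and le: "(\<integral>\<^sup>+x. f x * indicator B x \<partial>M) \<le> k * emeasure M B"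
  shows "\<exists>y\<in>B. f y \<le> k"
proof (rule ccontr)
  assume "\<not> ?thesis"
  then have *: "\<And>y. y \<in> B \<Longrightarrow> k < f y" by (auto simp: not_le)
  have "(\<integral>\<^sup>+x. k * indicator B x \<partial>M) < (\<integral>\<^sup>+x. f x * indicator B x \<partial>M)"
  proof (rule nn_integral_less)
    show "(\<integral>\<^sup>+x. k * indicator B x \<partial>M) \<noteq> \<infinity>"
      using B k by (auto simp: nn_integral_cmult_indicator ennreal_mult_eq_top_iff)
    show "AE x in M. k * indicator B x \<le> f x * indicator B x"
      using * by (auto simp: indicator_def less_imp_le)
    show "\<not> (AE x in M. f x * indicator B x \<le> k * indicator B x)"
    proof
      assume "AE x in M. f x * indicator B x \<le> k * indicator B x"
      then have "AE x in M. x \<notin> B"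
        by eventually_elim (use * in \<open>force simp: indicator_def not_le split: if_splits\<close>)
      then have "emeasure M B = 0" by (subst (asm) AE_iff_measurable[of B]) (use sets.sets_into_space[OF assms(2)] in auto)
      with B show False by simp
    qed
  qed auto
  with le show False by (simp add: nn_integral_cmult_indicator)
qed

lemma nn_integral_swap:
  fixes f :: "'a::euclidean_space \<Rightarrow> 'b::euclidean_space \<Rightarrow> ennreal"
  assumes "case_prod f \<in> borel_measurable (borel \<Otimes>\<^sub>M borel)"
  shows "(\<integral>\<^sup>+x. \<integral>\<^sup>+y. f x y \<partial>lborel \<partial>lborel) = (\<integral>\<^sup>+y. \<integral>\<^sup>+x. f x y \<partial>lborel \<partial>lborel)"
proof -
  have "case_prod f \<in> borel_measurable (lborel \<Otimes>\<^sub>M lborel)"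
    using assms by (simp cong: measurable_cong_sets sets_pair_measure_cong)
  then show ?thesis by (rule lborel_pair.Fubini'[symmetric])
qed

text \<open>Substituting x = y + h and exchanging the integrals reduces the claim to one h at a
  time. For fixed h, the points y with both y and y + h in the ball form an open set, and the
  segments from y to y + h stay in the convex ball. The translation estimate with e = h and l =
  \<tau> = 1 gives |h| V \<le> 2 r V; such y exist only if |h| < 2 r.\<close>

lemma bv_double_integral_ball:
  fixes \<Omega> :: "(real ^ 'n) set"
  assumes v: "bv_rep \<Omega> V v" and sub: "ball a r \<subseteq> \<Omega>" and "0 < r"
  shows "(\<integral>\<^sup>+y. (\<integral>\<^sup>+x. ennreal \<bar>v x - v y\<bar> * indicator (ball a r) x \<partial>lborel) * indicator (ball a r) y \<partial>lborel)
    \<le> ennreal (2 * r * V) * emeasure lborel (ball (0 :: real ^ 'n) (2 * r))" (is "?lhs \<le> _")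
proof -
  note [measurable] = bv_rep_measurable[OF v]
  have "0 \<le> V" by (rule bv_rep_nonneg[OF v])
  let ?B = "ball a r"
  have [measurable]: "?B \<in> sets borel" by simp
  let ?f = "\<lambda>h y. ennreal \<bar>v (y + h) - v y\<bar> * (indicator ?B (y + h) * indicator ?B y)"
  have "?lhs = (\<integral>\<^sup>+y. (\<integral>\<^sup>+h. ennreal \<bar>v (h + y) - v y\<bar> * indicator ?B (h + y) \<partial>lborel) * indicator ?B y \<partial>lborel)"
    by (subst nn_integral_translate) auto
  also have "\<dots> = (\<integral>\<^sup>+y. \<integral>\<^sup>+h. ?f h y \<partial>lborel \<partial>lborel)"
    by (subst nn_integral_multc[symmetric]) (auto simp: mult.assoc add.commute)
  also have "\<dots> = (\<integral>\<^sup>+h. \<integral>\<^sup>+y. ?f h y \<partial>lborel \<partial>lborel)"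
    by (rule nn_integral_swap) measurable
  also have "\<dots> \<le> (\<integral>\<^sup>+h. ennreal (2 * r * V) * indicator (ball (0 :: real ^ 'n) (2 * r)) h \<partial>lborel)"
  proof (rule nn_integral_mono)
    fix h :: "real ^ 'n"
    let ?D = "{y. y \<in> ?B \<and> y + h \<in> ?B}"
    have f_eq: "?f h y = ennreal \<bar>v (y + 1 *\<^sub>R h) - v y\<bar> * indicator ?D y" for y
      by (auto simp: indicator_def)
    have small: "norm h < 2 * r" if "y \<in> ?D" for y
    proof -
      have "norm h \<le> dist a y + dist a (y + h)"
        using dist_triangle[of y "y + h" a] by (simp add: dist_norm norm_minus_commute)
      then show ?thesis using that by (auto simp only: mem_ball mem_Collect_eq)
    qed
    show "(\<integral>\<^sup>+y. ?f h y \<partial>lborel) \<le> ennreal (2 * r * V) * indicator (ball 0 (2 * r)) h"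
    proof (cases "h = 0 \<or> 2 * r \<le> norm h")
      case True
      have "?f h y = 0" for y
      proof (cases "h = 0")
        case False
        with True small[of y] have "y \<notin> ?D" by linarith
        then show ?thesis by (auto simp: indicator_def)
      qed simp
      then have "(\<integral>\<^sup>+y. ?f h y \<partial>lborel) = (\<integral>\<^sup>+y. 0 \<partial>(lborel :: (real ^ 'n) measure))" by (simp only:)
      then show ?thesis by simp
    next
      case False
      have "open ((\<lambda>y. y + h) -` ?B)" by (intro open_vimage continuous_intros) auto
      then have "open (?B \<inter> (\<lambda>y. y + h) -` ?B)" by (intro open_Int) auto
      moreover have "?B \<inter> (\<lambda>y. y + h) -` ?B = ?D" by auto
      ultimately have "open ?D" by simp
      have "(\<integral>\<^sup>+y. ennreal \<bar>v (y + 1 *\<^sub>R h) - v y\<bar> * indicator ?D y \<partial>lborel) \<le> ennreal (1 * norm h * V)"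
      proof (rule bv_translate_le[OF v \<open>open ?D\<close>])
        fix x and s :: real assume "x \<in> ?D" "0 \<le> s" "s \<le> 1"
        then have "(1 - s) *\<^sub>R x + s *\<^sub>R (x + h) \<in> ?B"
          by (intro convexD_alt[OF convex_ball]) auto
        moreover have "(1 - s) *\<^sub>R x + s *\<^sub>R (x + h) = x + s *\<^sub>R h" by (simp add: algebra_simps)
        ultimately show "x + s *\<^sub>R h \<in> \<Omega>" using sub by auto
      next
        fix y
        have "measure lborel {s \<in> {0..1}. y - s *\<^sub>R h \<in> ?D} \<le> measure lborel {0..1::real}"
        proof (rule measure_mono_fmeasurable)
          have "open ((\<lambda>s. y - s *\<^sub>R h) -` ?D)" by (intro open_vimage \<open>open ?D\<close> continuous_intros)
          moreover have eq: "{s \<in> {0..1}. y - s *\<^sub>R h \<in> ?D} = {0..1} \<inter> (\<lambda>s. y - s *\<^sub>R h) -` ?D" by auto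
          ultimately show "{s \<in> {0..1}. y - s *\<^sub>R h \<in> ?D} \<in> sets lborel"
            unfolding eq sets_lborel by (intro sets.Int borel_open[of "_ -` _"]) auto
        qed (auto simp: fmeasurable_def)
        then show "measure lborel {s \<in> {0..1}. y - s *\<^sub>R h \<in> ?D} \<le> 1" by simp
      qed (use False in auto)
      also have "\<dots> \<le> ennreal (2 * r * V)" using False \<open>0 \<le> V\<close> by (intro ennreal_leI mult_right_mono) auto
      finally show ?thesis unfolding f_eq using False by simp
    qed
  qed
  finally show ?thesis by (simp add: nn_integral_cmult_indicator)
qed

text \<open>The double integral bounds the average over y of the integral of |v - v(y)|, and c is
  v(y) for some y that does not exceed the resulting bound. The factor 2^d is the volume ratio of
  the balls of radius 2 r and r.\<close>

lemma bv_poincare_ball: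
  fixes \<Omega> :: "(real ^ 'n) set"
  assumes v: "bv_rep \<Omega> V v" and sub: "ball a r \<subseteq> \<Omega>" and "0 < r"
  shows "\<exists>c. (\<integral>\<^sup>+x. ennreal \<bar>v x - c\<bar> * indicator (ball a r) x \<partial>lborel)
    \<le> ennreal (2 * r * 2 ^ CARD('n) * V)"
proof -
  note [measurable] = bv_rep_measurable[OF v]
  have "0 \<le> V" by (rule bv_rep_nonneg[OF v])
  have [measurable]: "ball a r \<in> sets borel" by simp
  have B: "emeasure lborel (ball b s) = ennreal (measure lborel (ball b s))" for b :: "real ^ 'n" and s
    using emeasure_lborel_ball_finite[of b s] by (simp add: emeasure_eq_ennreal_measure less_top)
  have pos: "0 < measure lborel (ball a r)" using \<open>0 < r\<close> by (rule content_ball_pos)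
  have double: "measure lborel (ball (0 :: real ^ 'n) (2 * r)) = 2 ^ CARD('n) * measure lborel (ball a r)"
    using \<open>0 < r\<close> by (simp add: content_ball power_mult_distrib)
  have "\<exists>y\<in>ball a r. (\<integral>\<^sup>+x. ennreal \<bar>v x - v y\<bar> * indicator (ball a r) x \<partial>lborel)
      \<le> ennreal (2 * r * 2 ^ CARD('n) * V)"
  proof (rule exists_le_average[where M = lborel])
    have "ennreal (2 * r * V) * emeasure lborel (ball (0 :: real ^ 'n) (2 * r))
        = ennreal (2 * r * 2 ^ CARD('n) * V) * emeasure lborel (ball a r)"
      unfolding B double using pos \<open>0 < r\<close> \<open>0 \<le> V\<close>
      by (subst (1 2) ennreal_mult[symmetric]) (auto simp: mult_ac)
    then show "(\<integral>\<^sup>+y. (\<integral>\<^sup>+x. ennreal \<bar>v x - v y\<bar> * indicator (ball a r) x \<partial>lborel) * indicator (ball a r) y \<partial>lborel)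
        \<le> ennreal (2 * r * 2 ^ CARD('n) * V) * emeasure lborel (ball a r)"
      using bv_double_integral_ball[OF assms] by simp
    show "(\<lambda>y. \<integral>\<^sup>+x. ennreal \<bar>v x - v y\<bar> * indicator (ball a r) x \<partial>lborel) \<in> borel_measurable lborel"
      by measurable
  qed (use B pos in auto)
  then show ?thesis by auto
qed

section \<open>Sets with short intersections along lines\<close>

text \<open>Substitution y = x + s e and Tonelli: a fixed y in E is counted only for the parameters
  s with y - s e in A, and these have measure at most \<tau>.\<close>

lemma nn_integral_line_layer:
  fixes F :: "'a::euclidean_space \<Rightarrow> ennreal"
  assumes [measurable]: "F \<in> borel_measurable borel" "A \<in> sets borel" "E \<in> sets borel"
    and line: "\<And>y. emeasure lborel {s. y - s *\<^sub>R e \<in> A} \<le> \<tau>"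
    and sub: "\<And>x s. x \<in> A \<Longrightarrow> h1 \<le> s \<Longrightarrow> s \<le> h2 \<Longrightarrow> x + s *\<^sub>R e \<in> E"
  shows "(\<integral>\<^sup>+s. (\<integral>\<^sup>+x. F (x + s *\<^sub>R e) * indicator A x \<partial>lborel) * indicator {h1..h2} s \<partial>lborel)
    \<le> \<tau> * (\<integral>\<^sup>+y. F y * indicator E y \<partial>lborel)" (is "?lhs \<le> _")
proof -
  have "?lhs = (\<integral>\<^sup>+s. \<integral>\<^sup>+y. F y * indicator A (y - s *\<^sub>R e) * indicator {h1..h2} s \<partial>lborel \<partial>lborel)"
  proof (rule nn_integral_cong)
    fix s :: real
    have "(\<integral>\<^sup>+x. F (x + s *\<^sub>R e) * indicator A x \<partial>lborel) = (\<integral>\<^sup>+y. F y * indicator A (y - s *\<^sub>R e) \<partial>lborel)"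
      using nn_integral_translate[of "\<lambda>y. F y * indicator A (y - s *\<^sub>R e)" "s *\<^sub>R e"] by simp
    then show "(\<integral>\<^sup>+x. F (x + s *\<^sub>R e) * indicator A x \<partial>lborel) * indicator {h1..h2} s
        = (\<integral>\<^sup>+y. F y * indicator A (y - s *\<^sub>R e) * indicator {h1..h2} s \<partial>lborel)"
      by (simp add: nn_integral_multc)
  qed
  also have "\<dots> = (\<integral>\<^sup>+y. \<integral>\<^sup>+s. F y * indicator A (y - s *\<^sub>R e) * indicator {h1..h2} s \<partial>lborel \<partial>lborel)"
    by (rule nn_integral_swap) measurable
  also have "\<dots> \<le> (\<integral>\<^sup>+y. \<tau> * (F y * indicator E y) \<partial>lborel)"
  proof (rule nn_integral_mono)
    fix y
    have "(\<integral>\<^sup>+s. F y * indicator A (y - s *\<^sub>R e) * indicator {h1..h2} s \<partial>lborel)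
        \<le> (\<integral>\<^sup>+s. (F y * indicator E y) * indicator {s. y - s *\<^sub>R e \<in> A} s \<partial>lborel)"
      using sub[of "y - s *\<^sub>R e" s for s] by (intro nn_integral_mono) (auto simp: indicator_def)
    also have "\<dots> = (F y * indicator E y) * emeasure lborel {s. y - s *\<^sub>R e \<in> A}"
      by (intro nn_integral_cmult_indicator) measurable
    also have "\<dots> \<le> \<tau> * (F y * indicator E y)"
      using line by (subst mult.commute, intro mult_right_mono) auto
    finally show "(\<integral>\<^sup>+s. F y * indicator A (y - s *\<^sub>R e) * indicator {h1..h2} s \<partial>lborel) \<le> \<tau> * (F y * indicator E y)" .
  qed
  also have "\<dots> = \<tau> * (\<integral>\<^sup>+y. F y * indicator E y \<partial>lborel)" by (rule nn_integral_cmult) measurable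
  finally show ?thesis .
qed

lemma emeasure_line_layer:
  assumes [measurable]: "A \<in> sets borel" "E \<in> sets borel"
    and line: "\<And>y. emeasure lborel {s. y - s *\<^sub>R e \<in> A} \<le> \<tau>"
    and sub: "\<And>x s. x \<in> A \<Longrightarrow> h1 \<le> s \<Longrightarrow> s \<le> h2 \<Longrightarrow> x + s *\<^sub>R e \<in> E"
    and "h1 \<le> h2"
  shows "emeasure lborel A * ennreal (h2 - h1) \<le> \<tau> * emeasure lborel E"
proof -
  have "(\<integral>\<^sup>+s. (\<integral>\<^sup>+x. 1 * indicator A x \<partial>lborel) * indicator {h1..h2} s \<partial>lborel) \<le> \<tau> * (\<integral>\<^sup>+y. 1 * indicator E y \<partial>lborel)"
    by (rule nn_integral_line_layer[OF _ assms(1,2) line sub]) auto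
  then show ?thesis using \<open>h1 \<le> h2\<close> by (simp add: nn_integral_cmult_indicator)
qed

text \<open>For a single shift s in [h1, h2], passing from v(x) to v(x + s e) costs \<tau> V, but
  the shifted integral is controlled only by \<kappa> V, without any gain. Averaging over s supplies
  the missing factor \<tau>: each point of E is reached from A only for a set of shifts of length at
  most \<tau>.\<close>

lemma bv_layer_le:
  fixes \<Omega> :: "(real ^ 'n) set"
  assumes v: "bv_rep \<Omega> V v" and A: "open A" and E [measurable]: "E \<in> sets borel"
    and line: "\<And>y. emeasure lborel {s. y - s *\<^sub>R e \<in> A} \<le> ennreal \<tau>"
    and sub1: "\<And>x s. x \<in> A \<Longrightarrow> 0 \<le> s \<Longrightarrow> s \<le> h2 \<Longrightarrow> x + s *\<^sub>R e \<in> \<Omega>"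
    and sub2: "\<And>x s. x \<in> A \<Longrightarrow> h1 \<le> s \<Longrightarrow> s \<le> h2 \<Longrightarrow> x + s *\<^sub>R e \<in> E"
    and "0 < \<tau>" "norm e = 1" "0 \<le> h1" "h1 < h2" "0 \<le> \<kappa>"
    and c: "(\<integral>\<^sup>+x. ennreal \<bar>v x - c\<bar> * indicator E x \<partial>lborel) \<le> ennreal (\<kappa> * V)"
  shows "(\<integral>\<^sup>+x. ennreal \<bar>v x - c\<bar> * indicator A x \<partial>lborel) \<le> ennreal (\<tau> * (1 + \<kappa> / (h2 - h1)) * V)"
proof -
  note [measurable] = bv_rep_measurable[OF v]
  have "0 \<le> V" by (rule bv_rep_nonneg[OF v])
  have [measurable]: "A \<in> sets borel" using A by simp
  let ?I = "\<integral>\<^sup>+x. ennreal \<bar>v x - c\<bar> * indicator A x \<partial>lborel"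
  let ?J = "\<lambda>s. \<integral>\<^sup>+x. ennreal \<bar>v (x + s *\<^sub>R e) - c\<bar> * indicator A x \<partial>lborel"
  have "?I \<le> ennreal (\<tau> * V) + ?J s" if s: "h1 \<le> s" "s \<le> h2" for s
  proof -
    have "(\<integral>\<^sup>+x. ennreal \<bar>v (x + s *\<^sub>R e) - v x\<bar> * indicator A x \<partial>lborel) \<le> ennreal (\<tau> * norm e * V)"
    proof (rule bv_translate_le[OF v A])
      fix y
      have "measure lborel {t \<in> {0..s}. y - t *\<^sub>R e \<in> A} \<le> enn2real (ennreal \<tau>)"
        unfolding measure_def
      proof (rule enn2real_mono)
        have "emeasure lborel {t \<in> {0..s}. y - t *\<^sub>R e \<in> A} \<le> emeasure lborel {t. y - t *\<^sub>R e \<in> A}"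
          by (rule emeasure_mono) (auto, measurable)
        then show "emeasure lborel {t \<in> {0..s}. y - t *\<^sub>R e \<in> A} \<le> ennreal \<tau>" using line order_trans by blast
      qed auto
      then show "measure lborel {t \<in> {0..s}. y - t *\<^sub>R e \<in> A} \<le> \<tau>" using \<open>0 < \<tau>\<close> by simp
    qed (use assms s in auto)
    moreover have "?I \<le> (\<integral>\<^sup>+x. ennreal \<bar>v (x + s *\<^sub>R e) - v x\<bar> * indicator A x
        + ennreal \<bar>v (x + s *\<^sub>R e) - c\<bar> * indicator A x \<partial>lborel)"
      by (intro nn_integral_mono) (auto simp: indicator_def simp flip: ennreal_plus intro!: ennreal_leI)
    ultimately show ?thesis
      using \<open>norm e = 1\<close> by (subst (asm) nn_integral_add) (auto intro: order_trans add_right_mono)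
  qed
  then have "(\<integral>\<^sup>+s. ?I * indicator {h1..h2} s \<partial>lborel)
      \<le> (\<integral>\<^sup>+s. ennreal (\<tau> * V) * indicator {h1..h2} s + ?J s * indicator {h1..h2} s \<partial>lborel)"
    by (intro nn_integral_mono) (auto simp: indicator_def)
  also have "\<dots> = ennreal (\<tau> * V) * ennreal (h2 - h1) + (\<integral>\<^sup>+s. ?J s * indicator {h1..h2} s \<partial>lborel)"
    using \<open>h1 < h2\<close> by (subst nn_integral_add) (auto simp: nn_integral_cmult_indicator)
  also have "\<dots> \<le> ennreal (\<tau> * V) * ennreal (h2 - h1) + ennreal \<tau> * ennreal (\<kappa> * V)"
  proof (rule add_left_mono)
    have "(\<integral>\<^sup>+s. ?J s * indicator {h1..h2} s \<partial>lborel) \<le> ennreal \<tau> * (\<integral>\<^sup>+x. ennreal \<bar>v x - c\<bar> * indicator E x \<partial>lborel)"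
      by (rule nn_integral_line_layer[OF _ _ E line sub2]) auto
    also have "\<dots> \<le> ennreal \<tau> * ennreal (\<kappa> * V)" using c by (rule mult_left_mono) simp
    finally show "(\<integral>\<^sup>+s. ?J s * indicator {h1..h2} s \<partial>lborel) \<le> ennreal \<tau> * ennreal (\<kappa> * V)" .
  qed
  also have "\<dots> = ennreal (\<tau> * (1 + \<kappa> / (h2 - h1)) * V) * ennreal (h2 - h1)"
    using assms \<open>0 \<le> V\<close> by (simp flip: ennreal_mult ennreal_plus) (simp add: field_simps)
  finally have "?I * ennreal (h2 - h1) \<le> ennreal (\<tau> * (1 + \<kappa> / (h2 - h1)) * V) * ennreal (h2 - h1)"
    using \<open>h1 < h2\<close> by (simp add: nn_integral_cmult_indicator)
  then have "ennreal (h2 - h1) * ?I \<le> ennreal (h2 - h1) * ennreal (\<tau> * (1 + \<kappa> / (h2 - h1)) * V)"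
    by (simp only: mult.commute[of "ennreal (h2 - h1)"])
  moreover have "ennreal (h2 - h1) \<noteq> 0" "ennreal (h2 - h1) \<noteq> top" using \<open>h1 < h2\<close> by simp_all
  ultimately show ?thesis using ennreal_mult_le_mult_iff by blast
qed

section \<open>Gluing local estimates\<close>

text \<open>C serves all weights of W, whereas c may depend on the weight and on v. V measures v on
  the whole of \<Omega>, so pieces can be glued without localising v; the bound on the total weight
  of D pays for changing c.\<close>

definition good_set :: "(real ^ 'n) set \<Rightarrow> (real ^ 'n \<Rightarrow> ennreal) set \<Rightarrow> (real ^ 'n) set \<Rightarrow> bool" where
  "good_set \<Omega> W D \<longleftrightarrow> open D \<and> (\<exists>C\<ge>0. \<forall>w\<in>W.
     (\<integral>\<^sup>+x. w x * indicator D x \<partial>lborel) \<le> ennreal C \<and>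
     (\<forall>V v. bv_rep \<Omega> V v \<longrightarrow>
        (\<exists>c. (\<integral>\<^sup>+x. ennreal \<bar>v x - c\<bar> * w x * indicator D x \<partial>lborel) \<le> ennreal (C * V))))"

text \<open>On the overlap, which has positive measure \<delta>, the two subtracted constants can be
  compared: as w \<ge> 1 there, |c2 - c1| \<delta> \<le> (C1 + C2) V. Replacing c2 by c1 on D2 then
  costs |c2 - c1| times the total weight of D2.\<close>

lemma good_set_Un:
  fixes \<Omega> :: "(real ^ 'n) set"
  assumes W: "\<And>w. w \<in> W \<Longrightarrow> w \<in> borel_measurable borel" "\<And>w x. w \<in> W \<Longrightarrow> 1 \<le> w x"
    and 1: "good_set \<Omega> W D1" and 2: "good_set \<Omega> W D2" and "D1 \<inter> D2 \<noteq> {}"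
  shows "good_set \<Omega> W (D1 \<union> D2)"
\<comment> \<open>The finiteness of the measure of the overlap is read off from some weight in W,
  hence the separate case.\<close>
proof (cases "W = {}")
  case True
  then show ?thesis using 1 2 by (auto simp: good_set_def)
next
  case False
  have D: "open D1" "open D2" using 1 2 by (auto simp: good_set_def)
  then have [measurable]: "D1 \<in> sets borel" "D2 \<in> sets borel" by auto
  obtain C1 where C1: "C1 \<ge> 0" "\<And>w. w \<in> W \<Longrightarrow> (\<integral>\<^sup>+x. w x * indicator D1 x \<partial>lborel) \<le> ennreal C1"
    "\<And>w V v. w \<in> W \<Longrightarrow> bv_rep \<Omega> V v \<Longrightarrow> \<exists>c. (\<integral>\<^sup>+x. ennreal \<bar>v x - c\<bar> * w x * indicator D1 x \<partial>lborel) \<le> ennreal (C1 * V)"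
    using 1 unfolding good_set_def by meson
  obtain C2 where C2: "C2 \<ge> 0" "\<And>w. w \<in> W \<Longrightarrow> (\<integral>\<^sup>+x. w x * indicator D2 x \<partial>lborel) \<le> ennreal C2"
    "\<And>w V v. w \<in> W \<Longrightarrow> bv_rep \<Omega> V v \<Longrightarrow> \<exists>c. (\<integral>\<^sup>+x. ennreal \<bar>v x - c\<bar> * w x * indicator D2 x \<partial>lborel) \<le> ennreal (C2 * V)"
    using 2 unfolding good_set_def by meson
  let ?I = "D1 \<inter> D2"
  have "open ?I" using D by auto
  then have "emeasure lborel ?I \<noteq> 0"
    using \<open>?I \<noteq> {}\<close> open_not_negligible[of ?I] by (auto simp: negligible_iff_emeasure0 emeasure_completion borel_open)
  moreover have "emeasure lborel ?I < top"
  proof -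
    obtain w where w: "w \<in> W" using False by auto
    have "emeasure lborel ?I = (\<integral>\<^sup>+x. indicator ?I x \<partial>lborel)" by simp
    also have "\<dots> \<le> (\<integral>\<^sup>+x. w x * indicator D1 x \<partial>lborel)"
      using W(2)[OF w] by (intro nn_integral_mono) (auto simp: indicator_def)
    also have "\<dots> \<le> ennreal C1" by (rule C1(2)[OF w])
    also have "\<dots> < top" by simp
    finally show ?thesis .
  qed
  ultimately obtain \<delta> where \<delta>: "emeasure lborel ?I = ennreal \<delta>" "0 < \<delta>"
    by (cases "emeasure lborel ?I") (auto simp: less_le)
  define C where "C = C1 + C2 + (C1 + C2) / \<delta> * C2"
  have "(\<integral>\<^sup>+x. w x * indicator (D1 \<union> D2) x \<partial>lborel) \<le> ennreal C" if w: "w \<in> W" for w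
  proof -
    note [measurable] = W(1)[OF w]
    have "(\<integral>\<^sup>+x. w x * indicator (D1 \<union> D2) x \<partial>lborel)
        \<le> (\<integral>\<^sup>+x. w x * indicator D1 x + w x * indicator D2 x \<partial>lborel)"
      by (intro nn_integral_mono) (auto simp: indicator_def)
    also have "\<dots> \<le> ennreal C1 + ennreal C2"
      using C1(2)[OF w] C2(2)[OF w] by (subst nn_integral_add) (auto intro: add_mono)
    also have "\<dots> \<le> ennreal C"
      using C1(1) C2(1) \<delta> by (simp add: C_def flip: ennreal_plus)
    finally show ?thesis .
  qed
  moreover have "\<exists>c. (\<integral>\<^sup>+x. ennreal \<bar>v x - c\<bar> * w x * indicator (D1 \<union> D2) x \<partial>lborel) \<le> ennreal (C * V)"
    if w: "w \<in> W" and v: "bv_rep \<Omega> V v" for w V v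
  proof -
    note [measurable] = W(1)[OF w] bv_rep_measurable[OF v]
    have "0 \<le> V" by (rule bv_rep_nonneg[OF v])
    obtain c1 where c1: "(\<integral>\<^sup>+x. ennreal \<bar>v x - c1\<bar> * w x * indicator D1 x \<partial>lborel) \<le> ennreal (C1 * V)"
      using C1(3)[OF w v] by blast
    obtain c2 where c2: "(\<integral>\<^sup>+x. ennreal \<bar>v x - c2\<bar> * w x * indicator D2 x \<partial>lborel) \<le> ennreal (C2 * V)"
      using C2(3)[OF w v] by blast
    have "ennreal \<bar>c2 - c1\<bar> * emeasure lborel ?I = (\<integral>\<^sup>+x. ennreal \<bar>c2 - c1\<bar> * indicator ?I x \<partial>lborel)"
      by (simp add: nn_integral_cmult_indicator)
    also have "\<dots> \<le> (\<integral>\<^sup>+x. ennreal \<bar>v x - c1\<bar> * w x * indicator D1 x + ennreal \<bar>v x - c2\<bar> * w x * indicator D2 x \<partial>lborel)"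
    proof (rule nn_integral_mono)
      fix x
      have "ennreal \<bar>c2 - c1\<bar> \<le> ennreal \<bar>v x - c1\<bar> + ennreal \<bar>v x - c2\<bar>"
        by (simp flip: ennreal_plus)
      also have "\<dots> \<le> ennreal \<bar>v x - c1\<bar> * w x + ennreal \<bar>v x - c2\<bar> * w x"
        using W(2)[OF w, of x] mult_left_mono[of 1 "w x"] by (intro add_mono) (metis mult.right_neutral zero_le)+
      finally show "ennreal \<bar>c2 - c1\<bar> * indicator ?I x
          \<le> ennreal \<bar>v x - c1\<bar> * w x * indicator D1 x + ennreal \<bar>v x - c2\<bar> * w x * indicator D2 x"
        by (auto simp: indicator_def)
    qed
    also have "\<dots> \<le> ennreal (C1 * V) + ennreal (C2 * V)"
      using c1 c2 by (subst nn_integral_add) (auto intro: add_mono)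
    finally have "\<bar>c2 - c1\<bar> * \<delta> \<le> C1 * V + C2 * V"
      using \<delta> C1(1) C2(1) \<open>0 \<le> V\<close> by (simp flip: ennreal_mult ennreal_plus)
    then have cc: "\<bar>c2 - c1\<bar> \<le> (C1 + C2) / \<delta> * V" using \<delta>(2) by (simp add: field_simps)
    have "(\<integral>\<^sup>+x. ennreal \<bar>v x - c1\<bar> * w x * indicator (D1 \<union> D2) x \<partial>lborel)
        \<le> (\<integral>\<^sup>+x. ennreal \<bar>v x - c1\<bar> * w x * indicator D1 x + (ennreal \<bar>v x - c2\<bar> * w x * indicator D2 x
            + ennreal \<bar>c2 - c1\<bar> * (w x * indicator D2 x)) \<partial>lborel)"
    proof (rule nn_integral_mono)
      fix x
      have "ennreal \<bar>v x - c1\<bar> * w x \<le> (ennreal \<bar>v x - c2\<bar> + ennreal \<bar>c2 - c1\<bar>) * w x"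
        by (intro mult_right_mono) (auto simp flip: ennreal_plus)
      then show "ennreal \<bar>v x - c1\<bar> * w x * indicator (D1 \<union> D2) x
          \<le> ennreal \<bar>v x - c1\<bar> * w x * indicator D1 x + (ennreal \<bar>v x - c2\<bar> * w x * indicator D2 x
            + ennreal \<bar>c2 - c1\<bar> * (w x * indicator D2 x))"
        by (auto simp: indicator_def distrib_right)
    qed
    also have "\<dots> = (\<integral>\<^sup>+x. ennreal \<bar>v x - c1\<bar> * w x * indicator D1 x \<partial>lborel)
        + ((\<integral>\<^sup>+x. ennreal \<bar>v x - c2\<bar> * w x * indicator D2 x \<partial>lborel)
        + ennreal \<bar>c2 - c1\<bar> * (\<integral>\<^sup>+x. w x * indicator D2 x \<partial>lborel))"
      by (simp add: nn_integral_add nn_integral_cmult)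
    also have "\<dots> \<le> ennreal (C1 * V) + (ennreal (C2 * V) + ennreal ((C1 + C2) / \<delta> * V) * ennreal C2)"
      by (intro add_mono mult_mono c1 c2 ennreal_leI cc C2(2)[OF w]) auto
    also have "\<dots> = ennreal (C * V)"
      using \<delta> C1(1) C2(1) \<open>0 \<le> V\<close> by (simp add: C_def algebra_simps flip: ennreal_mult ennreal_plus)
    finally show ?thesis by blast
  qed
  moreover have "0 \<le> C" using C1(1) C2(1) \<delta>(2) by (simp add: C_def)
  ultimately show ?thesis unfolding good_set_def using D by blast
qed

text \<open>A subfamily of largest cardinality with good nonempty union must exhaust \<Omega>:
  otherwise connectedness makes its union meet one of the remaining members, which can then be added
  by gluing.\<close>

lemma good_set_connected:
  fixes \<Omega> :: "(real ^ 'n) set"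
  assumes W: "\<And>w. w \<in> W \<Longrightarrow> w \<in> borel_measurable borel" "\<And>w x. w \<in> W \<Longrightarrow> 1 \<le> w x"
    and \<Omega>: "connected \<Omega>" "\<Omega> \<noteq> {}" and F: "finite F" "\<Union>F = \<Omega>" "\<And>D. D \<in> F \<Longrightarrow> good_set \<Omega> W D"
  shows "good_set \<Omega> W \<Omega>"
proof -
  define S where "S = {G. G \<subseteq> F \<and> \<Union>G \<noteq> {} \<and> good_set \<Omega> W (\<Union>G)}"
  have "finite S" using F(1) by (auto simp: S_def intro: finite_subset[of _ "Pow F"])
  moreover have "S \<noteq> {}"
  proof -
    obtain D where "D \<in> F" "D \<noteq> {}" using F(2) \<Omega>(2) by auto
    then have "{D} \<in> S" using F(3) by (auto simp: S_def)
    then show ?thesis by auto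
  qed
  ultimately obtain G where G: "G \<in> S" "\<And>H. H \<in> S \<Longrightarrow> card H \<le> card G"
    using Max_in[of "card ` S"] Max_ge[of "card ` S"] by (metis (no_types, lifting) finite_imageI image_iff image_is_empty imageI)
  have op: "open D" if "D \<in> F" for D using F(3)[OF that] by (simp add: good_set_def)
  show ?thesis
  proof (cases "\<Union>G = \<Omega>")
    case True
    then show ?thesis using G(1) by (simp add: S_def)
  next
    case False
    have "\<Union>G \<inter> \<Union>(F - G) \<noteq> {}"
    proof
      assume "\<Union>G \<inter> \<Union>(F - G) = {}"
      moreover have "G \<subseteq> F" using G(1) by (simp add: S_def)
      then have "open (\<Union>G)" "open (\<Union>(F - G))" using op by (blast intro: open_Union)+
      moreover have "\<Union>G \<union> \<Union>(F - G) = \<Omega>" using F(2) G(1) by (auto simp: S_def)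
      ultimately have "\<Union>G = {} \<or> \<Union>(F - G) = {}"
        using connectedD[OF \<Omega>(1), of "\<Union>G" "\<Union>(F - G)"] by blast
      then show False using False G(1) \<open>\<Union>G \<union> \<Union>(F - G) = \<Omega>\<close> by (auto simp: S_def)
    qed
    then obtain D where D: "D \<in> F" "D \<notin> G" "D \<inter> \<Union>G \<noteq> {}" by blast
    then have "good_set \<Omega> W (D \<union> \<Union>G)"
      using G(1) F(3) W by (intro good_set_Un) (auto simp: S_def)
    then have "insert D G \<in> S" using D G(1) by (auto simp: S_def)
    then have "card (insert D G) \<le> card G" by (rule G(2))
    moreover have "finite G" using G(1) F(1) by (auto simp: S_def intro: finite_subset)
    ultimately show ?thesis using D(2) by simp
  qed
qed

lemma good_set_compact:
  fixes \<Omega> :: "(real ^ 'n) set"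
  assumes W: "\<And>w. w \<in> W \<Longrightarrow> w \<in> borel_measurable borel" "\<And>w x. w \<in> W \<Longrightarrow> 1 \<le> w x"
    and \<Omega>: "connected \<Omega>" "\<Omega> \<noteq> {}" "bounded \<Omega>"
    and loc: "\<And>p. p \<in> closure \<Omega> \<Longrightarrow> \<exists>U. open U \<and> p \<in> U \<and> good_set \<Omega> W (U \<inter> \<Omega>)"
  shows "good_set \<Omega> W \<Omega>"
proof -
  obtain U where U: "\<And>p. p \<in> closure \<Omega> \<Longrightarrow> open (U p) \<and> p \<in> U p \<and> good_set \<Omega> W (U p \<inter> \<Omega>)"
    using loc by metis
  have "closure \<Omega> \<subseteq> (\<Union>p\<in>closure \<Omega>. U p)" using U by blast
  then obtain P where P: "P \<subseteq> closure \<Omega>" "finite P" "closure \<Omega> \<subseteq> (\<Union>p\<in>P. U p)"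
    using compactE_image[of "closure \<Omega>" "closure \<Omega>" U] U \<Omega>(3) by (metis compact_closure)
  show ?thesis
  proof (rule good_set_connected)
    show "finite ((\<lambda>p. U p \<inter> \<Omega>) ` P)" using P by simp
    show "\<Union>((\<lambda>p. U p \<inter> \<Omega>) ` P) = \<Omega>" using P(3) closure_subset[of \<Omega>] by blast
    show "good_set \<Omega> W D" if "D \<in> (\<lambda>p. U p \<inter> \<Omega>) ` P" for D
      using that U P(1) by blast
  qed (use W \<Omega> in auto)
qed

section \<open>Boundary charts\<close>

text \<open>\<rho> is the height above the boundary graph, measured along e and defined on the whole
  space; it replaces the graph function. Along e it grows with slope exactly 1, so the points of a
  line with height in an interval form a segment of the same length.\<close>

definition boundary_chart ::
    "(real ^ 'n) set \<Rightarrow> real ^ 'n \<Rightarrow> real ^ 'n \<Rightarrow> real \<Rightarrow> real \<Rightarrow> (real ^ 'n \<Rightarrow> real) \<Rightarrow> bool" where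
  "boundary_chart \<Omega> p e r K \<rho> \<longleftrightarrow> open \<Omega> \<and> norm e = 1 \<and> 0 < r \<and> 1 \<le> K \<and> p \<in> frontier \<Omega> \<and>
     (\<forall>x t. \<rho> (x + t *\<^sub>R e) = \<rho> x + t) \<and> (\<forall>x y. \<bar>\<rho> x - \<rho> y\<bar> \<le> K * dist x y) \<and> \<rho> p = 0 \<and>
     (\<forall>x\<in>ball p r. x \<in> \<Omega> \<longleftrightarrow> 0 < \<rho> x)"

text \<open>\<rho> x is x \<bullet> e minus the graph function at the projection of x. The
  projection does not increase distances, which gives K = 1 + L.\<close>

lemma lipschitz_domain_chart:
  fixes \<Omega> :: "(real ^ 'n) set"
  assumes "lipschitz_domain \<Omega>" "p \<in> frontier \<Omega>"
  shows "\<exists>e r K \<rho>. boundary_chart \<Omega> p e r K \<rho>"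
proof -
  have op: "open \<Omega>" using assms by (simp add: lipschitz_domain_def)
  have "\<exists>e r L. \<exists>g :: real ^ 'n \<Rightarrow> real.
        norm e = 1 \<and> r > 0 \<and> L-lipschitz_on {y. y \<bullet> e = 0} g \<and>
        \<Omega> \<inter> ball p r = {x \<in> ball p r. g (x - (x \<bullet> e) *\<^sub>R e) < x \<bullet> e}"
    using assms by (simp only: lipschitz_domain_def)
  then obtain e r L and g :: "real ^ 'n \<Rightarrow> real" where e: "norm e = 1" and r: "r > 0"
    and g: "L-lipschitz_on {y. y \<bullet> e = 0} g"
    and eq: "\<Omega> \<inter> ball p r = {x \<in> ball p r. g (x - (x \<bullet> e) *\<^sub>R e) < x \<bullet> e}"
    by (elim exE conjE)
  have ee: "e \<bullet> e = 1" using e by (simp add: norm_eq_1)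
  define \<pi> where "\<pi> x = x - (x \<bullet> e) *\<^sub>R e" for x
  define \<rho> where "\<rho> x = x \<bullet> e - g (\<pi> x)" for x
  have L: "0 \<le> L" using g by (rule lipschitz_on_nonneg)
  have \<pi>: "\<pi> x \<bullet> e = 0" for x by (simp add: \<pi>_def inner_diff_left ee)
  have \<pi>_norm: "norm (\<pi> z) \<le> norm z" for z
  proof -
    have "(norm (\<pi> z))\<^sup>2 = \<pi> z \<bullet> \<pi> z" by (rule power2_norm_eq_inner)
    also have "\<dots> = z \<bullet> z - (z \<bullet> e)\<^sup>2"
      by (simp add: \<pi>_def inner_diff_left inner_diff_right ee inner_commute power2_eq_square)
    also have "\<dots> \<le> (norm z)\<^sup>2" by (simp add: power2_norm_eq_inner)
    finally show ?thesis by (rule power2_le_imp_le) simp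
  qed
  have \<pi>_dist: "dist (\<pi> x) (\<pi> y) \<le> dist x y" for x y
  proof -
    have "\<pi> x - \<pi> y = \<pi> (x - y)" by (simp add: \<pi>_def inner_diff_left scaleR_left_diff_distrib)
    then show ?thesis using \<pi>_norm[of "x - y"] by (simp only: dist_norm)
  qed
  have lip: "\<bar>\<rho> x - \<rho> y\<bar> \<le> (1 + L) * dist x y" for x y
  proof -
    have "\<bar>(x - y) \<bullet> e\<bar> \<le> norm (x - y) * norm e" by (rule Cauchy_Schwarz_ineq2)
    then have "\<bar>x \<bullet> e - y \<bullet> e\<bar> \<le> dist x y" by (simp add: e dist_norm inner_diff_left)
    moreover have "dist (g (\<pi> x)) (g (\<pi> y)) \<le> L * dist (\<pi> x) (\<pi> y)"
      using \<pi> by (intro lipschitz_onD[OF g]) auto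
    then have "\<bar>g (\<pi> x) - g (\<pi> y)\<bar> \<le> L * dist x y"
      using mult_left_mono[OF \<pi>_dist[of x y] L] by (simp add: dist_real_def)
    ultimately show ?thesis by (simp add: \<rho>_def distrib_right)
  qed
  have shift: "\<rho> (x + t *\<^sub>R e) = \<rho> x + t" for x t
  proof -
    have "\<pi> (x + t *\<^sub>R e) = \<pi> x" by (simp add: \<pi>_def inner_add_left ee algebra_simps)
    then show ?thesis by (simp add: \<rho>_def inner_add_left ee)
  qed
  have iff: "x \<in> \<Omega> \<longleftrightarrow> 0 < \<rho> x" if "x \<in> ball p r" for x
  proof -
    have "x \<in> \<Omega> \<inter> ball p r \<longleftrightarrow> g (\<pi> x) < x \<bullet> e" unfolding eq using that by (simp add: \<pi>_def)
    then show ?thesis using that by (simp add: \<rho>_def)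
  qed
  \<comment> \<open>As p is not in the open set \<Omega>, its height is at most 0; a negative height
    would persist near p by the Lipschitz bound and keep p out of the closure.\<close>
  have "\<rho> p = 0"
  proof (rule ccontr)
    assume "\<rho> p \<noteq> 0"
    have "p \<notin> \<Omega>" using assms(2) op by (simp add: frontier_def interior_open)
    then have neg: "\<rho> p < 0" using iff[of p] r \<open>\<rho> p \<noteq> 0\<close> by auto
    let ?d = "min r (- \<rho> p / (1 + L))"
    have "0 < ?d" using neg r L by (auto intro: divide_neg_pos)
    moreover have "p \<in> closure \<Omega>" using assms(2) by (simp add: frontier_def)
    ultimately obtain x where x: "x \<in> \<Omega>" "dist x p < ?d" unfolding closure_approachable by blast
    then have "0 < \<rho> x" using iff[of x] by (auto simp: dist_commute)
    moreover have "dist x p < - \<rho> p / (1 + L)" using x(2) by (simp only: min_less_iff_conj)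
    then have "(1 + L) * dist x p < - \<rho> p" using L by (subst (asm) pos_less_divide_eq) (auto simp: mult.commute)
    ultimately show False using lip[of x p] by linarith
  qed
  then have "boundary_chart \<Omega> p e r (1 + L) \<rho>"
    unfolding boundary_chart_def using op e r L assms(2) shift lip iff by auto
  then show ?thesis by blast
qed

lemma bdist_frontier_pos:
  assumes "open \<Omega>" "x \<in> \<Omega>" "frontier \<Omega> \<noteq> {}"
  shows "0 < bdist \<Omega> x"
  unfolding bdist_def using assms
  by (intro infdist_pos_not_in_closed) (auto simp: frontier_def interior_open)

lemma bdist_ge:
  assumes "frontier \<Omega> \<noteq> {}" "\<And>q. q \<in> frontier \<Omega> \<Longrightarrow> d \<le> dist x q"
  shows "d \<le> bdist \<Omega> x"
  unfolding bdist_def infdist_def using assms by (auto intro: cINF_greatest)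

lemma bdist_le_dist: "q \<in> frontier \<Omega> \<Longrightarrow> bdist \<Omega> x \<le> dist x q"
  unfolding bdist_def by (rule infdist_le)

lemma bdist_continuous: "continuous_on A (bdist \<Omega>)"
  unfolding bdist_def by (intro continuous_intros)

lemma bdist_measurable [measurable]: "bdist \<Omega> \<in> borel_measurable borel"
  by (rule borel_measurable_continuous_onI[OF bdist_continuous])

text \<open>A frontier point q inside the chart ball has height at most 0, and the Lipschitz bound
  applies to x and q. A point q outside it is at least as far from x as p is, since x lies in the
  half ball; then p, of height 0, takes its place.\<close>

lemma chart_height_le_bdist:
  assumes ch: "boundary_chart \<Omega> p e r K \<rho>" and x: "x \<in> \<Omega>" "dist p x < r / 2"
  shows "\<rho> x \<le> K * bdist \<Omega> x"
proof -
  have K: "1 \<le> K" and lip: "\<bar>\<rho> x - \<rho> y\<bar> \<le> K * dist x y" and \<rho>p: "\<rho> p = 0"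
    and iff: "x \<in> ball p r \<Longrightarrow> x \<in> \<Omega> \<longleftrightarrow> 0 < \<rho> x" and op: "open \<Omega>" for x y
    using ch by (auto simp: boundary_chart_def)
  have "\<rho> x / K \<le> bdist \<Omega> x"
  proof (rule bdist_ge)
    show "frontier \<Omega> \<noteq> {}" using ch by (auto simp: boundary_chart_def)
    fix q assume q: "q \<in> frontier \<Omega>"
    show "\<rho> x / K \<le> dist x q"
    proof (cases "q \<in> ball p r")
      case True
      have "q \<notin> \<Omega>" using q op by (simp add: frontier_def interior_open)
      then have "\<rho> q \<le> 0" using iff[OF True] by simp
      then have "\<rho> x \<le> K * dist x q" using lip[of x q] by linarith
      then show ?thesis using K by (simp add: divide_le_eq mult.commute)
    next
      case False
      have "r \<le> dist p x + dist x q" using False dist_triangle[of p q x] by simp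
      then have "dist p x \<le> dist x q" using x(2) by linarith
      moreover have "\<rho> x \<le> K * dist p x" using lip[of x p] \<rho>p by (simp add: dist_commute)
      then have "\<rho> x / K \<le> dist p x" using K by (simp add: divide_le_eq mult.commute)
      ultimately show ?thesis by linarith
    qed
  qed
  then show ?thesis using K by (simp add: divide_le_eq mult.commute)
qed

text \<open>Moving down from x along e by \<rho> x leads to a point q of height 0, at distance
  exactly \<rho> x. The radius r / (2 K) keeps q inside the chart ball, where height 0 means a
  frontier point.\<close>

lemma chart_bdist_le_height:
  assumes ch: "boundary_chart \<Omega> p e r K \<rho>" and x: "x \<in> \<Omega>" "dist p x < r / (2 * K)"
  shows "bdist \<Omega> x \<le> \<rho> x"
proof -
  have K: "1 \<le> K" and e: "norm e = 1" and lip: "\<bar>\<rho> x - \<rho> y\<bar> \<le> K * dist x y" and \<rho>p: "\<rho> p = 0"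
    and iff: "x \<in> ball p r \<Longrightarrow> x \<in> \<Omega> \<longleftrightarrow> 0 < \<rho> x" and op: "open \<Omega>"
    and shift: "\<rho> (x + t *\<^sub>R e) = \<rho> x + t" and r: "0 < r" for x y t
    using ch by (auto simp: boundary_chart_def)
  have "2 * K * dist p x < r" using x(2) K by (simp add: pos_less_divide_eq mult.commute)
  moreover have "1 * dist p x \<le> K * dist p x" using K by (intro mult_right_mono) auto
  moreover have "\<bar>\<rho> x\<bar> \<le> K * dist p x" using lip[of x p] \<rho>p by (simp add: dist_commute)
  ultimately have small: "dist p x + \<bar>\<rho> x\<bar> < r" by linarith
  then have "x \<in> ball p r" by simp
  then have pos: "0 < \<rho> x" using iff x(1) by blast
  define q where "q = x + (- \<rho> x) *\<^sub>R e"
  have "\<rho> q = 0" unfolding q_def shift by simp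
  have dq: "dist x q = \<rho> x" using pos e by (simp add: q_def dist_norm)
  have "dist p q < r" using dist_triangle[of p q x] dq small pos by linarith
  then have "q \<in> ball p r" by simp
  then have "q \<notin> \<Omega>" using iff \<open>\<rho> q = 0\<close> by simp
  moreover have "q \<in> closure \<Omega>"
    unfolding closure_approachable
  proof (intro allI impI)
    fix d :: real assume "0 < d"
    \<comment> \<open>Small enough for q + t e to stay within d of q and inside the chart ball,
      where its height t > 0 places it in \<Omega>.\<close>
    define t where "t = min (d / 2) ((r - dist p q) / 2)"
    have "t \<le> d / 2" "t \<le> (r - dist p q) / 2" unfolding t_def by (rule min.cobounded1, rule min.cobounded2)
    moreover have "(r - dist p q) / 2 < r - dist p q" "d / 2 < d" using \<open>0 < d\<close> \<open>dist p q < r\<close> by simp_all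
    moreover have "0 < t" using \<open>0 < d\<close> \<open>dist p q < r\<close> by (simp add: t_def)
    ultimately have t: "0 < t" "t < d" "t < r - dist p q" by (auto intro: le_less_trans)
    have dt: "dist q (q + t *\<^sub>R e) = t" using t e by (simp add: dist_norm)
    have "dist p (q + t *\<^sub>R e) < r" using dist_triangle[of p "q + t *\<^sub>R e" q] dt t by linarith
    then have "q + t *\<^sub>R e \<in> \<Omega>" using iff[of "q + t *\<^sub>R e"] shift[of q t] \<open>\<rho> q = 0\<close> t by simp
    then show "\<exists>y\<in>\<Omega>. dist y q < d" using dt t by (metis dist_commute)
  qed
  ultimately have "q \<in> frontier \<Omega>" using op by (simp add: frontier_def interior_open)
  from bdist_le_dist[OF this, of x] dq show ?thesis by simp
qed

section \<open>Uniform estimates for thin sets in a chart\<close>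

definition line_thin :: "'a::euclidean_space \<Rightarrow> 'a set \<Rightarrow> real \<Rightarrow> bool" where
  "line_thin e A \<tau> \<longleftrightarrow> open A \<and> 0 < \<tau> \<and> (\<forall>y. emeasure lborel {s. y - s *\<^sub>R e \<in> A} \<le> ennreal \<tau>)"

text \<open>The constant c comes from the Poincare inequality on one fixed ball E inside \<Omega>,
  into which D is shifted along e. Hence the same c works for all thin sets A, as the summation over
  layers requires.\<close>

lemma chart_line_thin_estimate:
  fixes \<Omega> :: "(real ^ 'n) set"
  assumes ch: "boundary_chart \<Omega> p e r K \<rho>" and D: "D = ball p (r / (8 * K)) \<inter> \<Omega>"
  shows "\<exists>C\<ge>0. (\<forall>A \<tau>. A \<subseteq> D \<longrightarrow> line_thin e A \<tau> \<longrightarrow> emeasure lborel A \<le> ennreal (C * \<tau>)) \<and>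
    (\<forall>V v. bv_rep \<Omega> V v \<longrightarrow> (\<exists>c. \<forall>A \<tau>. A \<subseteq> D \<longrightarrow> line_thin e A \<tau> \<longrightarrow>
       (\<integral>\<^sup>+x. ennreal \<bar>v x - c\<bar> * indicator A x \<partial>lborel) \<le> ennreal (C * V * \<tau>)))"
proof -
  have K: "1 \<le> K" and e: "norm e = 1" and lip: "\<bar>\<rho> x - \<rho> y\<bar> \<le> K * dist x y" and \<rho>p: "\<rho> p = 0"
    and iff: "x \<in> ball p r \<Longrightarrow> x \<in> \<Omega> \<longleftrightarrow> 0 < \<rho> x"
    and shift: "\<rho> (x + t *\<^sub>R e) = \<rho> x + t" and r: "0 < r" for x y t
    using ch by (auto simp: boundary_chart_def)
  \<comment> \<open>With this s the ball E of radius 2 s has heights within K * 2 s = r / 4 of r /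
    2, hence positive ones; shifts between r / 2 - s and r / 2 + s carry points within s of p into
    E.\<close>
  define s where "s = r / (8 * K)"
  have s: "0 < s" "s \<le> r / 8" "K * (2 * s) = r / 4" using r K by (auto simp: s_def divide_simps)
  define h1 h2 where "h1 = r / 2 - s" and "h2 = r / 2 + s"
  define E where "E = ball (p + (r / 2) *\<^sub>R e) (2 * s)"
  have E\<Omega>: "E \<subseteq> \<Omega>"
  proof
    fix y assume "y \<in> E"
    then have y: "dist (p + (r / 2) *\<^sub>R e) y < 2 * s" by (simp add: E_def)
    have "dist p (p + (r / 2) *\<^sub>R e) = r / 2" using e r by (simp add: dist_norm)
    then have "dist p y < r" using dist_triangle[of p y "p + (r / 2) *\<^sub>R e"] y s r by linarith
    moreover have "K * dist (p + (r / 2) *\<^sub>R e) y \<le> K * (2 * s)" using y K by (intro mult_left_mono) auto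
    then have "0 < \<rho> y" using lip[of "p + (r / 2) *\<^sub>R e" y] shift[of p "r / 2"] \<rho>p s r by linarith
    ultimately show "y \<in> \<Omega>" using iff by simp
  qed
  have dist_D: "dist p x < s" "0 < \<rho> x" if "x \<in> D" for x
    using that iff[of x] s r by (auto simp: D s_def[symmetric])
  have sub1: "x + t *\<^sub>R e \<in> \<Omega>" if "x \<in> D" "0 \<le> t" "t \<le> h2" for x t
  proof -
    have "dist x (x + t *\<^sub>R e) = t" using that e by (simp add: dist_norm)
    then have "dist p (x + t *\<^sub>R e) < r"
      using dist_triangle[of p "x + t *\<^sub>R e" x] dist_D[OF that(1)] that(3) s r by (simp add: h2_def)
    then show ?thesis using iff[of "x + t *\<^sub>R e"] shift[of x t] dist_D[OF that(1)] that(2) by simp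
  qed
  have sub2: "x + t *\<^sub>R e \<in> E" if "x \<in> D" "h1 \<le> t" "t \<le> h2" for x t
  proof -
    have "dist (p + (r / 2) *\<^sub>R e) (x + t *\<^sub>R e) = norm ((p - x) + (r / 2 - t) *\<^sub>R e)"
      by (simp add: dist_norm algebra_simps)
    also have "\<dots> \<le> dist p x + \<bar>r / 2 - t\<bar>" using norm_triangle_ineq[of "p - x" "(r / 2 - t) *\<^sub>R e"] e by (simp add: dist_norm)
    also have "\<dots> < 2 * s" using dist_D[OF that(1)] that by (simp add: h1_def h2_def abs_le_iff)
    finally show ?thesis by (simp add: E_def)
  qed
  have h: "0 \<le> h1" "h1 < h2" using s r by (auto simp: h1_def h2_def)
  define \<kappa> where "\<kappa> = 2 * (2 * s) * 2 ^ CARD('n)"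
  define C where "C = 1 + \<kappa> / (h2 - h1) + measure lborel E / (h2 - h1)"
  have \<kappa>: "0 \<le> \<kappa>" using s by (simp add: \<kappa>_def)
  have C: "1 + \<kappa> / (h2 - h1) \<le> C" "measure lborel E / (h2 - h1) \<le> C" "0 \<le> C" using h \<kappa> by (auto simp: C_def)
  have Eb [measurable]: "E \<in> sets borel" by (simp add: E_def)
  have "emeasure lborel A \<le> ennreal (C * \<tau>)" if A: "A \<subseteq> D" "line_thin e A \<tau>" for A \<tau>
  proof -
    have "0 < \<tau>" using A by (simp add: line_thin_def)
    have "emeasure lborel A * ennreal (h2 - h1) \<le> ennreal \<tau> * emeasure lborel E"
      using A sub2 h by (intro emeasure_line_layer[where e = e]) (auto simp: line_thin_def)
    also have "emeasure lborel E = ennreal (measure lborel E)"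
      using emeasure_lborel_ball_finite unfolding E_def by (intro emeasure_eq_ennreal_measure) (auto simp: less_top)
    also have "ennreal \<tau> * \<dots> = ennreal (measure lborel E / (h2 - h1) * \<tau>) * ennreal (h2 - h1)"
      using \<open>0 < \<tau>\<close> h by (subst (1 2) ennreal_mult[symmetric]) auto
    finally have "ennreal (h2 - h1) * emeasure lborel A \<le> ennreal (h2 - h1) * ennreal (measure lborel E / (h2 - h1) * \<tau>)"
      by (simp only: mult.commute[of "ennreal (h2 - h1)"])
    moreover have "ennreal (h2 - h1) \<noteq> 0" "ennreal (h2 - h1) \<noteq> top" using h by simp_all
    ultimately have "emeasure lborel A \<le> ennreal (measure lborel E / (h2 - h1) * \<tau>)"
      using ennreal_mult_le_mult_iff by blast
    also have "\<dots> \<le> ennreal (C * \<tau>)" using C \<open>0 < \<tau>\<close> by (intro ennreal_leI mult_right_mono) auto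
    finally show ?thesis .
  qed
  moreover have "\<exists>c. \<forall>A \<tau>. A \<subseteq> D \<longrightarrow> line_thin e A \<tau> \<longrightarrow>
       (\<integral>\<^sup>+x. ennreal \<bar>v x - c\<bar> * indicator A x \<partial>lborel) \<le> ennreal (C * V * \<tau>)" if v: "bv_rep \<Omega> V v" for V v
  proof -
    have "0 \<le> V" by (rule bv_rep_nonneg[OF v])
    have "0 < 2 * s" using s by simp
    from bv_poincare_ball[OF v E\<Omega>[unfolded E_def] this]
    obtain c where c: "(\<integral>\<^sup>+x. ennreal \<bar>v x - c\<bar> * indicator E x \<partial>lborel) \<le> ennreal (\<kappa> * V)"
      by (auto simp: E_def \<kappa>_def)
    have "(\<integral>\<^sup>+x. ennreal \<bar>v x - c\<bar> * indicator A x \<partial>lborel) \<le> ennreal (C * V * \<tau>)"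
      if A: "A \<subseteq> D" "line_thin e A \<tau>" for A \<tau>
    proof -
      have \<tau>: "0 < \<tau>" "open A" using A by (auto simp: line_thin_def)
      have "(\<integral>\<^sup>+x. ennreal \<bar>v x - c\<bar> * indicator A x \<partial>lborel) \<le> ennreal (\<tau> * (1 + \<kappa> / (h2 - h1)) * V)"
        by (rule bv_layer_le[OF v \<tau>(2) Eb _ _ _ \<tau>(1) e h \<kappa> c])
           (use A sub1 sub2 in \<open>auto simp: line_thin_def\<close>)
      also have "\<dots> \<le> ennreal (\<tau> * C * V)"
        using C \<tau> \<open>0 \<le> V\<close> by (intro ennreal_leI mult_right_mono mult_left_mono) auto
      finally show ?thesis by (simp add: mult_ac)
    qed
    then show ?thesis by blast
  qed
  ultimately show ?thesis using C(3) by blast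
qed

text \<open>On the line y - s e the height is \<rho> y - s. In the layer it lies between 0 and K a,
  so s is confined to an interval of length K a.\<close>

lemma chart_line_thin_layer:
  fixes \<Omega> :: "(real ^ 'n) set"
  assumes ch: "boundary_chart \<Omega> p e r K \<rho>" and D: "D = ball p (r / (8 * K)) \<inter> \<Omega>" and "0 < a"
  shows "line_thin e {x \<in> D. bdist \<Omega> x < a} (K * a)"
proof -
  have K: "1 \<le> K" and op: "open \<Omega>" and iff: "x \<in> ball p r \<Longrightarrow> x \<in> \<Omega> \<longleftrightarrow> 0 < \<rho> x"
    and shift: "\<rho> (x + t *\<^sub>R e) = \<rho> x + t" and r: "0 < r" for x t
    using ch by (auto simp: boundary_chart_def)
  have small: "r / (8 * K) \<le> r / 2" using K r by (simp add: divide_simps)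
  have "open {x. bdist \<Omega> x < a}" by (intro open_Collect_less bdist_continuous continuous_intros)
  then have "open (D \<inter> {x. bdist \<Omega> x < a})" unfolding D using op by (intro open_Int) auto
  moreover have "D \<inter> {x. bdist \<Omega> x < a} = {x \<in> D. bdist \<Omega> x < a}" by auto
  moreover have "emeasure lborel {s. y - s *\<^sub>R e \<in> {x \<in> D. bdist \<Omega> x < a}} \<le> ennreal (K * a)" for y
  proof -
    have "{s. y - s *\<^sub>R e \<in> {x \<in> D. bdist \<Omega> x < a}} \<subseteq> {\<rho> y - K * a..\<rho> y}"
    proof
      fix s assume "s \<in> {s. y - s *\<^sub>R e \<in> {x \<in> D. bdist \<Omega> x < a}}"
      then have x: "y - s *\<^sub>R e \<in> D" "bdist \<Omega> (y - s *\<^sub>R e) < a" by auto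
      have "\<rho> (y + (- s) *\<^sub>R e) = \<rho> y + (- s)" by (rule shift)
      then have eq: "\<rho> (y - s *\<^sub>R e) = \<rho> y - s" by simp
      have "0 < \<rho> (y - s *\<^sub>R e)" using x iff[of "y - s *\<^sub>R e"] small r by (auto simp: D)
      moreover have "\<rho> (y - s *\<^sub>R e) \<le> K * bdist \<Omega> (y - s *\<^sub>R e)"
        using x small by (intro chart_height_le_bdist[OF ch]) (auto simp: D)
      moreover have "K * bdist \<Omega> (y - s *\<^sub>R e) \<le> K * a" using x K by (intro mult_left_mono) auto
      ultimately show "s \<in> {\<rho> y - K * a..\<rho> y}" by (simp add: eq)
    qed
    then have "emeasure lborel {s. y - s *\<^sub>R e \<in> {x \<in> D. bdist \<Omega> x < a}} \<le> emeasure lborel {\<rho> y - K * a..\<rho> y}"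
      by (rule emeasure_mono) simp
    also have "\<dots> = ennreal (K * a)" using K \<open>0 < a\<close> by simp
    finally show ?thesis .
  qed
  ultimately show ?thesis using K \<open>0 < a\<close> by (simp add: line_thin_def)
qed

section \<open>Summation over dyadic layers\<close>

lemma dyadic_shell_exists:
  fixes t :: real
  assumes "0 < t" "t < 1"
  shows "\<exists>k. 1 / 2 ^ Suc k \<le> t \<and> t < 1 / 2 ^ k"
proof -
  obtain n where n: "(1 / 2) ^ n < t" using real_arch_pow_inv[OF assms(1), of "1 / 2"] by auto
  define k where "k = (LEAST k. 1 / 2 ^ Suc k \<le> t)"
  have "1 / 2 ^ Suc n \<le> t" using n assms by (simp add: power_divide)
  then have "1 / 2 ^ Suc k \<le> t" unfolding k_def by (rule LeastI)
  moreover have "t < 1 / 2 ^ k"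
  proof (cases k)
    case (Suc j)
    then have "\<not> 1 / 2 ^ Suc j \<le> t" unfolding k_def by (intro not_less_Least) simp
    then show ?thesis using Suc by simp
  qed (use assms in simp)
  ultimately show ?thesis by blast
qed

text \<open>On the shell R / 2^(k+1) \<le> d < R / 2^k the weight is at most \<open>b k\<close>. The
  shell is enlarged to the full layer, over which f has integral at most M R / 2^k; this cancels R
  and the power of 2 in \<open>b k\<close> up to a factor 2. What remains is 2 M times the dyadic
  sum of the weights, which is at most 3, and R and m have disappeared.\<close>

lemma nn_integral_log_weight_le:
  fixes f :: "'a::euclidean_space \<Rightarrow> ennreal" and d :: "'a \<Rightarrow> real"
  assumes [measurable]: "f \<in> borel_measurable borel" "D \<in> sets borel" "d \<in> borel_measurable borel"
    and d: "\<And>x. x \<in> D \<Longrightarrow> 0 < d x \<and> d x < R" and "0 < R" "0 \<le> M" "1 \<le> m"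
    and layer: "\<And>a. 0 < a \<Longrightarrow> (\<integral>\<^sup>+x. f x * indicator {x \<in> D. d x < a} x \<partial>lborel) \<le> ennreal (M * a)"
  shows "(\<integral>\<^sup>+x. f x * ennreal (1 / d x * log_weight m (d x / R)) * indicator D x \<partial>lborel) \<le> ennreal (6 * M)"
proof -
  define b where "b k = 2 ^ Suc k / R * log_weight m (1 / 2 ^ k)" for k
  let ?g = "\<lambda>k x. ennreal (b k) * (f x * indicator {x \<in> D. d x < R / 2 ^ k} x)"
  have lw: "0 \<le> log_weight m (1 / 2 ^ k)" for k by (rule log_weight_nonneg) auto
  have b: "0 \<le> b k" for k using lw[of k] \<open>0 < R\<close> by (simp add: b_def)
  have "(\<integral>\<^sup>+x. f x * ennreal (1 / d x * log_weight m (d x / R)) * indicator D x \<partial>lborel)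
      \<le> (\<integral>\<^sup>+x. (\<Sum>k. ?g k x) \<partial>lborel)"
  proof (rule nn_integral_mono)
    fix x
    show "f x * ennreal (1 / d x * log_weight m (d x / R)) * indicator D x \<le> (\<Sum>k. ?g k x)"
    proof (cases "x \<in> D")
      case True
      then have t: "0 < d x / R" "d x / R < 1" using d[OF True] by auto
      then obtain k where k: "1 / 2 ^ Suc k \<le> d x / R" "d x / R < 1 / 2 ^ k"
        using dyadic_shell_exists by blast
      have "1 / d x \<le> 2 ^ Suc k / R" using k(1) d[OF True] \<open>0 < R\<close> by (simp add: divide_simps mult_ac)
      moreover have "log_weight m (d x / R) \<le> log_weight m (1 / 2 ^ k)"
        using t k by (intro log_weight_mono) auto
      ultimately have "1 / d x * log_weight m (d x / R) \<le> b k"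
        unfolding b_def using t d[OF True] \<open>0 < R\<close> by (intro mult_mono log_weight_nonneg) auto
      moreover have "d x < R / 2 ^ k" using k(2) \<open>0 < R\<close> by (simp add: divide_simps mult_ac)
      ultimately have "f x * ennreal (1 / d x * log_weight m (d x / R)) * indicator D x \<le> ?g k x"
        using True by (simp add: mult.commute[of "ennreal (b k)"]) (intro mult_left_mono ennreal_leI, auto)
      also have "\<dots> \<le> (\<Sum>k. ?g k x)" using sum_le_suminf[of "\<lambda>k. ?g k x" "{k}"] by simp
      finally show ?thesis .
    qed simp
  qed
  also have "\<dots> = (\<Sum>k. \<integral>\<^sup>+x. ?g k x \<partial>lborel)" by (rule nn_integral_suminf) measurable
  also have "\<dots> \<le> ennreal (6 * M)"
  proof (rule suminf_le_const)
    fix n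
    have "(\<Sum>k<n. \<integral>\<^sup>+x. ?g k x \<partial>lborel) \<le> (\<Sum>k<n. ennreal (2 * M * log_weight m (1 / 2 ^ k)))"
    proof (rule sum_mono)
      fix k
      have "(\<integral>\<^sup>+x. ?g k x \<partial>lborel) = ennreal (b k) * (\<integral>\<^sup>+x. f x * indicator {x \<in> D. d x < R / 2 ^ k} x \<partial>lborel)"
        by (rule nn_integral_cmult) measurable
      also have "\<dots> \<le> ennreal (b k) * ennreal (M * (R / 2 ^ k))"
        using \<open>0 < R\<close> by (intro mult_left_mono layer) auto
      also have "\<dots> = ennreal (2 * M * log_weight m (1 / 2 ^ k))"
        using b[of k] \<open>0 \<le> M\<close> \<open>0 < R\<close> by (subst ennreal_mult[symmetric]) (auto simp: b_def mult_ac)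
      finally show "(\<integral>\<^sup>+x. ?g k x \<partial>lborel) \<le> ennreal (2 * M * log_weight m (1 / 2 ^ k))" .
    qed
    also have "\<dots> = ennreal (2 * M * (\<Sum>k<n. log_weight m (1 / 2 ^ k)))"
      using lw \<open>0 \<le> M\<close> by (subst sum_ennreal) (auto simp: sum_distrib_left)
    also have "\<dots> \<le> ennreal (2 * M * 3)"
      using sum_log_weight_le[OF \<open>1 \<le> m\<close>] \<open>0 \<le> M\<close> by (intro ennreal_leI mult_left_mono) auto
    finally show "(\<Sum>k<n. \<integral>\<^sup>+x. ?g k x \<partial>lborel) \<le> ennreal (6 * M)" by (simp add: mult.commute)
  qed simp
  finally show ?thesis .
qed

section \<open>The upper bound\<close>

lemma iter_log_measurable [measurable]:
  assumes [measurable]: "f \<in> borel_measurable M"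
  shows "(\<lambda>x. iter_log m (f x)) \<in> borel_measurable M"
  by (induction m) (simp_all, measurable)

lemma log_weight_measurable [measurable]:
  assumes [measurable]: "f \<in> borel_measurable M"
  shows "(\<lambda>x. log_weight m (f x)) \<in> borel_measurable M"
  unfolding log_weight_def by measurable

section \<open>Weighted estimates in charts and interior balls\<close>

definition hardy_weight :: "(real ^ 'n) set \<Rightarrow> real \<Rightarrow> nat \<Rightarrow> real ^ 'n \<Rightarrow> ennreal" where
  "hardy_weight \<Omega> R m x = ennreal (1 / bdist \<Omega> x * log_weight m (bdist \<Omega> x / R))"

lemma hardy_weight_measurable [measurable]: "hardy_weight \<Omega> R m \<in> borel_measurable borel"
  unfolding hardy_weight_def by measurable

text \<open>Adding 1 gives the lower bound that gluing needs and lets the same estimate control the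
  unweighted integral of |v - c|, from which c is compared with the average. All R and m are taken
  together so that one constant serves them all.\<close>

definition hardy_weights :: "(real ^ 'n) set \<Rightarrow> (real ^ 'n \<Rightarrow> ennreal) set" where
  "hardy_weights \<Omega> = {\<lambda>x. 1 + hardy_weight \<Omega> R m x | R m. 0 < R \<and> 1 \<le> m \<and> (\<forall>x\<in>\<Omega>. bdist \<Omega> x < R)}"

text \<open>The summand s stems from the added 1, since the layer of width s is all of D; the 6 is
  the dyadic bound for the singular part.\<close>

lemma nn_integral_hardy_weight_le:
  fixes f :: "real ^ 'n \<Rightarrow> ennreal"
  assumes f [measurable]: "f \<in> borel_measurable borel" and "D \<in> sets borel" and \<Omega>: "open \<Omega>" "frontier \<Omega> \<noteq> {}" "D \<subseteq> \<Omega>"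
    and w: "w \<in> hardy_weights \<Omega>" and "0 \<le> M" "0 < s"
    and small: "\<And>x. x \<in> D \<Longrightarrow> bdist \<Omega> x < s"
    and layer: "\<And>a. 0 < a \<Longrightarrow> (\<integral>\<^sup>+x. f x * indicator {x \<in> D. bdist \<Omega> x < a} x \<partial>lborel) \<le> ennreal (M * a)"
  shows "(\<integral>\<^sup>+x. f x * w x * indicator D x \<partial>lborel) \<le> ennreal (M * (s + 6))"
proof -
  obtain R m where w_eq: "w = (\<lambda>x. 1 + hardy_weight \<Omega> R m x)" and R: "0 < R" "1 \<le> m" "\<forall>x\<in>\<Omega>. bdist \<Omega> x < R"
    using w by (auto simp: hardy_weights_def)
  note [measurable] = \<open>D \<in> sets borel\<close>
  have "(\<integral>\<^sup>+x. f x * w x * indicator D x \<partial>lborel)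
      = (\<integral>\<^sup>+x. f x * indicator D x + f x * hardy_weight \<Omega> R m x * indicator D x \<partial>lborel)"
    by (intro nn_integral_cong) (simp add: w_eq distrib_left distrib_right)
  also have "\<dots> = (\<integral>\<^sup>+x. f x * indicator D x \<partial>lborel) + (\<integral>\<^sup>+x. f x * hardy_weight \<Omega> R m x * indicator D x \<partial>lborel)"
    by (rule nn_integral_add) measurable
  also have "\<dots> \<le> ennreal (M * s) + ennreal (6 * M)"
  proof (rule add_mono)
    have "{x \<in> D. bdist \<Omega> x < s} = D" using small by auto
    then show "(\<integral>\<^sup>+x. f x * indicator D x \<partial>lborel) \<le> ennreal (M * s)" using layer[OF \<open>0 < s\<close>] by simp
    have "0 < bdist \<Omega> x \<and> bdist \<Omega> x < R" if "x \<in> D" for x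
      using that \<Omega> R(3) bdist_frontier_pos[of \<Omega> x] by auto
    then show "(\<integral>\<^sup>+x. f x * hardy_weight \<Omega> R m x * indicator D x \<partial>lborel) \<le> ennreal (6 * M)"
      unfolding hardy_weight_def using R \<open>0 \<le> M\<close> layer
      by (intro nn_integral_log_weight_le) auto
  qed
  also have "\<dots> = ennreal (M * (s + 6))"
    using \<open>0 \<le> M\<close> \<open>0 < s\<close> by (subst ennreal_plus[symmetric]) (auto simp: algebra_simps)
  finally show ?thesis .
qed

text \<open>The layer hypothesis is verified twice, for the constant 1 (total weight) and for |v -
  c|; in both cases the layer of width a is thin with \<tau> = K a. Every point of D is within s of
  the frontier point p, so D is itself a layer of width s.\<close>

lemma good_set_boundary:
  fixes \<Omega> :: "(real ^ 'n) set"
  assumes "lipschitz_domain \<Omega>" "p \<in> frontier \<Omega>"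
  shows "\<exists>U. open U \<and> p \<in> U \<and> good_set \<Omega> (hardy_weights \<Omega>) (U \<inter> \<Omega>)"
proof -
  obtain e r K \<rho> where ch: "boundary_chart \<Omega> p e r K \<rho>" using lipschitz_domain_chart[OF assms] by blast
  then have K: "1 \<le> K" and r: "0 < r" and op: "open \<Omega>" by (auto simp: boundary_chart_def)
  define s where "s = r / (8 * K)"
  have s: "0 < s" using r K by (simp add: s_def)
  define D where "D = ball p s \<inter> \<Omega>"
  have D': "D = ball p (r / (8 * K)) \<inter> \<Omega>" by (simp add: D_def s_def)
  have opD: "open D" using op by (auto simp: D_def)
  then have [measurable]: "D \<in> sets borel" by simp
  obtain C where C: "0 \<le> C" "\<And>A \<tau>. A \<subseteq> D \<Longrightarrow> line_thin e A \<tau> \<Longrightarrow> emeasure lborel A \<le> ennreal (C * \<tau>)"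
    "\<And>V v. bv_rep \<Omega> V v \<Longrightarrow> \<exists>c. \<forall>A \<tau>. A \<subseteq> D \<longrightarrow> line_thin e A \<tau> \<longrightarrow>
       (\<integral>\<^sup>+x. ennreal \<bar>v x - c\<bar> * indicator A x \<partial>lborel) \<le> ennreal (C * V * \<tau>)"
    using chart_line_thin_estimate[OF ch D'] by blast
  have thin: "line_thin e {x \<in> D. bdist \<Omega> x < a} (K * a)" if "0 < a" for a
    by (rule chart_line_thin_layer[OF ch D' that])
  have small: "bdist \<Omega> x < s" if "x \<in> D" for x
    using bdist_le_dist[OF assms(2), of x] that by (simp add: D_def dist_commute)
  have fr: "frontier \<Omega> \<noteq> {}" and sub: "D \<subseteq> \<Omega>" using assms(2) by (auto simp: D_def)
  have "good_set \<Omega> (hardy_weights \<Omega>) D"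
    unfolding good_set_def
  proof (intro conjI opD, rule exI[of _ "C * K * (s + 6)"], intro conjI ballI allI impI)
    show "0 \<le> C * K * (s + 6)" using C(1) K s by simp
    fix w assume w: "w \<in> hardy_weights \<Omega>"
    have "(\<integral>\<^sup>+x. 1 * w x * indicator D x \<partial>lborel) \<le> ennreal (C * K * (s + 6))"
    proof (rule nn_integral_hardy_weight_le[OF _ _ op fr sub w _ s small])
      fix a :: real assume "0 < a"
      have "(\<integral>\<^sup>+x. 1 * indicator {x \<in> D. bdist \<Omega> x < a} x \<partial>lborel) = emeasure lborel {x \<in> D. bdist \<Omega> x < a}"
        by simp
      also have "\<dots> \<le> ennreal (C * (K * a))" using thin[OF \<open>0 < a\<close>] by (intro C(2)) auto
      finally show "(\<integral>\<^sup>+x. 1 * indicator {x \<in> D. bdist \<Omega> x < a} x \<partial>lborel) \<le> ennreal (C * K * a)"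
        by (simp add: mult.assoc)
    qed (use C(1) K in auto)
    then show "(\<integral>\<^sup>+x. w x * indicator D x \<partial>lborel) \<le> ennreal (C * K * (s + 6))" by simp
    fix V v assume v: "bv_rep \<Omega> V v"
    note [measurable] = bv_rep_measurable[OF v]
    obtain c where c: "\<And>A \<tau>. A \<subseteq> D \<Longrightarrow> line_thin e A \<tau> \<Longrightarrow>
       (\<integral>\<^sup>+x. ennreal \<bar>v x - c\<bar> * indicator A x \<partial>lborel) \<le> ennreal (C * V * \<tau>)"
      using C(3)[OF v] by blast
    have "(\<integral>\<^sup>+x. ennreal \<bar>v x - c\<bar> * w x * indicator D x \<partial>lborel) \<le> ennreal (C * V * K * (s + 6))"
    proof (rule nn_integral_hardy_weight_le[OF _ _ op fr sub w _ s small])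
      fix a :: real assume "0 < a"
      have "(\<integral>\<^sup>+x. ennreal \<bar>v x - c\<bar> * indicator {x \<in> D. bdist \<Omega> x < a} x \<partial>lborel) \<le> ennreal (C * V * (K * a))"
        using thin[OF \<open>0 < a\<close>] by (intro c) auto
      then show "(\<integral>\<^sup>+x. ennreal \<bar>v x - c\<bar> * indicator {x \<in> D. bdist \<Omega> x < a} x \<partial>lborel) \<le> ennreal (C * V * K * a)"
        by (simp add: mult.assoc)
    qed (use C(1) K bv_rep_nonneg[OF v] in auto)
    then show "\<exists>c. (\<integral>\<^sup>+x. ennreal \<bar>v x - c\<bar> * w x * indicator D x \<partial>lborel) \<le> ennreal (C * K * (s + 6) * V)"
      by (intro exI[of _ c]) (simp add: mult_ac)
  qed
  then show ?thesis using s by (intro exI[of _ "ball p s"]) (auto simp: D_def)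
qed

text \<open>Away from the boundary the weights are bounded by 1 + 1/r uniformly in R and m, as the
  logarithmic factor is at most 1; the Poincare inequality on the ball then suffices.\<close>

lemma good_set_interior:
  fixes \<Omega> :: "(real ^ 'n) set"
  assumes "open \<Omega>" "p \<in> \<Omega>" "frontier \<Omega> \<noteq> {}"
  shows "\<exists>U. open U \<and> p \<in> U \<and> good_set \<Omega> (hardy_weights \<Omega>) (U \<inter> \<Omega>)"
proof -
  obtain r0 where r0: "0 < r0" "ball p r0 \<subseteq> \<Omega>" using assms openE by blast
  \<comment> \<open>Half the radius, so that all of U stays at distance at least r from the
    frontier.\<close>
  define r where "r = r0 / 2"
  define U where "U = ball p r"
  have r: "0 < r" "U \<subseteq> \<Omega>" using r0 by (auto simp: r_def U_def)
  have [measurable]: "U \<in> sets borel" by (simp add: U_def)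
  have dist: "r \<le> bdist \<Omega> x" if "x \<in> U" for x
  proof (rule bdist_ge[OF assms(3)])
    fix q assume "q \<in> frontier \<Omega>"
    then have "q \<notin> ball p r0" using r0 assms(1) by (auto simp: frontier_def interior_open)
    then show "r \<le> dist x q" using dist_triangle[of p q x] that by (simp add: U_def r_def)
  qed
  have w_le: "w x \<le> ennreal (1 + 1 / r)" if mem: "w \<in> hardy_weights \<Omega>" "x \<in> U" for w x
  proof -
    obtain R m where w: "w = (\<lambda>x. 1 + hardy_weight \<Omega> R m x)" and R: "0 < R" "\<forall>x\<in>\<Omega>. bdist \<Omega> x < R"
      using mem(1) unfolding hardy_weights_def by blast
    have b: "r \<le> bdist \<Omega> x" "bdist \<Omega> x < R" using dist[OF mem(2)] R r mem(2) by auto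
    then have "1 / bdist \<Omega> x * log_weight m (bdist \<Omega> x / R) \<le> 1 / r * 1"
      using r R by (intro mult_mono divide_left_mono log_weight_le_1 log_weight_nonneg) auto
    then have "w x \<le> ennreal 1 + ennreal (1 / r)"
      unfolding w hardy_weight_def by (intro add_mono ennreal_leI) auto
    then show ?thesis using r by (subst ennreal_plus) auto
  qed
  define C where "C = (1 + 1 / r) * (measure lborel U + 2 * r * 2 ^ CARD('n))"
  have C: "(1 + 1 / r) * measure lborel U \<le> C" "(1 + 1 / r) * (2 * r * 2 ^ CARD('n)) \<le> C"
    unfolding C_def using r by (intro mult_left_mono; simp)+
  have "good_set \<Omega> (hardy_weights \<Omega>) U"
    unfolding good_set_def
  proof (rule conjI, simp add: U_def, rule exI[of _ C], intro conjI ballI allI impI)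
    show "0 \<le> C" using r by (simp add: C_def)
    fix w assume w: "w \<in> hardy_weights \<Omega>"
    have "(\<integral>\<^sup>+x. w x * indicator U x \<partial>lborel) \<le> (\<integral>\<^sup>+x. ennreal (1 + 1 / r) * indicator U x \<partial>lborel)"
      using w_le[OF w] by (intro nn_integral_mono) (auto simp: indicator_def)
    also have "\<dots> = ennreal (1 + 1 / r) * ennreal (measure lborel U)"
      using emeasure_lborel_ball_finite[of p r]
      by (simp add: nn_integral_cmult_indicator U_def emeasure_eq_ennreal_measure less_top)
    also have "\<dots> \<le> ennreal C" using C(1) r by (subst ennreal_mult[symmetric]) (auto intro: ennreal_leI)
    finally show "(\<integral>\<^sup>+x. w x * indicator U x \<partial>lborel) \<le> ennreal C" .
    fix V v assume v: "bv_rep \<Omega> V v"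
    note [measurable] = bv_rep_measurable[OF v]
    obtain c where c: "(\<integral>\<^sup>+x. ennreal \<bar>v x - c\<bar> * indicator U x \<partial>lborel) \<le> ennreal (2 * r * 2 ^ CARD('n) * V)"
      using bv_poincare_ball[OF v, of p r] r unfolding U_def by blast
    have "(\<integral>\<^sup>+x. ennreal \<bar>v x - c\<bar> * w x * indicator U x \<partial>lborel)
        \<le> (\<integral>\<^sup>+x. ennreal (1 + 1 / r) * (ennreal \<bar>v x - c\<bar> * indicator U x) \<partial>lborel)"
      using w_le[OF w] by (intro nn_integral_mono) (auto simp: indicator_def mult.commute[of "ennreal (1 + 1 / r)"] intro!: mult_left_mono)
    also have "\<dots> = ennreal (1 + 1 / r) * (\<integral>\<^sup>+x. ennreal \<bar>v x - c\<bar> * indicator U x \<partial>lborel)"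
      by (rule nn_integral_cmult) measurable
    also have "\<dots> \<le> ennreal (1 + 1 / r) * ennreal (2 * r * 2 ^ CARD('n) * V)"
      by (rule mult_left_mono[OF c]) simp
    also have "\<dots> = ennreal ((1 + 1 / r) * (2 * r * 2 ^ CARD('n)) * V)"
      using r bv_rep_nonneg[OF v] by (subst ennreal_mult[symmetric]) (auto simp: mult.assoc)
    also have "\<dots> \<le> ennreal (C * V)"
      using C(2) bv_rep_nonneg[OF v] by (intro ennreal_leI mult_right_mono)
    finally show "\<exists>c. (\<integral>\<^sup>+x. ennreal \<bar>v x - c\<bar> * w x * indicator U x \<partial>lborel) \<le> ennreal (C * V)" by blast
  qed
  moreover have "U \<inter> \<Omega> = U" using r by blast
  ultimately show ?thesis using r(1) by (intro exI[of _ U]) (auto simp: U_def)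
qed

lemma bounded_domain_frontier:
  fixes \<Omega> :: "(real ^ 'n) set"
  assumes "bounded \<Omega>" "\<Omega> \<noteq> {}"
  shows "frontier \<Omega> \<noteq> {}"
  using assms by (metis frontier_eq_empty not_bounded_UNIV)

lemma good_set_lipschitz_domain:
  fixes \<Omega> :: "(real ^ 'n) set"
  assumes "bounded \<Omega>" "lipschitz_domain \<Omega>"
  shows "good_set \<Omega> (hardy_weights \<Omega>) \<Omega>"
proof (rule good_set_compact)
  have op: "open \<Omega>" and ne: "\<Omega> \<noteq> {}" using assms(2) by (auto simp: lipschitz_domain_def)
  show "connected \<Omega>" "\<Omega> \<noteq> {}" "bounded \<Omega>" using assms by (auto simp: lipschitz_domain_def)
  show "\<exists>U. open U \<and> p \<in> U \<and> good_set \<Omega> (hardy_weights \<Omega>) (U \<inter> \<Omega>)" if "p \<in> closure \<Omega>" for p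
    using that good_set_interior[OF op, of p] good_set_boundary[OF assms(2), of p] bounded_domain_frontier[OF assms(1) ne] op
    by (auto simp: frontier_def interior_open)
qed (auto simp: hardy_weights_def)

section \<open>Test fields and Borel representatives of BV functions\<close>

lemma test_field_gradients:
  fixes \<phi> :: "real ^ 'n \<Rightarrow> real ^ 'n"
  assumes "\<phi> \<in> test_fields \<Omega>"
  shows "\<exists>g. (\<forall>i x. ((\<lambda>x. \<phi> x $ i) has_derivative (\<lambda>v. g i x \<bullet> v)) (at x)) \<and> (\<forall>i. continuous_on UNIV (g i)) \<and>
    (\<forall>x. divergence \<phi> x = (\<Sum>i\<in>UNIV. g i x \<bullet> axis i 1))"
proof -
  obtain \<phi>' :: "real ^ 'n \<Rightarrow> (real ^ 'n) \<Rightarrow>\<^sub>L (real ^ 'n)"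
    where \<phi>': "\<And>x. (\<phi> has_derivative blinfun_apply (\<phi>' x)) (at x)" "continuous_on UNIV \<phi>'"
    using assms unfolding test_fields_def by blast
  define g where "g i x = (\<Sum>b\<in>Basis. (\<phi>' x b $ i) *\<^sub>R b)" for i x
  have g: "g i x \<bullet> v = \<phi>' x v $ i" for i x v
  proof -
    have "\<phi>' x v = \<phi>' x (\<Sum>b\<in>Basis. (v \<bullet> b) *\<^sub>R b)" by (simp add: euclidean_representation)
    also have "\<dots> = (\<Sum>b\<in>Basis. (v \<bullet> b) *\<^sub>R \<phi>' x b)" by (simp add: blinfun.sum_right blinfun.scaleR_right)
    finally have "\<phi>' x v $ i = (\<Sum>b\<in>Basis. (v \<bullet> b) * \<phi>' x b $ i)" by simp
    then show ?thesis by (simp add: g_def inner_sum_left inner_commute[of v] mult.commute)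
  qed
  show ?thesis
  proof (rule exI[of _ g], intro conjI allI)
    show "((\<lambda>x. \<phi> x $ i) has_derivative (\<lambda>v. g i x \<bullet> v)) (at x)" for i x
      unfolding g using \<phi>'(1) by (rule bounded_linear.has_derivative[OF bounded_linear_vec_nth])
    show "continuous_on UNIV (g i)" for i
      unfolding g_def using \<phi>'(2) by (intro continuous_intros)
    have "frechet_derivative \<phi> (at x) = \<phi>' x" for x using \<phi>'(1) by (rule frechet_derivative_at[symmetric])
    then show "divergence \<phi> x = (\<Sum>i\<in>UNIV. g i x \<bullet> axis i 1)" for x by (simp add: divergence_def g)
  qed
qed

lemma divergence_measurable:
  fixes \<phi> :: "real ^ 'n \<Rightarrow> real ^ 'n"
  assumes "\<phi> \<in> test_fields \<Omega>"
  shows "divergence \<phi> \<in> borel_measurable borel"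
proof -
  obtain g :: "'n \<Rightarrow> real ^ 'n \<Rightarrow> real ^ 'n" where g: "\<forall>i. continuous_on UNIV (g i)" "\<forall>x. divergence \<phi> x = (\<Sum>i\<in>UNIV. g i x \<bullet> axis i 1)"
    using test_field_gradients[OF assms] by (elim exE conjE) (rule that)
  have "divergence \<phi> = (\<lambda>x. \<Sum>i\<in>UNIV. g i x \<bullet> axis i 1)" by (rule ext) (rule g(2)[rule_format])
  then show ?thesis using g(1) by (auto intro!: borel_measurable_continuous_onI continuous_intros)
qed

text \<open>u is only Lebesgue measurable on \<Omega>; a Borel function equal to it almost
  everywhere, cut off outside \<Omega>, has the same integrals. The divergence of a test field is
  Borel, which moves the pairing from \<open>lebesgue\<close> to \<open>lborel\<close>.\<close>

lemma BV_rep_exists: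
  fixes \<Omega> :: "(real ^ 'n) set"
  assumes u: "u \<in> BV \<Omega>" and \<Omega>: "open \<Omega>"
  shows "\<exists>v. bv_rep \<Omega> (enn2real (bv_seminorm \<Omega> u)) v \<and> (AE x in lebesgue. indicator \<Omega> x * u x = v x)"
proof -
  have [measurable]: "\<Omega> \<in> sets borel" using \<Omega> by simp
  let ?u = "\<lambda>x. indicator \<Omega> x * u x"
  have ui: "integrable lebesgue ?u" using u by (simp add: BV_def set_integrable_def)
  then have um [measurable]: "?u \<in> borel_measurable lebesgue" by simp
  obtain g where g [measurable]: "g \<in> borel_measurable lborel" and ae: "AE x in lborel. ?u x = g x"
    using completion_ex_borel_measurable_real[OF um] by blast
  define v where "v x = indicator \<Omega> x * g x" for x
  have [measurable]: "v \<in> borel_measurable borel" using g unfolding v_def by measurable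
  have "AE x in lborel. ?u x = v x" using ae by eventually_elim (auto simp: v_def indicator_def)
  then have ae: "AE x in lebesgue. ?u x = v x" by (rule AE_completion)
  have vm [measurable]: "v \<in> borel_measurable lebesgue" by (simp add: measurable_completion)
  have "integrable lebesgue v" using integrable_cong_AE[OF um vm ae] ui by simp
  then have vi: "integrable lborel v" by (simp add: integrable_completion)
  have fin: "bv_seminorm \<Omega> u < top" using u by (simp add: BV_def)
  have "(\<integral>x. v x * divergence \<phi> x \<partial>lborel) \<le> enn2real (bv_seminorm \<Omega> u)" if \<phi>: "\<phi> \<in> test_fields \<Omega>" for \<phi>
  proof -
    note [measurable] = divergence_measurable[OF \<phi>]
    have dm [measurable]: "divergence \<phi> \<in> borel_measurable lebesgue" by (simp add: measurable_completion)
    have "(\<integral>x. v x * divergence \<phi> x \<partial>lborel) = (\<integral>x. v x * divergence \<phi> x \<partial>lebesgue)"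
      by (rule integral_completion[symmetric]) measurable
    also have "\<dots> = (\<integral>x. ?u x * divergence \<phi> x \<partial>lebesgue)"
    proof (rule integral_cong_AE)
      show "AE x in lebesgue. v x * divergence \<phi> x = ?u x * divergence \<phi> x"
        using ae by eventually_elim simp
    qed measurable
    also have "\<dots> = (LINT x:\<Omega>|lebesgue. u x * divergence \<phi> x)"
      by (simp add: set_lebesgue_integral_def mult.assoc)
    \<comment> \<open>Passing through \<open>ennreal\<close> clips negative values to 0, which can
      only increase the right-hand side.\<close>
    also have "\<dots> \<le> enn2real (ennreal (LINT x:\<Omega>|lebesgue. u x * divergence \<phi> x))"
      by (cases "0 \<le> (LINT x:\<Omega>|lebesgue. u x * divergence \<phi> x)") (auto simp: ennreal_neg)
    also have "\<dots> \<le> enn2real (bv_seminorm \<Omega> u)"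
      unfolding bv_seminorm_def using \<phi> fin by (intro enn2real_mono SUP_upper) (auto simp: bv_seminorm_def)
    finally show ?thesis .
  qed
  then have "bv_rep \<Omega> (enn2real (bv_seminorm \<Omega> u)) v" using vi by (auto simp: bv_rep_def v_def)
  then show ?thesis using ae by blast
qed

lemma hardy_integral_eq:
  fixes \<Omega> :: "(real ^ 'n) set"
  assumes \<Omega>: "open \<Omega>" "frontier \<Omega> \<noteq> {}" and ae: "AE x in lebesgue. indicator \<Omega> x * u x = v x"
    and [measurable]: "v \<in> borel_measurable borel"
  shows "hardy_integral \<Omega> R m u = (\<integral>\<^sup>+x. ennreal \<bar>v x - average \<Omega> u\<bar> * hardy_weight \<Omega> R m x * indicator \<Omega> x \<partial>lborel)"
proof -
  have [measurable]: "\<Omega> \<in> sets borel" using \<Omega> by simp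
  have "hardy_integral \<Omega> R m u = (\<integral>\<^sup>+x. ennreal \<bar>v x - average \<Omega> u\<bar> * hardy_weight \<Omega> R m x * indicator \<Omega> x \<partial>lebesgue)"
    unfolding hardy_integral_def
  proof (rule nn_integral_cong_AE)
    show "AE x in lebesgue. ennreal (\<bar>u x - average \<Omega> u\<bar> / bdist \<Omega> x *
        (\<Prod>k=1..m - 1. iter_log k (bdist \<Omega> x / R)) * (iter_log m (bdist \<Omega> x / R))\<^sup>2) * indicator \<Omega> x
      = ennreal \<bar>v x - average \<Omega> u\<bar> * hardy_weight \<Omega> R m x * indicator \<Omega> x"
      using ae
    proof eventually_elim
      case (elim x)
      show ?case
      proof (cases "x \<in> \<Omega>")
        case True
        have "\<bar>u x - average \<Omega> u\<bar> / bdist \<Omega> x *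
            (\<Prod>k=1..m - 1. iter_log k (bdist \<Omega> x / R)) * (iter_log m (bdist \<Omega> x / R))\<^sup>2
            = \<bar>v x - average \<Omega> u\<bar> * (1 / bdist \<Omega> x * log_weight m (bdist \<Omega> x / R))"
          using elim True by (simp add: log_weight_def)
        then show ?thesis by (simp only: hardy_weight_def ennreal_mult'[OF abs_ge_zero])
      qed simp
    qed
  qed
  also have "\<dots> = (\<integral>\<^sup>+x. ennreal \<bar>v x - average \<Omega> u\<bar> * hardy_weight \<Omega> R m x * indicator \<Omega> x \<partial>lborel)"
    by (rule nn_integral_completion) measurable
  finally show ?thesis .
qed

text \<open>The average replaces c at a bounded price: integrating v - c over \<Omega> shows that c
  and the average differ by at most C V / \<mu>, because w \<ge> 1.\<close>

lemma hardy_integral_le: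
  fixes \<Omega> :: "(real ^ 'n) set"
  assumes bd: "bounded \<Omega>" and lip: "lipschitz_domain \<Omega>"
  shows "\<exists>C>0. \<forall>R>0. (\<forall>x\<in>\<Omega>. bdist \<Omega> x < R) \<longrightarrow> (\<forall>m\<ge>1. \<forall>u\<in>BV \<Omega>.
    hardy_integral \<Omega> R m u \<le> ennreal C * bv_seminorm \<Omega> u)"
proof -
  have op: "open \<Omega>" and ne: "\<Omega> \<noteq> {}" using lip by (auto simp: lipschitz_domain_def)
  have fr: "frontier \<Omega> \<noteq> {}" by (rule bounded_domain_frontier[OF bd ne])
  have [measurable]: "\<Omega> \<in> sets borel" using op by simp
  obtain C where C: "0 \<le> C" "\<And>w. w \<in> hardy_weights \<Omega> \<Longrightarrow> (\<integral>\<^sup>+x. w x * indicator \<Omega> x \<partial>lborel) \<le> ennreal C"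
    "\<And>w V v. w \<in> hardy_weights \<Omega> \<Longrightarrow> bv_rep \<Omega> V v \<Longrightarrow>
       \<exists>c. (\<integral>\<^sup>+x. ennreal \<bar>v x - c\<bar> * w x * indicator \<Omega> x \<partial>lborel) \<le> ennreal (C * V)"
    using good_set_lipschitz_domain[OF bd lip] unfolding good_set_def by meson
  define \<mu> where "\<mu> = measure lborel \<Omega>"
  have fin: "emeasure lborel \<Omega> < \<infinity>" using bd by (rule emeasure_bounded_finite)
  then have em: "emeasure lborel \<Omega> = ennreal \<mu>" by (simp add: \<mu>_def emeasure_eq_ennreal_measure less_top)
  have "emeasure lborel \<Omega> \<noteq> 0"
    using op ne open_not_negligible[of \<Omega>] by (auto simp: negligible_iff_emeasure0 emeasure_completion borel_open)
  then have \<mu>: "0 < \<mu>" using em by (cases "\<mu> = 0") (auto simp: \<mu>_def less_le)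
  \<comment> \<open>C bounds the deviation from c, C / \<mu> * C is the price of passing from c to
    the average times the total weight, and the 1 makes the constant positive.\<close>
  have "hardy_integral \<Omega> R m u \<le> ennreal (1 + C + C / \<mu> * C) * bv_seminorm \<Omega> u"
    if R: "0 < R" "\<forall>x\<in>\<Omega>. bdist \<Omega> x < R" and m: "1 \<le> m" and u: "u \<in> BV \<Omega>" for R m u
  proof -
    define V where "V = enn2real (bv_seminorm \<Omega> u)"
    have V: "bv_seminorm \<Omega> u = ennreal V" using u by (simp add: V_def BV_def less_top)
    obtain v where v: "bv_rep \<Omega> V v" and ae: "AE x in lebesgue. indicator \<Omega> x * u x = v x"
      using BV_rep_exists[OF u op] by (auto simp: V_def)
    note [measurable] = bv_rep_measurable[OF v]
    have vi: "integrable lborel v" and v0: "\<And>x. x \<notin> \<Omega> \<Longrightarrow> v x = 0" using v by (auto simp: bv_rep_def)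
    have "0 \<le> V" by (rule bv_rep_nonneg[OF v])
    define w where "w x = 1 + hardy_weight \<Omega> R m x" for x
    have w: "w \<in> hardy_weights \<Omega>" using R m unfolding hardy_weights_def w_def[abs_def] by blast
    have [measurable]: "w \<in> borel_measurable borel" unfolding w_def by measurable
    obtain c where c: "(\<integral>\<^sup>+x. ennreal \<bar>v x - c\<bar> * w x * indicator \<Omega> x \<partial>lborel) \<le> ennreal (C * V)"
      using C(3)[OF w v] by blast
    let ?a = "average \<Omega> u"
    have a_eq: "?a = (\<integral>x. v x \<partial>lborel) / \<mu>"
    proof -
      have um: "(\<lambda>x. indicator \<Omega> x * u x) \<in> borel_measurable lebesgue"
        using u by (auto simp: BV_def set_integrable_def)
      have "(LINT y:\<Omega>|lebesgue. u y) = (\<integral>x. indicator \<Omega> x * u x \<partial>lebesgue)"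
        by (simp add: set_lebesgue_integral_def)
      also have "\<dots> = (\<integral>x. v x \<partial>lebesgue)"
        using um ae by (intro integral_cong_AE) (auto simp: measurable_completion)
      also have "\<dots> = (\<integral>x. v x \<partial>lborel)" by (rule integral_completion) measurable
      finally show ?thesis by (simp add: average_def \<mu>_def)
    qed
    have "\<bar>c - ?a\<bar> \<le> C / \<mu> * V"
    proof -
      have ci: "integrable lborel (\<lambda>x. c * indicator \<Omega> x)" using fin by simp
      have "(\<integral>x. v x - c * indicator \<Omega> x \<partial>lborel) = (?a - c) * \<mu>"
        using vi ci \<mu> by (simp add: a_eq \<mu>_def left_diff_distrib)
      then have "ennreal (\<bar>c - ?a\<bar> * \<mu>) = ennreal (norm (\<integral>x. v x - c * indicator \<Omega> x \<partial>lborel))"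
        using \<mu> by (simp add: abs_mult abs_minus_commute)
      also have "\<dots> \<le> (\<integral>\<^sup>+x. norm (v x - c * indicator \<Omega> x) \<partial>lborel)"
        using vi ci by (intro integral_norm_bound_ennreal) auto
      also have "\<dots> \<le> (\<integral>\<^sup>+x. ennreal \<bar>v x - c\<bar> * w x * indicator \<Omega> x \<partial>lborel)"
      proof (rule nn_integral_mono)
        fix x
        have "ennreal \<bar>v x - c\<bar> * 1 \<le> ennreal \<bar>v x - c\<bar> * w x" by (intro mult_left_mono) (auto simp: w_def)
        then show "ennreal (norm (v x - c * indicator \<Omega> x)) \<le> ennreal \<bar>v x - c\<bar> * w x * indicator \<Omega> x"
          using v0[of x] by (auto simp: indicator_def)
      qed
      also note c
      finally have "\<bar>c - ?a\<bar> * \<mu> \<le> C * V" using C(1) \<open>0 \<le> V\<close> by simp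
      then show ?thesis using \<mu> by (simp add: field_simps)
    qed
    have "hardy_integral \<Omega> R m u = (\<integral>\<^sup>+x. ennreal \<bar>v x - ?a\<bar> * hardy_weight \<Omega> R m x * indicator \<Omega> x \<partial>lborel)"
      by (rule hardy_integral_eq[OF op fr ae]) measurable
    also have "\<dots> \<le> (\<integral>\<^sup>+x. ennreal \<bar>v x - c\<bar> * w x * indicator \<Omega> x + ennreal \<bar>c - ?a\<bar> * (w x * indicator \<Omega> x) \<partial>lborel)"
    proof (rule nn_integral_mono)
      fix x
      have "ennreal \<bar>v x - ?a\<bar> * hardy_weight \<Omega> R m x \<le> (ennreal \<bar>v x - c\<bar> + ennreal \<bar>c - ?a\<bar>) * w x"
        by (intro mult_mono) (auto simp: w_def simp flip: ennreal_plus)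
      then show "ennreal \<bar>v x - ?a\<bar> * hardy_weight \<Omega> R m x * indicator \<Omega> x
          \<le> ennreal \<bar>v x - c\<bar> * w x * indicator \<Omega> x + ennreal \<bar>c - ?a\<bar> * (w x * indicator \<Omega> x)"
        by (auto simp: indicator_def distrib_right)
    qed
    also have "\<dots> = (\<integral>\<^sup>+x. ennreal \<bar>v x - c\<bar> * w x * indicator \<Omega> x \<partial>lborel) + ennreal \<bar>c - ?a\<bar> * (\<integral>\<^sup>+x. w x * indicator \<Omega> x \<partial>lborel)"
      by (simp add: nn_integral_add nn_integral_cmult)
    also have "\<dots> \<le> ennreal (C * V) + ennreal (C / \<mu> * V) * ennreal C"
      by (intro add_mono mult_mono c C(2)[OF w] ennreal_leI \<open>\<bar>c - ?a\<bar> \<le> C / \<mu> * V\<close>) auto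
    also have "\<dots> = ennreal ((C + C / \<mu> * C) * V)"
      using C(1) \<mu> \<open>0 \<le> V\<close> by (simp add: algebra_simps flip: ennreal_mult ennreal_plus)
    also have "\<dots> \<le> ennreal ((1 + C + C / \<mu> * C) * V)"
      using \<open>0 \<le> V\<close> by (intro ennreal_leI mult_right_mono) auto
    also have "\<dots> = ennreal (1 + C + C / \<mu> * C) * bv_seminorm \<Omega> u"
      unfolding V using C(1) \<mu> \<open>0 \<le> V\<close> by (intro ennreal_mult) auto
    finally show ?thesis .
  qed
  moreover have "0 < 1 + C + C / \<mu> * C" using C(1) \<mu> by (simp add: add_pos_nonneg)
  ultimately show ?thesis by blast
qed

section \<open>The lower bound\<close>

text \<open>A weak form of the fact that a 1-Lipschitz function has directional derivatives bounded
  by 1, obtained without differentiating u: the derivative of g is a limit of difference quotients,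
  a translation moves the difference onto u, and there it is at most the step length.\<close>

lemma lipschitz_integral_derivative_le:
  fixes u g :: "'a::euclidean_space \<Rightarrow> real"
  assumes u: "\<And>x y. \<bar>u x - u y\<bar> \<le> dist x y"
    and g: "\<And>x. (g has_derivative (\<lambda>v. g' x \<bullet> v)) (at x)" "continuous_on UNIV g'"
    and K: "compact K" "\<And>x. x \<notin> K \<Longrightarrow> g x = 0" "\<And>x. \<bar>g x\<bar> \<le> 1" and e: "norm e = 1"
  shows "integrable lborel (\<lambda>x. u x * (g' x \<bullet> e))"
    and "(\<integral>x. u x * (g' x \<bullet> e) \<partial>lborel) \<le> measure lborel K"
    and "\<And>x. x \<notin> K \<Longrightarrow> g' x = 0"
proof -
  have cu: "continuous_on A u" for A
  proof (rule continuous_on_subset[of UNIV])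
    show "continuous_on UNIV u"
      unfolding continuous_on_iff by (metis u dist_real_def le_less_trans)
  qed simp
  have cg: "continuous_on A g" for A
    using g(1) by (meson continuous_on_eq_continuous_at has_derivative_continuous open_UNIV continuous_on_subset subset_UNIV)
  have [measurable]: "u \<in> borel_measurable borel" "g \<in> borel_measurable borel" "g' \<in> borel_measurable borel"
    using cu cg g(2) by (auto intro: borel_measurable_continuous_onI)
  have [measurable]: "K \<in> sets borel" using K(1) by (rule borel_compact)
  show zero: "g' x = 0" if "x \<notin> K" for x
  proof -
    have "open (- K)" using K(1) by (simp add: compact_imp_closed open_Compl)
    have "(g has_derivative (\<lambda>v. 0)) (at x)"
      by (rule has_derivative_transform_within_open[OF has_derivative_const[of 0] \<open>open (- K)\<close>]) (use that K(2) in auto)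
    then have "(\<lambda>v. g' x \<bullet> v) = (\<lambda>v. 0)" using g(1) has_derivative_unique by blast
    then show ?thesis by (metis inner_eq_zero_iff)
  qed
  have "bounded (g' ` K)" using K(1) g(2) by (intro compact_imp_bounded compact_continuous_image) (auto intro: continuous_on_subset)
  then obtain B where B: "0 < B" "\<And>x. x \<in> K \<Longrightarrow> norm (g' x) \<le> B" unfolding bounded_pos by auto
  then have B': "norm (g' x) \<le> B" for x using zero[of x] by (cases "x \<in> K") auto
  obtain N where N: "\<And>x. x \<in> K \<Longrightarrow> norm x \<le> N" using compact_imp_bounded[OF K(1)] unfolding bounded_iff by auto
  \<comment> \<open>Enlarged by 1 because the translate g(x + a n e) may be nonzero up to distance
    \<open>a n\<close> \<le> 1 from K.\<close>
  let ?K = "cball (0 :: 'a) (N + 1)"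
  define a where "a n = inverse (real (Suc n))" for n
  have a: "0 < a n" "a n \<le> 1" "a \<longlonglongrightarrow> 0" for n
    using LIMSEQ_inverse_real_of_nat by (auto simp: a_def[abs_def] divide_simps)
  have lip: "\<bar>g (x + a n *\<^sub>R e) - g x\<bar> \<le> B * a n" for x n
  proof -
    have "norm (g (x + a n *\<^sub>R e) - g x) \<le> B * norm (x + a n *\<^sub>R e - x)"
    proof (rule differentiable_bound[of UNIV])
      show "onorm (\<lambda>v. g' y \<bullet> v) \<le> B" for y
      proof (rule onorm_le)
        fix v
        have "norm (g' y \<bullet> v) \<le> norm (g' y) * norm v" by (rule Cauchy_Schwarz_ineq2[unfolded real_norm_def[symmetric]])
        also have "\<dots> \<le> B * norm v" by (intro mult_right_mono B') auto
        finally show "norm (g' y \<bullet> v) \<le> B * norm v" .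
      qed
    qed (use g(1) in auto)
    then show ?thesis using e a(1)[of n] by simp
  qed
  have int: "integrable lborel (\<lambda>x. u x * h x)"
    if [measurable]: "h \<in> borel_measurable borel" and h: "\<And>x. \<bar>h x\<bar> \<le> b" "\<And>x. x \<notin> ?K \<Longrightarrow> h x = 0" for h b
  proof (rule Bochner_Integration.integrable_bound)
    show "integrable lborel (\<lambda>x. indicator ?K x *\<^sub>R (b * \<bar>u x\<bar>))"
      by (rule borel_integrable_compact) (auto intro!: continuous_intros cu)
    show "AE x in lborel. norm (u x * h x) \<le> norm (indicator ?K x *\<^sub>R (b * \<bar>u x\<bar>))"
    proof (rule AE_I2)
      fix x
      have "\<bar>u x\<bar> * \<bar>h x\<bar> \<le> \<bar>u x\<bar> * \<bar>b\<bar>" using h(1)[of x] by (intro mult_left_mono) auto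
      then show "norm (u x * h x) \<le> norm (indicator ?K x *\<^sub>R (b * \<bar>u x\<bar>))"
        using h(2)[of x] by (cases "x \<in> ?K") (auto simp: abs_mult mult.commute)
    qed
  qed measurable
  have outK: "x \<notin> K" "x + a n *\<^sub>R e \<notin> K" if "x \<notin> ?K" for x n
  proof -
    show "x \<notin> K" using that N[of x] by auto
    have "norm x \<le> norm (x + a n *\<^sub>R e) + norm (a n *\<^sub>R e)" using norm_triangle_ineq4[of "x + a n *\<^sub>R e" "a n *\<^sub>R e"] by simp
    then show "x + a n *\<^sub>R e \<notin> K" using that N[of "x + a n *\<^sub>R e"] a(1,2)[of n] e by auto
  qed
  define q where "q n x = (g (x + a n *\<^sub>R e) - g x) / a n" for n x
  have q_le: "\<bar>q n x\<bar> \<le> B" for n x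
    using lip[of x n] a(1)[of n] by (simp add: q_def abs_divide divide_le_eq)
  have q_0: "q n x = 0" if "x \<notin> ?K" for n x using outK[OF that] K(2) by (simp add: q_def)
  have [measurable]: "q n \<in> borel_measurable borel" for n unfolding q_def by measurable
  have iB: "integrable lborel (\<lambda>x. u x * (B * indicator ?K x))"
    using B(1) by (intro int[where b = B]) (auto simp: indicator_def)
  have "\<bar>g' x \<bullet> e\<bar> \<le> B" for x using Cauchy_Schwarz_ineq2[of "g' x" e] B'[of x] e by simp
  then show "integrable lborel (\<lambda>x. u x * (g' x \<bullet> e))"
    using zero outK(1) by (intro int) auto
  have "(\<lambda>n. \<integral>x. u x * q n x \<partial>lborel) \<longlonglongrightarrow> (\<integral>x. u x * (g' x \<bullet> e) \<partial>lborel)"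
  proof (rule integral_dominated_convergence[where w = "\<lambda>x. \<bar>u x * (B * indicator ?K x)\<bar>"])
    show "integrable lborel (\<lambda>x. \<bar>u x * (B * indicator ?K x)\<bar>)" using iB by (rule integrable_abs)
    show "AE x in lborel. norm (u x * q n x) \<le> \<bar>u x * (B * indicator ?K x)\<bar>" for n
    proof (rule AE_I2)
      fix x show "norm (u x * q n x) \<le> \<bar>u x * (B * indicator ?K x)\<bar>"
        using q_le[of n x] q_0[of x n] B(1) by (cases "x \<in> ?K") (auto simp: abs_mult intro: mult_left_mono)
    qed
    show "AE x in lborel. (\<lambda>n. u x * q n x) \<longlonglongrightarrow> u x * (g' x \<bullet> e)"
    proof (intro AE_I2 tendsto_mult tendsto_const)
      fix x
      have "((\<lambda>t. g (x + t *\<^sub>R e)) has_real_derivative g' x \<bullet> e) (at 0)"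
      proof -
        have "((\<lambda>t. g (x + t *\<^sub>R e)) has_derivative (\<lambda>t. g' (x + 0 *\<^sub>R e) \<bullet> (t *\<^sub>R e))) (at 0)"
          by (rule has_derivative_compose[OF _ g(1)]) (auto intro!: derivative_eq_intros)
        then show ?thesis
          unfolding has_field_derivative_def by (rule has_derivative_eq_rhs) (simp add: fun_eq_iff mult.commute)
      qed
      then have "((\<lambda>t. (g (x + t *\<^sub>R e) - g x) / t) \<longlongrightarrow> g' x \<bullet> e) (at 0)" by (simp add: DERIV_def)
      moreover have "filterlim a (at 0) sequentially" using a by (simp add: filterlim_at less_imp_neq[THEN not_sym])
      ultimately show "(\<lambda>n. q n x) \<longlonglongrightarrow> g' x \<bullet> e" unfolding q_def by (rule filterlim_compose)
    qed
  qed measurable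
  moreover have "(\<integral>x. u x * q n x \<partial>lborel) \<le> measure lborel K" for n
  proof -
    have g0: "g x = 0" if "x \<notin> ?K" for x using outK(1)[OF that] K(2) by simp
    have i1: "integrable lborel (\<lambda>x. u x * g x)" by (rule int[where b = 1]) (use K(3) g0 in auto)
    have i2: "integrable lborel (\<lambda>x. u x * g (x + a n *\<^sub>R e))"
      by (rule int[where b = 1]) (use K(2,3) outK in auto)
    have i3: "integrable lborel (\<lambda>x. u (x - a n *\<^sub>R e) * g x)"
      using integrable_translate(1)[OF i2, of "- a n *\<^sub>R e"] by simp
    have "(\<integral>x. u x * q n x \<partial>lborel) = (\<integral>x. (u x * g (x + a n *\<^sub>R e) - u x * g x) / a n \<partial>lborel)"
      by (intro Bochner_Integration.integral_cong refl) (simp add: q_def right_diff_distrib)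
    also have "\<dots> = ((\<integral>x. u x * g (x + a n *\<^sub>R e) \<partial>lborel) - (\<integral>x. u x * g x \<partial>lborel)) / a n"
      by (subst integral_divide_zero, subst Bochner_Integration.integral_diff[OF i2 i1]) (rule refl)
    also have "(\<integral>x. u x * g (x + a n *\<^sub>R e) \<partial>lborel) = (\<integral>x. u (x - a n *\<^sub>R e) * g x \<partial>lborel)"
      using integrable_translate(2)[OF i2, of "- a n *\<^sub>R e"] by simp
    also have "(\<dots> - (\<integral>x. u x * g x \<partial>lborel)) / a n = (\<integral>x. (u (x - a n *\<^sub>R e) * g x - u x * g x) / a n \<partial>lborel)"
      by (subst integral_divide_zero, subst Bochner_Integration.integral_diff[OF i3 i1]) (rule refl)
    also have "\<dots> \<le> (\<integral>x. indicator K x \<partial>lborel)"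
    proof (rule integral_mono)
      show "integrable lborel (\<lambda>x. (u (x - a n *\<^sub>R e) * g x - u x * g x) / a n)"
        using i1 i3 by (intro integrable_divide_zero Bochner_Integration.integrable_diff) auto
      show "integrable lborel (indicator K :: 'a \<Rightarrow> real)"
        using emeasure_compact_finite[OF K(1)] by (intro integrable_real_indicator) auto
      fix x
      have "\<bar>u (x - a n *\<^sub>R e) - u x\<bar> \<le> a n" using u[of "x - a n *\<^sub>R e" x] e a(1)[of n] by (simp add: dist_norm)
      then have "\<bar>u (x - a n *\<^sub>R e) - u x\<bar> * \<bar>g x\<bar> \<le> a n * indicator K x"
        using K(2)[of x] K(3)[of x] a(1)[of n] by (intro mult_mono) (auto simp: indicator_def)
      moreover have "(u (x - a n *\<^sub>R e) - u x) * g x \<le> \<bar>u (x - a n *\<^sub>R e) - u x\<bar> * \<bar>g x\<bar>"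
        by (simp flip: abs_mult)
      ultimately have "(u (x - a n *\<^sub>R e) - u x) * g x \<le> indicator K x * a n" by (simp add: mult.commute)
      then show "(u (x - a n *\<^sub>R e) * g x - u x * g x) / a n \<le> indicator K x"
        using a(1)[of n] by (simp add: pos_divide_le_eq left_diff_distrib)
    qed
    also have "\<dots> = measure lborel K" by (subst Bochner_Integration.integral_indicator) simp
    finally show ?thesis .
  qed
  ultimately show "(\<integral>x. u x * (g' x \<bullet> e) \<partial>lborel) \<le> measure lborel K" by (intro LIMSEQ_le_const2) auto
qed

lemma bdist_lipschitz: "\<bar>bdist \<Omega> x - bdist \<Omega> y\<bar> \<le> dist x y"
  unfolding bdist_def by (rule infdist_triangle_abs)

text \<open>The divergence is split into its d summands; each component of the field is bounded by 1
  and so contributes at most the volume of \<Omega>.\<close>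

lemma bdist_in_BV:
  fixes \<Omega> :: "(real ^ 'n) set"
  assumes bd: "bounded \<Omega>" and op: "open \<Omega>"
  shows "bdist \<Omega> \<in> BV \<Omega>"
proof -
  have [measurable]: "\<Omega> \<in> sets borel" using op by simp
  have fin: "emeasure lborel \<Omega> < \<infinity>" using bd by (rule emeasure_bounded_finite)
  have "set_integrable lborel (closure \<Omega>) (bdist \<Omega>)"
    unfolding set_integrable_def using bd
    by (intro borel_integrable_compact bdist_continuous) (simp add: compact_closure)
  then have "set_integrable lborel \<Omega> (bdist \<Omega>)"
    by (rule set_integrable_subset) (auto simp: closure_subset[THEN subsetD])
  then have ui: "bdist \<Omega> absolutely_integrable_on \<Omega>"
    unfolding set_integrable_def by (simp add: integrable_completion)
  have "(LINT x:\<Omega>|lebesgue. bdist \<Omega> x * divergence \<phi> x) \<le> CARD('n) * measure lborel \<Omega>"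
    if \<phi>: "\<phi> \<in> test_fields \<Omega>" for \<phi>
  proof -
    define K where "K = closure {x. \<phi> x \<noteq> 0}"
    have K: "compact K" "K \<subseteq> \<Omega>" "\<And>x. x \<in> \<Omega> \<Longrightarrow> norm (\<phi> x) \<le> 1" using \<phi> by (auto simp: test_fields_def K_def)
    have \<phi>0: "\<phi> x = 0" if "x \<notin> K" for x using that closure_subset[of "{x. \<phi> x \<noteq> 0}"] by (auto simp: K_def)
    obtain g :: "'n \<Rightarrow> real ^ 'n \<Rightarrow> real ^ 'n" where "\<forall>i x. ((\<lambda>x. \<phi> x $ i) has_derivative (\<lambda>v. g i x \<bullet> v)) (at x)" "\<forall>i. continuous_on UNIV (g i)"
      "\<forall>x. divergence \<phi> x = (\<Sum>i\<in>UNIV. g i x \<bullet> axis i 1)"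
      using test_field_gradients[OF \<phi>] by (elim exE conjE) (rule that)
    note g = this[rule_format]
    have le1: "\<bar>\<phi> x $ i\<bar> \<le> 1" for x i
    proof (cases "x \<in> \<Omega>")
      case True
      then show ?thesis using K(3)[OF True] component_le_norm_cart[of "\<phi> x" i] by linarith
    next
      case False
      then have "x \<notin> K" using K(2) by blast
      then show ?thesis by (simp add: \<phi>0)
    qed
    have *: "integrable lborel (\<lambda>x. bdist \<Omega> x * (g i x \<bullet> axis i 1))"
      "(\<integral>x. bdist \<Omega> x * (g i x \<bullet> axis i 1) \<partial>lborel) \<le> measure lborel K"
      "\<And>x. x \<notin> K \<Longrightarrow> g i x = 0" for i
      using lipschitz_integral_derivative_le[OF bdist_lipschitz[of \<Omega>] g(1)[of i] g(2)[of i] K(1) _ le1[of _ i],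
          where e = "axis i 1"] \<phi>0 by (auto simp: norm_axis_1)
    have [measurable]: "divergence \<phi> \<in> borel_measurable borel" by (rule divergence_measurable[OF \<phi>])
    have "divergence \<phi> x = 0" if "x \<notin> \<Omega>" for x
    proof -
      have "x \<notin> K" using that K(2) by blast
      then show ?thesis by (simp add: g(3) *(3))
    qed
    then have "(LINT x:\<Omega>|lebesgue. bdist \<Omega> x * divergence \<phi> x) = (\<integral>x. bdist \<Omega> x * divergence \<phi> x \<partial>lebesgue)"
      unfolding set_lebesgue_integral_def by (intro Bochner_Integration.integral_cong refl) (auto simp: indicator_def)
    also have "\<dots> = (\<integral>x. bdist \<Omega> x * divergence \<phi> x \<partial>lborel)"
      by (rule integral_completion) measurable
    also have "\<dots> = (\<integral>x. (\<Sum>i\<in>UNIV. bdist \<Omega> x * (g i x \<bullet> axis i 1)) \<partial>lborel)"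
      by (simp add: g(3) sum_distrib_left)
    also have "\<dots> = (\<Sum>i\<in>UNIV. \<integral>x. bdist \<Omega> x * (g i x \<bullet> axis i 1) \<partial>lborel)"
      using *(1) by (intro Bochner_Integration.integral_sum) auto
    also have "\<dots> \<le> (\<Sum>i\<in>(UNIV :: 'n set). measure lborel \<Omega>)"
    proof (rule sum_mono)
      fix i
      have "measure lborel K \<le> measure lborel \<Omega>"
        using K fin by (intro measure_mono_fmeasurable) (auto simp: fmeasurable_def borel_compact)
      then show "(\<integral>x. bdist \<Omega> x * (g i x \<bullet> axis i 1) \<partial>lborel) \<le> measure lborel \<Omega>" using *(2)[of i] by linarith
    qed
    finally show ?thesis by simp
  qed
  then have "bv_seminorm \<Omega> (bdist \<Omega>) \<le> ennreal (CARD('n) * measure lborel \<Omega>)"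
    unfolding bv_seminorm_def by (intro SUP_least ennreal_leI)
  then show ?thesis using ui by (simp add: BV_def order_le_less_trans)
qed

text \<open>Averaging over translations in direction \<open>e\<close> bounds the volume of a layer from below by its
  length along the lines.\<close>

lemma emeasure_line_ge:
  fixes E :: "'a::euclidean_space set"
  assumes [measurable]: "E \<in> sets borel" "B \<in> sets borel" and "0 < h"
    and line: "\<And>y. y \<in> B \<Longrightarrow> \<exists>a\<ge>-h. a + l \<le> h \<and> (\<forall>s. a \<le> s \<longrightarrow> s < a + l \<longrightarrow> y + s *\<^sub>R e \<in> E)" and "0 \<le> l"
  shows "ennreal l * emeasure lborel B \<le> ennreal (2 * h) * emeasure lborel E"
proof -
  have "ennreal l * emeasure lborel B = (\<integral>\<^sup>+y. ennreal l * indicator B y \<partial>lborel)"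
    by (simp add: nn_integral_cmult_indicator)
  also have "\<dots> \<le> (\<integral>\<^sup>+y. \<integral>\<^sup>+s. indicator {-h..h} s * (indicator B y * indicator E (y + s *\<^sub>R e)) \<partial>lborel \<partial>lborel)"
  proof (rule nn_integral_mono)
    fix y
    show "ennreal l * indicator B y \<le> (\<integral>\<^sup>+s. indicator {-h..h} s * (indicator B y * indicator E (y + s *\<^sub>R e)) \<partial>lborel)"
    proof (cases "y \<in> B")
      case True
      then obtain a where a: "- h \<le> a" "a + l \<le> h" "\<And>s. a \<le> s \<Longrightarrow> s < a + l \<Longrightarrow> y + s *\<^sub>R e \<in> E"
        using line by blast
      have "ennreal l * indicator B y = (\<integral>\<^sup>+s. indicator {a..<a + l} s \<partial>lborel)" using True \<open>0 \<le> l\<close> by simp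
      also have "\<dots> \<le> (\<integral>\<^sup>+s. indicator {-h..h} s * (indicator B y * indicator E (y + s *\<^sub>R e)) \<partial>lborel)"
        using a True by (intro nn_integral_mono) (auto simp: indicator_def)
      finally show ?thesis .
    qed simp
  qed
  also have "\<dots> = (\<integral>\<^sup>+s. \<integral>\<^sup>+y. indicator {-h..h} s * (indicator B y * indicator E (y + s *\<^sub>R e)) \<partial>lborel \<partial>lborel)"
    by (rule nn_integral_swap) measurable
  also have "\<dots> \<le> (\<integral>\<^sup>+s. emeasure lborel E * indicator {-h..h} s \<partial>lborel)"
  proof (rule nn_integral_mono)
    fix s :: real
    have "(\<integral>\<^sup>+y. indicator {-h..h} s * (indicator B y * indicator E (y + s *\<^sub>R e)) \<partial>lborel)
        \<le> (\<integral>\<^sup>+y. indicator {-h..h} s * indicator E (y + s *\<^sub>R e) \<partial>lborel)"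
      by (intro nn_integral_mono) (auto simp: indicator_def)
    also have "\<dots> = (\<integral>\<^sup>+y. indicator {-h..h} s * indicator E y \<partial>lborel)"
      by (rule nn_integral_translate) measurable
    also have "\<dots> = emeasure lborel E * indicator {-h..h} s"
      by (subst nn_integral_cmult) (auto simp: mult.commute)
    finally show "(\<integral>\<^sup>+y. indicator {-h..h} s * (indicator B y * indicator E (y + s *\<^sub>R e)) \<partial>lborel)
        \<le> emeasure lborel E * indicator {-h..h} s" .
  qed
  also have "\<dots> = ennreal (2 * h) * emeasure lborel E"
    using \<open>0 < h\<close> by (simp add: nn_integral_cmult_indicator mult.commute)
  finally show ?thesis .
qed

section \<open>Mass of the weights near the boundary\<close>

text \<open>The dyadic slabs are cut by the height \<rho> and not by the distance, since \<rho> has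
  slope 1 along e and makes their thickness on lines exact. The volume of the k-th slab and the
  factor 1/\<delta> compensate each other, so the mass is at least a fixed multiple of the dyadic
  sum of the weights, which is at least a for every m.\<close>

lemma hardy_weight_mass_ge:
  fixes \<Omega> :: "(real ^ 'n) set"
  assumes ch: "boundary_chart \<Omega> p e r K \<rho>" and R: "0 < R" "\<forall>x\<in>\<Omega>. bdist \<Omega> x < R" and s: "0 < s"
  shows "\<exists>c>0. \<forall>m\<ge>1. ennreal c \<le> (\<integral>\<^sup>+x. hardy_weight \<Omega> R m x * indicator (ball p s \<inter> \<Omega>) x \<partial>lborel)"
proof -
  have K: "1 \<le> K" and e: "norm e = 1" and lip: "\<bar>\<rho> x - \<rho> y\<bar> \<le> K * dist x y" and \<rho>p: "\<rho> p = 0"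
    and iff: "x \<in> ball p r \<Longrightarrow> x \<in> \<Omega> \<longleftrightarrow> 0 < \<rho> x" and op: "open \<Omega>" and fr: "frontier \<Omega> \<noteq> {}"
    and shift: "\<rho> (x + t *\<^sub>R e) = \<rho> x + t" and r: "0 < r" for x y t
    using ch by (auto simp: boundary_chart_def)
  have "continuous_on UNIV \<rho>"
  proof (rule lipschitz_on_continuous_on[of K])
    show "K-lipschitz_on UNIV \<rho>" using lip K by (intro lipschitz_onI) (auto simp: dist_real_def)
  qed
  then have [measurable]: "\<rho> \<in> borel_measurable borel" by (rule borel_measurable_continuous_onI)
  have [measurable]: "\<Omega> \<in> sets borel" using op by simp
  define s1 where "s1 = min s (r / (2 * K))"
  \<comment> \<open>The first bound keeps the slabs within reach of lines from B that stay in the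
    ball of radius s1; the second makes a \<le> 1.\<close>
  define b where "b = min (s1 / 4) (2 * K * R)"
  \<comment> \<open>Chosen so that the distance divided by R is at least a / 2^k on the k-th slab,
    where the height is at least b / 2^(k+1) and at most K times the distance.\<close>
  define a where "a = b / (2 * K * R)"
  define E where "E k = {x \<in> ball p s1. b / 2 ^ Suc k \<le> \<rho> x \<and> \<rho> x < b / 2 ^ k}" for k :: nat
  \<comment> \<open>Heights on this ball are at most s1 / 4 in absolute value, so shifts by at most
    s1 / 2 reach every slab.\<close>
  define B where "B = ball p (s1 / (4 * K))"
  have s1: "0 < s1" "s1 \<le> s" "s1 \<le> r / (2 * K)" using s r K by (auto simp: s1_def)
  have b: "0 < b" "b \<le> s1 / 4" "b \<le> 2 * K * R" using s1 K R by (auto simp: b_def)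
  have a: "0 < a" "a \<le> 1" using b K R by (auto simp: a_def)
  have "r / (2 * K) \<le> r / 2" using K r by (intro divide_left_mono) auto
  then have s1r: "s1 \<le> r / 2" "s1 \<le> r" using s1(3) r by linarith+
  have [measurable]: "E k \<in> sets borel" for k unfolding E_def by measurable
  have [measurable]: "B \<in> sets borel" by (simp add: B_def)
  have E_sub: "x \<in> ball p s \<inter> \<Omega>" if "x \<in> E k" for x k
  proof -
    have "0 < b / 2 ^ Suc k" using b by simp
    then have "0 < \<rho> x" using that by (simp add: E_def)
    then show ?thesis using that iff[of x] s1r s1(2) by (auto simp: E_def)
  qed
  have vol: "ennreal (b / 2 ^ Suc k) * emeasure lborel B \<le> ennreal (2 * (s1 / 2)) * emeasure lborel (E k)" for k
  proof (rule emeasure_line_ge[where e = e])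
    fix y assume "y \<in> B"
    then have y: "dist p y < s1 / (4 * K)" by (simp add: B_def)
    then have "K * dist p y \<le> s1 / 4" using K by (simp add: pos_less_divide_eq mult_ac)
    then have \<rho>y: "\<bar>\<rho> y\<bar> \<le> s1 / 4" using lip[of y p] \<rho>p by (simp add: dist_commute)
    have "s1 / (4 * K) \<le> s1 / 4" using s1 K by (simp add: divide_simps)
    then have y': "dist p y < s1 / 4" using y by linarith
    have b2: "0 < b / 2 ^ Suc k" "b / 2 ^ k \<le> b" "b / 2 ^ Suc k + b / 2 ^ Suc k = b / 2 ^ k" using b by (auto simp: divide_simps)
    show "\<exists>a\<ge>- (s1 / 2). a + b / 2 ^ Suc k \<le> s1 / 2 \<and> (\<forall>t. a \<le> t \<longrightarrow> t < a + b / 2 ^ Suc k \<longrightarrow> y + t *\<^sub>R e \<in> E k)"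
    proof (intro exI[of _ "b / 2 ^ Suc k - \<rho> y"] conjI allI impI)
      show "- (s1 / 2) \<le> b / 2 ^ Suc k - \<rho> y" "b / 2 ^ Suc k - \<rho> y + b / 2 ^ Suc k \<le> s1 / 2"
        using \<rho>y b2 b s1 by linarith+
      fix t assume t: "b / 2 ^ Suc k - \<rho> y \<le> t" "t < b / 2 ^ Suc k - \<rho> y + b / 2 ^ Suc k"
      have "\<bar>t\<bar> \<le> s1 / 2" using t \<rho>y b2 b s1 by linarith
      moreover have "dist y (y + t *\<^sub>R e) = \<bar>t\<bar>" using e by (simp add: dist_norm)
      ultimately have "dist p (y + t *\<^sub>R e) < s1" using dist_triangle[of p "y + t *\<^sub>R e" y] y' s1 by linarith
      moreover have "b / 2 ^ Suc k \<le> \<rho> (y + t *\<^sub>R e)" "\<rho> (y + t *\<^sub>R e) < b / 2 ^ k"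
        unfolding shift using t b2 by linarith+
      ultimately show "y + t *\<^sub>R e \<in> E k" by (simp add: E_def)
    qed
  qed (use s1 b in auto)
  have w: "ennreal (2 ^ k / b * log_weight m (a / 2 ^ k)) \<le> hardy_weight \<Omega> R m x" if x: "x \<in> E k" for x k m
    unfolding hardy_weight_def
  proof (intro ennreal_leI mult_mono)
    have x\<Omega>: "x \<in> \<Omega>" and dx: "dist p x < s1" using E_sub[OF x] x by (auto simp: E_def)
    have pos: "0 < bdist \<Omega> x" by (rule bdist_frontier_pos[OF op x\<Omega> fr])
    have "bdist \<Omega> x \<le> \<rho> x" using dx s1(3) by (intro chart_bdist_le_height[OF ch x\<Omega>]) linarith
    then have "bdist \<Omega> x \<le> b / 2 ^ k" using x by (simp add: E_def)
    then have "1 / (b / 2 ^ k) \<le> 1 / bdist \<Omega> x" using pos b(1) by (intro divide_left_mono) auto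
    then show "2 ^ k / b \<le> 1 / bdist \<Omega> x" by simp
    have "\<rho> x \<le> K * bdist \<Omega> x" using dx s1r by (intro chart_height_le_bdist[OF ch x\<Omega>]) linarith
    then have "b / 2 ^ Suc k \<le> K * bdist \<Omega> x" using x by (simp add: E_def)
    then have "a / 2 ^ k \<le> bdist \<Omega> x / R" using K R by (simp add: a_def divide_simps mult_ac)
    then show "log_weight m (a / 2 ^ k) \<le> log_weight m (bdist \<Omega> x / R)"
      using a R x\<Omega> pos by (intro log_weight_mono) (auto simp: less_imp_le)
    show "0 \<le> log_weight m (a / 2 ^ k)"
      using a by (intro log_weight_nonneg) (auto simp: divide_le_eq intro: order_trans[of a 1])
    show "0 \<le> 1 / bdist \<Omega> x" using pos by simp
  qed
  \<comment> \<open>The product of the weight factor 2^k / b, the thickness b / 2^(k+1) and the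
    volume of B, divided by the length s1 of the range of shifts.\<close>
  define c where "c = measure lborel B / (2 * s1)"
  have "0 < measure lborel B" unfolding B_def using s1 K by (intro content_ball_pos) auto
  then have c: "0 < c" using s1 by (simp add: c_def)
  have B: "emeasure lborel B = ennreal (measure lborel B)"
    using emeasure_lborel_ball_finite unfolding B_def by (intro emeasure_eq_ennreal_measure) (auto simp: less_top)
  have "ennreal (c * a) \<le> (\<integral>\<^sup>+x. hardy_weight \<Omega> R m x * indicator (ball p s \<inter> \<Omega>) x \<partial>lborel)" if "1 \<le> m" for m
  proof -
    let ?M = "density lborel (hardy_weight \<Omega> R m)"
    have lw: "0 \<le> log_weight m (a / 2 ^ k)" for k
      using a by (intro log_weight_nonneg) (auto simp: divide_le_eq intro: order_trans[of a 1])
    have "ennreal (c * a) = ennreal c * ennreal a" using c a by (simp add: ennreal_mult)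
    also have "\<dots> \<le> ennreal c * (\<Sum>k. ennreal (log_weight m (a / 2 ^ k)))"
      by (intro mult_left_mono suminf_log_weight_ge that a) auto
    also have "\<dots> = (\<Sum>k. ennreal c * ennreal (log_weight m (a / 2 ^ k)))" by simp
    also have "\<dots> \<le> (\<Sum>k. emeasure ?M (E k))"
    proof (rule suminf_le)
      fix k
      have "ennreal (2 ^ k / b * log_weight m (a / 2 ^ k)) * (ennreal (b / 2 ^ Suc k) * emeasure lborel B)
          \<le> ennreal (2 ^ k / b * log_weight m (a / 2 ^ k)) * (ennreal s1 * emeasure lborel (E k))"
        using vol[of k] by (intro mult_left_mono) auto
      moreover have "ennreal (2 ^ k / b * log_weight m (a / 2 ^ k)) * (ennreal (b / 2 ^ Suc k) * emeasure lborel B)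
          = ennreal s1 * (ennreal c * ennreal (log_weight m (a / 2 ^ k)))"
        unfolding B using b s1 c lw[of k] by (simp add: c_def field_simps flip: ennreal_mult)
      ultimately have "ennreal s1 * (ennreal c * ennreal (log_weight m (a / 2 ^ k)))
          \<le> ennreal s1 * (ennreal (2 ^ k / b * log_weight m (a / 2 ^ k)) * emeasure lborel (E k))"
        by (simp add: mult_ac)
      moreover have "ennreal s1 \<noteq> 0" "ennreal s1 \<noteq> top" using s1 by simp_all
      ultimately have "ennreal c * ennreal (log_weight m (a / 2 ^ k))
          \<le> ennreal (2 ^ k / b * log_weight m (a / 2 ^ k)) * emeasure lborel (E k)"
        using ennreal_mult_le_mult_iff by blast
      also have "\<dots> = (\<integral>\<^sup>+x. ennreal (2 ^ k / b * log_weight m (a / 2 ^ k)) * indicator (E k) x \<partial>lborel)"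
        by (simp add: nn_integral_cmult_indicator)
      also have "\<dots> \<le> (\<integral>\<^sup>+x. hardy_weight \<Omega> R m x * indicator (E k) x \<partial>lborel)"
        using w by (intro nn_integral_mono) (auto simp: indicator_def)
      also have "\<dots> = emeasure ?M (E k)" by (rule emeasure_density[symmetric]) measurable
      finally show "ennreal c * ennreal (log_weight m (a / 2 ^ k)) \<le> emeasure ?M (E k)" .
    qed auto
    also have "\<dots> = emeasure ?M (\<Union>k. E k)"
    proof (rule suminf_emeasure)
      have "j \<le> k" if "x \<in> E j" "x \<in> E k" for x j k
      proof (rule ccontr)
        assume "\<not> j \<le> k"
        then have "(2::real) ^ Suc k \<le> 2 ^ j" by (intro power_increasing) auto
        then have "b / 2 ^ j \<le> b / 2 ^ Suc k" using b by (intro divide_left_mono) auto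
        then show False using that by (auto simp: E_def)
      qed
      then show "disjoint_family E" by (auto simp: disjoint_family_on_def intro: antisym)
    qed auto
    also have "\<dots> \<le> emeasure ?M (ball p s \<inter> \<Omega>)" using E_sub by (intro emeasure_mono) auto
    also have "\<dots> = (\<integral>\<^sup>+x. hardy_weight \<Omega> R m x * indicator (ball p s \<inter> \<Omega>) x \<partial>lborel)"
      by (rule emeasure_density) measurable
    finally show ?thesis .
  qed
  moreover have "0 < c * a" using c a by simp
  ultimately show ?thesis by blast
qed

text \<open>The radius of the ball about a boundary point is half the average: there the distance is
  at most half the average, so it differs from the average by at least as much.\<close>

lemma hardy_integral_bdist_ge:
  fixes \<Omega> :: "(real ^ 'n) set"
  assumes bd: "bounded \<Omega>" and lip: "lipschitz_domain \<Omega>" and R: "0 < R" "\<forall>x\<in>\<Omega>. bdist \<Omega> x < R"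
  shows "\<exists>c>0. \<forall>m\<ge>1. ennreal c \<le> hardy_integral \<Omega> R m (bdist \<Omega>)"
proof -
  have op: "open \<Omega>" and ne: "\<Omega> \<noteq> {}" using lip by (auto simp: lipschitz_domain_def)
  have fr: "frontier \<Omega> \<noteq> {}" by (rule bounded_domain_frontier[OF bd ne])
  have [measurable]: "\<Omega> \<in> sets borel" using op by simp
  obtain p where p: "p \<in> frontier \<Omega>" using fr by blast
  obtain e r K \<rho> where ch: "boundary_chart \<Omega> p e r K \<rho>" using lipschitz_domain_chart[OF lip p] by blast
  let ?a = "average \<Omega> (bdist \<Omega>)"
  have fin: "emeasure lborel \<Omega> < \<infinity>" using bd by (rule emeasure_bounded_finite)
  have nz: "emeasure lborel \<Omega> \<noteq> 0"
    using op ne open_not_negligible[of \<Omega>] by (auto simp: negligible_iff_emeasure0 emeasure_completion borel_open)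
  have "0 < ?a"
  proof -
    have int: "integrable lebesgue (\<lambda>x. indicator \<Omega> x * bdist \<Omega> x)"
      using bdist_in_BV[OF bd op] by (simp add: BV_def set_integrable_def)
    have nonneg: "0 \<le> indicator \<Omega> x * bdist \<Omega> x" for x by (simp add: bdist_def infdist_nonneg)
    have "(\<integral>x. indicator \<Omega> x * bdist \<Omega> x \<partial>lebesgue) \<noteq> 0"
    proof
      assume "(\<integral>x. indicator \<Omega> x * bdist \<Omega> x \<partial>lebesgue) = 0"
      then have "AE x in lebesgue. indicator \<Omega> x * bdist \<Omega> x = 0"
        using integral_nonneg_eq_0_iff_AE[OF int] nonneg by auto
      then have "AE x in lebesgue. x \<notin> \<Omega>"
        by eventually_elim (use bdist_frontier_pos[OF op _ fr] in \<open>force simp: indicator_def\<close>)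
      then have "AE x in lborel. x \<notin> \<Omega>" by (simp add: AE_completion_iff)
      then have "emeasure lborel \<Omega> = 0" by (subst (asm) AE_iff_measurable[of \<Omega>]) auto
      then show False using nz by simp
    qed
    moreover have "0 \<le> (\<integral>x. indicator \<Omega> x * bdist \<Omega> x \<partial>lebesgue)" 
      by (rule Bochner_Integration.integral_nonneg[OF nonneg])
    moreover have "0 < measure lebesgue \<Omega>"
      using nz fin by (simp add: measure_def enn2real_positive_iff zero_less_iff_neq_zero)
    ultimately show ?thesis by (simp add: average_def set_lebesgue_integral_def)
  qed
  then obtain c where c: "0 < c"
    "\<And>m. 1 \<le> m \<Longrightarrow> ennreal c \<le> (\<integral>\<^sup>+x. hardy_weight \<Omega> R m x * indicator (ball p (?a / 2) \<inter> \<Omega>) x \<partial>lborel)"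
    using hardy_weight_mass_ge[OF ch R, of "?a / 2"] by auto
  have [measurable]: "ball p (?a / 2) \<in> sets borel" by simp
  have "ennreal (?a / 2 * c) \<le> hardy_integral \<Omega> R m (bdist \<Omega>)" if "1 \<le> m" for m
  proof -
    have "ennreal (?a / 2 * c) = ennreal (?a / 2) * ennreal c" using \<open>0 < ?a\<close> c by (intro ennreal_mult) auto
    also have "\<dots> \<le> ennreal (?a / 2) * (\<integral>\<^sup>+x. hardy_weight \<Omega> R m x * indicator (ball p (?a / 2) \<inter> \<Omega>) x \<partial>lborel)"
      by (rule mult_left_mono[OF c(2)[OF that]]) simp
    also have "\<dots> = (\<integral>\<^sup>+x. ennreal (?a / 2) * (hardy_weight \<Omega> R m x * indicator (ball p (?a / 2) \<inter> \<Omega>) x) \<partial>lborel)"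
      by (rule nn_integral_cmult[symmetric]) measurable
    also have "\<dots> \<le> (\<integral>\<^sup>+x. ennreal \<bar>indicator \<Omega> x * bdist \<Omega> x - ?a\<bar> * hardy_weight \<Omega> R m x * indicator \<Omega> x \<partial>lborel)"
    proof (rule nn_integral_mono)
      fix x
      show "ennreal (?a / 2) * (hardy_weight \<Omega> R m x * indicator (ball p (?a / 2) \<inter> \<Omega>) x)
          \<le> ennreal \<bar>indicator \<Omega> x * bdist \<Omega> x - ?a\<bar> * hardy_weight \<Omega> R m x * indicator \<Omega> x"
      proof (cases "x \<in> ball p (?a / 2) \<inter> \<Omega>")
        case True
        then have "bdist \<Omega> x \<le> ?a / 2" using bdist_le_dist[OF p, of x] by (simp add: dist_commute)
        then have "?a / 2 \<le> \<bar>bdist \<Omega> x - ?a\<bar>" by linarith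
        then have "?a / 2 \<le> \<bar>indicator \<Omega> x * bdist \<Omega> x - ?a\<bar>" using True by simp
        then show ?thesis using True by (auto intro!: mult_right_mono ennreal_leI)
      qed simp
    qed
    also have "\<dots> = hardy_integral \<Omega> R m (bdist \<Omega>)"
      by (rule hardy_integral_eq[OF op fr, symmetric]) auto
    finally show ?thesis .
  qed
  then show ?thesis using \<open>0 < ?a\<close> c(1) by (intro exI[of _ "?a / 2 * c"]) auto
qed

theorem theorem1:
  fixes \<Omega> :: "(real ^ 'n) set"
  assumes "bounded \<Omega>" and "lipschitz_domain \<Omega>"
  shows
    "(\<exists>C::real. C > 0 \<and>
        (\<forall>R>0. (\<forall>x\<in>\<Omega>. bdist \<Omega> x < R) \<longrightarrow>
          (\<forall>m\<ge>2. \<forall>u\<in>BV \<Omega>.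
             hardy_integral \<Omega> R m u \<le> ennreal (C * 2 ^ m) * bv_seminorm \<Omega> u)))
     \<and>
     (\<exists>C::real. C > 0 \<and>
        (\<forall>R>0. (\<forall>x\<in>\<Omega>. bdist \<Omega> x < R) \<longrightarrow>
          (\<forall>\<alpha>::real. 0 < \<alpha> \<and> \<alpha> < 1 / 2 \<longrightarrow>
            (\<forall>u\<in>BV \<Omega>.
               hardy_series \<Omega> R \<alpha> u
                 \<le> ennreal (C * (4 * \<alpha>\<^sup>2 / (1 - 2 * \<alpha>))) * bv_seminorm \<Omega> u))))
     \<and>
     (\<forall>R>0. (\<forall>x\<in>\<Omega>. bdist \<Omega> x < R) \<longrightarrow>
        (\<forall>\<alpha>::real. \<alpha> \<ge> 1 \<longrightarrow>
           \<not> (\<exists>C'::real. \<forall>u\<in>BV \<Omega>.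
                hardy_series \<Omega> R \<alpha> u \<le> ennreal C' * bv_seminorm \<Omega> u)))"
proof (intro conjI)
  obtain C where "0 < C" and bound: "\<And>R m u. 0 < R \<Longrightarrow> \<forall>x\<in>\<Omega>. bdist \<Omega> x < R \<Longrightarrow> 1 \<le> m \<Longrightarrow> u \<in> BV \<Omega>
      \<Longrightarrow> hardy_integral \<Omega> R m u \<le> ennreal C * bv_seminorm \<Omega> u"
    using hardy_integral_le[OF assms] by blast
  have i: "hardy_integral \<Omega> R m u \<le> ennreal (C * 2 ^ m) * bv_seminorm \<Omega> u"
    if "0 < R" "\<forall>x\<in>\<Omega>. bdist \<Omega> x < R" "2 \<le> m" "u \<in> BV \<Omega>" for R m u
  proof -
    have "C * 1 \<le> C * 2 ^ m" using \<open>0 < C\<close> by (intro mult_left_mono) auto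
    then have "ennreal C * bv_seminorm \<Omega> u \<le> ennreal (C * 2 ^ m) * bv_seminorm \<Omega> u"
      by (intro mult_right_mono ennreal_leI) auto
    then show ?thesis using bound[OF that(1,2) _ that(4), of m] that(3) by (auto intro: order_trans)
  qed
  show "\<exists>C::real. C > 0 \<and> (\<forall>R>0. (\<forall>x\<in>\<Omega>. bdist \<Omega> x < R) \<longrightarrow> (\<forall>m\<ge>2. \<forall>u\<in>BV \<Omega>.
      hardy_integral \<Omega> R m u \<le> ennreal (C * 2 ^ m) * bv_seminorm \<Omega> u))"
    using i \<open>0 < C\<close> by blast
  have ii: "hardy_series \<Omega> R \<alpha> u \<le> ennreal (C * (4 * \<alpha>\<^sup>2 / (1 - 2 * \<alpha>))) * bv_seminorm \<Omega> u"
    if R: "0 < R" "\<forall>x\<in>\<Omega>. bdist \<Omega> x < R" and \<alpha>: "0 < \<alpha>" "\<alpha> < 1 / 2" and u: "u \<in> BV \<Omega>" for R \<alpha> u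
  proof -
    \<comment> \<open>The series starts with the weight of index 2, which puts \<alpha>^2 in front
      of the geometric series.\<close>
    have "(\<lambda>m. C * \<alpha>\<^sup>2 * \<alpha> ^ m) sums (C * \<alpha>\<^sup>2 * (1 / (1 - \<alpha>)))"
      using \<alpha> by (intro sums_mult geometric_sums) auto
    then have sum: "(\<Sum>m. ennreal (C * \<alpha>\<^sup>2 * \<alpha> ^ m)) = ennreal (C * \<alpha>\<^sup>2 * (1 / (1 - \<alpha>)))"
      using \<open>0 < C\<close> \<alpha> by (intro suminf_ennreal_eq) auto
    have "hardy_series \<Omega> R \<alpha> u \<le> (\<Sum>m. ennreal (C * \<alpha>\<^sup>2 * \<alpha> ^ m) * bv_seminorm \<Omega> u)"
      unfolding hardy_series_def
    proof (rule suminf_le)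
      fix m
      have "ennreal (\<alpha> ^ (m + 2)) * hardy_integral \<Omega> R (m + 2) u \<le> ennreal (\<alpha> ^ (m + 2)) * (ennreal C * bv_seminorm \<Omega> u)"
        by (intro mult_left_mono bound R u) auto
      also have "\<dots> = ennreal (C * \<alpha>\<^sup>2 * \<alpha> ^ m) * bv_seminorm \<Omega> u"
      proof -
        have "ennreal (\<alpha> ^ (m + 2)) * ennreal C = ennreal (\<alpha> ^ (m + 2) * C)"
          using \<open>0 < C\<close> \<alpha> by (intro ennreal_mult[symmetric]) auto
        also have "\<alpha> ^ (m + 2) * C = C * \<alpha>\<^sup>2 * \<alpha> ^ m" by (simp add: power_add power2_eq_square mult_ac)
        finally show ?thesis by (simp only: mult.assoc[symmetric])
      qed
      finally show "ennreal (\<alpha> ^ (m + 2)) * hardy_integral \<Omega> R (m + 2) u \<le> ennreal (C * \<alpha>\<^sup>2 * \<alpha> ^ m) * bv_seminorm \<Omega> u" .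
    qed auto
    also have "\<dots> = ennreal (C * \<alpha>\<^sup>2 * (1 / (1 - \<alpha>))) * bv_seminorm \<Omega> u" by (simp only: ennreal_suminf_multc sum)
    also have "\<dots> \<le> ennreal (C * (4 * \<alpha>\<^sup>2 / (1 - 2 * \<alpha>))) * bv_seminorm \<Omega> u"
    proof (intro mult_right_mono ennreal_leI)
      have "\<alpha>\<^sup>2 / (1 - \<alpha>) \<le> 4 * \<alpha>\<^sup>2 / (1 - 2 * \<alpha>)" using \<alpha> by (intro frac_le) auto
      then have "C * (\<alpha>\<^sup>2 / (1 - \<alpha>)) \<le> C * (4 * \<alpha>\<^sup>2 / (1 - 2 * \<alpha>))"
        using \<open>0 < C\<close> by (intro mult_left_mono) auto
      then show "C * \<alpha>\<^sup>2 * (1 / (1 - \<alpha>)) \<le> C * (4 * \<alpha>\<^sup>2 / (1 - 2 * \<alpha>))" by simp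
    qed auto
    finally show ?thesis .
  qed
  show "\<exists>C::real. C > 0 \<and> (\<forall>R>0. (\<forall>x\<in>\<Omega>. bdist \<Omega> x < R) \<longrightarrow> (\<forall>\<alpha>::real. 0 < \<alpha> \<and> \<alpha> < 1 / 2 \<longrightarrow> (\<forall>u\<in>BV \<Omega>.
      hardy_series \<Omega> R \<alpha> u \<le> ennreal (C * (4 * \<alpha>\<^sup>2 / (1 - 2 * \<alpha>))) * bv_seminorm \<Omega> u)))"
    using ii \<open>0 < C\<close> by blast
  show "\<forall>R>0. (\<forall>x\<in>\<Omega>. bdist \<Omega> x < R) \<longrightarrow> (\<forall>\<alpha>::real. \<alpha> \<ge> 1 \<longrightarrow>
      \<not> (\<exists>C'::real. \<forall>u\<in>BV \<Omega>. hardy_series \<Omega> R \<alpha> u \<le> ennreal C' * bv_seminorm \<Omega> u))"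
  proof (intro allI impI notI)
    fix R \<alpha> :: real
    assume R: "0 < R" "\<forall>x\<in>\<Omega>. bdist \<Omega> x < R" and \<alpha>: "1 \<le> \<alpha>"
      and "\<exists>C'::real. \<forall>u\<in>BV \<Omega>. hardy_series \<Omega> R \<alpha> u \<le> ennreal C' * bv_seminorm \<Omega> u"
    moreover have BV: "bdist \<Omega> \<in> BV \<Omega>" using assms by (intro bdist_in_BV) (auto simp: lipschitz_domain_def)
    ultimately obtain C' where "hardy_series \<Omega> R \<alpha> (bdist \<Omega>) \<le> ennreal C' * bv_seminorm \<Omega> (bdist \<Omega>)" by blast
    \<comment> \<open>The seminorm of the distance is finite, and \<open>ennreal C'\<close> is
      finite for every real C', a negative one included.\<close>
    also have "\<dots> < top" using BV by (simp add: BV_def ennreal_mult_less_top)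
    finally have fin: "hardy_series \<Omega> R \<alpha> (bdist \<Omega>) < top" .
    obtain c where c: "0 < c" "\<And>m. 1 \<le> m \<Longrightarrow> ennreal c \<le> hardy_integral \<Omega> R m (bdist \<Omega>)"
      using hardy_integral_bdist_ge[OF assms R] by blast
    \<comment> \<open>As \<alpha> \<ge> 1, the powers do not decay, and no term of the series falls
      below the uniform bound c.\<close>
    have "ennreal c \<le> ennreal (\<alpha> ^ (m + 2)) * hardy_integral \<Omega> R (m + 2) (bdist \<Omega>)" for m
    proof -
      have "1 \<le> \<alpha> ^ (m + 2)" using \<alpha> by (rule one_le_power)
      then have "1 * ennreal c \<le> ennreal (\<alpha> ^ (m + 2)) * hardy_integral \<Omega> R (m + 2) (bdist \<Omega>)"
        by (intro mult_mono c(2)) (auto simp flip: ennreal_1 intro: ennreal_leI)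
      then show ?thesis by simp
    qed
    then have "(\<Sum>m::nat. ennreal c) \<le> hardy_series \<Omega> R \<alpha> (bdist \<Omega>)"
      unfolding hardy_series_def by (intro suminf_le) auto
    moreover have "(\<Sum>m::nat. ennreal c) = top"
    proof (rule ccontr)
      assume "(\<Sum>m::nat. ennreal c) \<noteq> top"
      then have "summable (\<lambda>m::nat. c)" using c(1) by (intro summable_suminf_not_top) auto
      then have "c = 0" by (simp add: summable_const_iff)
      then show False using c(1) by simp
    qed
    ultimately show False using fin by (simp add: top_unique)
  qed
qed

end
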